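(* Let $\mathcal{A}$, $\mathcal{B}$, $X$, $Y$, $V$, $H$, $A$, $B$ and the spaces $X_s$ be as in the context. Assume that there exist constants $T>0$, $c>0$ and $\beta>-\tfrac12$ such that for every $\Delta t>0$ and every $z^0\in D(A)=D(\mathcal{A})\times V$, the solution $(u^k)$ of $$\frac{\tilde u^{k+1}-u^k}{\Delta t}=A\Big(\frac{u^k+\tilde u^{k+1}}{2}\Big),\qquad \frac{u^{k+1}-\tilde u^{k+1}}{\Delta t}=(\Delta t)^2A^2u^{k+1}\quad(k\in\mathbb{N}),\qquad u^0=z^0,$$ satisfies $$c\,\|u^0\|^2_{X_{-\beta}\times X_{-\beta-\frac12}}\le \Delta t\sum_{k\Delta t\in[0,T]}\Big\|B^*\Big(\frac{u^k+\tilde u^{k+1}}{2}\Big)\Big\|_Y^2+\Delta t\sum_{k\Delta t\in[0,T]}(\Delta t)^2\|Au^{k+1}\|_H^2+\Delta t\sum_{k\Delta t\in[0,T]}(\Delta t)^5\|A^2u^{k+1}\|_H^2 .$$ Then there exists $M>0$ such that for every $0<\Delta t<1$ and every $z^0\in D(A)$, the solution $(z^k)$ of $$\frac{\tilde z^{k+1}-z^k}{\Delta t}=A\Big(\frac{z^k+\tilde z^{k+1}}{2}\Big)-BB^*\Big(\frac{z^k+\tilde z^{k+1}}{2}\Big),\qquad \frac{z^{k+1}-\tilde z^{k+1}}{\Delta t}=(\Delta t)^2A^2z^{k+1}\quad(k\in\mathbb{N}),$$ with initial datum $z^0$, satisfies $$\frac12\|z^k\|_H^2\le \frac{M}{(1+k\Delta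 t)^{\frac{1}{1+2\beta}}}\,\|z^0\|_{D(A)}^2\qquad\text{for all }k\ge 0 .$$
   Context: $X$ and $Y$ are real Hilbert spaces ($Y$ identified with its dual). $\mathcal{A}:D(\mathcal{A})\subset X\to X$ is a self-adjoint positive operator with $\mathcal{A}^{-1}$ compact in $X$, and $\mathcal{B}\in\mathfrak{L}(Y,X)$ is a bounded linear operator. $V=D(\mathcal{A}^{1/2})$ with norm $\|x\|_V=\|\mathcal{A}^{1/2}x\|_X$, and $H=V\times X$. For $s\ge0$, $X_s=D(\mathcal{A}^s)$ with norm $\|\mathcal{A}^s x\|_X$, and $X_{-s}$ is the dual of $D(\mathcal{A}^s)$ with respect to the pivot space $X$ (norm $\|\mathcal{A}^{-s}x\|_X$). On $H$, $A=\begin{pmatrix}0&I\\-\mathcal{A}&0\end{pmatrix}$ with domain $D(A)=D(\mathcal{A})\times V$, normed by $\|(w_0,w_1)\|_{D(A)}^2=\|\mathcal{A}w_0\|_X^2+\|\mathcal{A}^{1/2}w_1\|_X^2$; $A$ is skew-adjoint with compact resolvent. $B=\begin{pmatrix}0\\ \mathcal{B}\end{pmatrix}\in\mathfrak{L}(Y,H)$ and $B^*=(0,\mathcal{B}^* )\in\mathfrak{L}(H,Y)$. The constant $c$ does not depend on $\Delta t$ or $z^0$; the constant $M$ does not depend on $\Delta t$, $k$ or $z^0$. *)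

theory Defs
  imports "HOL-Analysis.Analysis"
begin

text \<open>
  An unbounded operator on \<open>X\<close> is a pair of a domain \<open>D\<close> and a total function \<open>\<A>\<close> of which only
  the values on \<open>D\<close> are meaningful.
\<close>

definition linear_op_on :: "'x::real_vector set \<Rightarrow> ('x \<Rightarrow> 'x) \<Rightarrow> bool" where
  "linear_op_on D \<A> \<longleftrightarrow> subspace D \<and>
     (\<forall>x\<in>D. \<forall>y\<in>D. \<A> (x + y) = \<A> x + \<A> y) \<and> (\<forall>a. \<forall>x\<in>D. \<A> (a *\<^sub>R x) = a *\<^sub>R \<A> x)"

text \<open>
  The graph of the Hilbert space adjoint; it is the graph of a function when \<open>D\<close> is dense.
\<close>

definition adjoint_graph :: "'x::real_inner set \<Rightarrow> ('x \<Rightarrow> 'x) \<Rightarrow> ('x \<times> 'x) set" where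
  "adjoint_graph D \<A> = {(y, z). \<forall>x\<in>D. \<A> x \<bullet> y = x \<bullet> z}"

definition self_adjoint_op :: "'x::real_inner set \<Rightarrow> ('x \<Rightarrow> 'x) \<Rightarrow> bool" where
  "self_adjoint_op D \<A> \<longleftrightarrow> linear_op_on D \<A> \<and> closure D = UNIV \<and>
     adjoint_graph D \<A> = {(x, \<A> x) | x. x \<in> D}"

definition positive_op :: "'x::real_inner set \<Rightarrow> ('x \<Rightarrow> 'x) \<Rightarrow> bool" where
  "positive_op D \<A> \<longleftrightarrow> (\<forall>x\<in>D. x \<noteq> 0 \<longrightarrow> \<A> x \<bullet> x > 0)"

definition compact_linear_map :: "('x::real_normed_vector \<Rightarrow> 'y::real_normed_vector) \<Rightarrow> bool" where
  "compact_linear_map K \<longleftrightarrow> linear K \<and> compact (closure (K ` cball 0 1))"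

definition has_compact_inverse :: "'x::real_normed_vector set \<Rightarrow> ('x \<Rightarrow> 'x) \<Rightarrow> bool" where
  "has_compact_inverse D \<A> \<longleftrightarrow> bij_betw \<A> D UNIV \<and> compact_linear_map (inv_into D \<A>)"


text \<open>
  Real powers of a self-adjoint positive operator with compact inverse, by the spectral
  decomposition \<open>\<A>\<^sup>s x = \<Sum>\<^sub>l l\<^sup>s P\<^sub>l x\<close> over the (distinct) eigenvalues \<open>l > 0\<close>, where \<open>P\<^sub>l\<close> is the
  orthogonal projection onto the eigenspace of \<open>l\<close>; grouping by eigenspaces avoids choosing an
  eigenbasis. The domain is \<open>{x. \<Sum>\<^sub>l l\<^sup>2\<^sup>s \<parallel>P\<^sub>l x\<parallel>\<^sup>2 < \<infinity>}\<close>, which is all of \<open>X\<close> when \<open>s \<le> 0\<close>.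
\<close>

definition eigenspace_op :: "'x::real_vector set \<Rightarrow> ('x \<Rightarrow> 'x) \<Rightarrow> real \<Rightarrow> 'x set" where
  "eigenspace_op D \<A> l = {x \<in> D. \<A> x = l *\<^sub>R x}"

definition eigenvalues_op :: "'x::real_vector set \<Rightarrow> ('x \<Rightarrow> 'x) \<Rightarrow> real set" where
  "eigenvalues_op D \<A> = {l. \<exists>x\<in>eigenspace_op D \<A> l. x \<noteq> 0}"

definition orth_proj :: "'x::real_inner set \<Rightarrow> 'x \<Rightarrow> 'x" where
  "orth_proj S x = (THE y. y \<in> S \<and> (\<forall>v\<in>S. (x - y) \<bullet> v = 0))"

definition power_dom :: "'x::real_inner set \<Rightarrow> ('x \<Rightarrow> 'x) \<Rightarrow> real \<Rightarrow> 'x set" where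
  "power_dom D \<A> s =
     {x. (\<lambda>l. l powr (2 * s) * (norm (orth_proj (eigenspace_op D \<A> l) x))\<^sup>2)
           summable_on eigenvalues_op D \<A>}"

definition power_op :: "'x::real_inner set \<Rightarrow> ('x \<Rightarrow> 'x) \<Rightarrow> real \<Rightarrow> 'x \<Rightarrow> 'x" where
  "power_op D \<A> s x =
     (\<Sum>\<^sub>\<infinity>l\<in>eigenvalues_op D \<A>. (l powr s) *\<^sub>R orth_proj (eigenspace_op D \<A> l) x)"

text \<open>
  The norm of \<open>X\<^sub>s\<close> for every real \<open>s\<close>. For \<open>s < 0\<close> the space \<open>X\<^sub>s\<close> (the dual of \<open>D(\<A>\<^sup>-\<^sup>s)\<close> with pivot
  \<open>X\<close>) is larger than \<open>X\<close>; this is its norm restricted to \<open>X\<close>.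
\<close>

definition X_norm :: "'x::real_inner set \<Rightarrow> ('x \<Rightarrow> 'x) \<Rightarrow> real \<Rightarrow> 'x \<Rightarrow> real" where
  "X_norm D \<A> s x = norm (power_op D \<A> s x)"


text \<open>
  \<open>H = V \<times> X\<close> is the set \<open>power_dom D \<A> (1/2) \<times> UNIV\<close> of pairs, with the norm below rather than the
  library norm of the product type.
\<close>

definition H_norm :: "'x::real_inner set \<Rightarrow> ('x \<Rightarrow> 'x) \<Rightarrow> 'x \<times> 'x \<Rightarrow> real" where
  "H_norm D \<A> w = sqrt ((norm (power_op D \<A> (1/2) (fst w)))\<^sup>2 + (norm (snd w))\<^sup>2)"

definition wave_dom :: "'x::real_inner set \<Rightarrow> ('x \<Rightarrow> 'x) \<Rightarrow> ('x \<times> 'x) set" where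
  "wave_dom D \<A> = D \<times> power_dom D \<A> (1/2)"

definition wave_op :: "('x::real_vector \<Rightarrow> 'x) \<Rightarrow> 'x \<times> 'x \<Rightarrow> 'x \<times> 'x" where
  "wave_op \<A> w = (snd w, - \<A> (fst w))"

definition wave_dom_norm :: "'x::real_inner set \<Rightarrow> ('x \<Rightarrow> 'x) \<Rightarrow> 'x \<times> 'x \<Rightarrow> real" where
  "wave_dom_norm D \<A> w =
     sqrt ((norm (\<A> (fst w)))\<^sup>2 + (norm (power_op D \<A> (1/2) (snd w)))\<^sup>2)"

definition wave_dom2 :: "'x::real_inner set \<Rightarrow> ('x \<Rightarrow> 'x) \<Rightarrow> ('x \<times> 'x) set" where
  "wave_dom2 D \<A> = {w \<in> wave_dom D \<A>. wave_op \<A> w \<in> wave_dom D \<A>}"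

definition ctrl_op :: "('y \<Rightarrow> 'x::zero) \<Rightarrow> 'y \<Rightarrow> 'x \<times> 'x" where
  "ctrl_op \<B> y = (0, \<B> y)"

definition ctrl_adj :: "('y::real_inner \<Rightarrow> 'x::real_inner) \<Rightarrow> 'x \<times> 'x \<Rightarrow> 'y" where
  "ctrl_adj \<B> w = adjoint \<B> (snd w)"


text \<open>
  Both schemes of the theorem have the form
  \<open>(u\<tilde>\<^sup>k\<^sup>+\<^sup>1 - u\<^sup>k) / \<Delta>t = G ((u\<^sup>k + u\<tilde>\<^sup>k\<^sup>+\<^sup>1) / 2)\<close>,
  \<open>(u\<^sup>k\<^sup>+\<^sup>1 - u\<tilde>\<^sup>k\<^sup>+\<^sup>1) / \<Delta>t = (\<Delta>t)\<^sup>2 A\<^sup>2 u\<^sup>k\<^sup>+\<^sup>1\<close>, with \<open>G = A\<close> or \<open>G = A - B B\<^sup>*\<close>, both with domain \<open>D(A)\<close>.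
  A solution is a pair of sequences for which the unbounded operators are applied inside their
  domains; \<open>ut (Suc k)\<close> stands for \<open>u\<tilde>\<^sup>k\<^sup>+\<^sup>1\<close>, and \<open>ut 0\<close> plays no role.
\<close>

definition midpt :: "(nat \<Rightarrow> 'h::real_vector) \<Rightarrow> (nat \<Rightarrow> 'h) \<Rightarrow> nat \<Rightarrow> 'h" where
  "midpt u ut k = (u k + ut (Suc k)) /\<^sub>R 2"

definition viscous_midpoint_solution ::
  "'x::real_inner set \<Rightarrow> ('x \<Rightarrow> 'x) \<Rightarrow> ('x \<times> 'x \<Rightarrow> 'x \<times> 'x) \<Rightarrow> real \<Rightarrow> 'x \<times> 'x
     \<Rightarrow> (nat \<Rightarrow> 'x \<times> 'x) \<Rightarrow> (nat \<Rightarrow> 'x \<times> 'x) \<Rightarrow> bool" where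
  "viscous_midpoint_solution D \<A> G dt z0 u ut \<longleftrightarrow>
     u 0 = z0 \<and>
     (\<forall>k. midpt u ut k \<in> wave_dom D \<A> \<and>
          (ut (Suc k) - u k) /\<^sub>R dt = G (midpt u ut k) \<and>
          u (Suc k) \<in> wave_dom2 D \<A> \<and>
          (u (Suc k) - ut (Suc k)) /\<^sub>R dt = dt\<^sup>2 *\<^sub>R wave_op \<A> (wave_op \<A> (u (Suc k))))"

end

theory Submission
  imports Defs
begin

text \<open>
  In the unknowns \<open>(\<A>\<^sup>1\<^sup>/\<^sup>2 a, b)\<close> the norm of \<open>H\<close> becomes the norm of \<open>X \<times> X\<close>, and the wave operator
  becomes \<open>A (p, b) = (\<A>\<^sup>1\<^sup>/\<^sup>2 b, - \<A>\<^sup>1\<^sup>/\<^sup>2 p)\<close>, which is skew, and \<open>I - \<epsilon> A\<close> is onto for all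
  \<open>\<epsilon> \<noteq> 0\<close>. Most of the argument rests on these two properties alone. The operator \<open>\<A>\<^sup>1\<^sup>/\<^sup>2\<close> is
  defined through the eigenspaces of \<open>\<A>\<close>, so their completeness is needed: it is the spectral theorem
  for the compact operator \<open>\<A>\<^sup>-\<^sup>1\<close> (\<open>eigenspaces_complete\<close>).

  Each step of the damped scheme with midpoint \<open>m\<close> loses exactly the energy
  \<open>2 dt \<parallel>B\<^sup>* m\<parallel>\<^sup>2 + 2 dt\<^sup>3 \<parallel>A z\<parallel>\<^sup>2 + dt\<^sup>6 \<parallel>A\<^sup>2 z\<parallel>\<^sup>2\<close>. The difference between a damped orbit and the free
  orbit with the same initial value is driven by \<open>B B\<^sup>* m\<close> alone, so over a window of length about
  \<open>T\<close> it is bounded by the lost energy. Observability of the free orbit therefore passes to the damped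
  one: the weak energy at the start of a window is at most a constant times the energy lost in it
  (\<open>free_observation_le_dissipation\<close>).

  To convert weak energy into energy one needs an a priori bound on a stronger norm. The viscosity
  does not commute with \<open>B B\<^sup>*\<close>, so the graph norm of \<open>z\<^sup>k\<close> is not obviously bounded uniformly in \<open>k\<close>
  and \<open>dt\<close>. What is nonincreasing is the norm of the difference quotient \<open>(z\<^sup>k\<^sup>+\<^sup>1 - z\<^sup>k) / dt\<close>, because it
  solves the same linear scheme. The scheme then bounds \<open>A (I - dt A)\<^sup>-\<^sup>1 z\<^sup>k\<^sup>+\<^sup>1\<close>
  (\<open>filtered_graph_bound\<close>), that is, the graph norm of the frequencies up to about \<open>1 / dt\<close>. The higher
  frequencies are controlled by the viscous dissipation \<open>dt\<^sup>3 \<parallel>A z\<parallel>\<^sup>2\<close>. With \<open>\<alpha> = 1 + 2 \<beta>\<close>, the two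
  regimes are combined in the elementary inequality
  \<open>1 \<le> 2 \<eta> l / (1 + dt\<^sup>2 l) + (\<eta> l)\<^sup>-\<^sup>\<alpha> + dt\<^sup>2 l\<close> between multipliers, valid for every \<open>\<eta> > 0\<close>
  (\<open>viscous_interpolation\<close>).

  Averaging over a window of \<open>K\<close> steps gives, for the energies \<open>e\<^sub>j\<close> and the squared graph norm \<open>a\<close> of the
  initial value, \<open>e\<^sub>j\<^sub>+\<^sub>2\<^sub>K \<le> C \<eta> a + (C \<eta>\<^sup>-\<^sup>\<alpha> + 1 / T) (e\<^sub>j - e\<^sub>j\<^sub>+\<^sub>2\<^sub>K)\<close> for all \<open>\<eta>\<close>
  (\<open>window_recursion\<close>). Optimising in \<open>\<eta>\<close> yields \<open>e\<^sub>j\<^sub>+\<^sub>2\<^sub>K\<^bsup>1+\<alpha>\<^esup> \<le> C a\<^sup>\<alpha> (e\<^sub>j - e\<^sub>j\<^sub>+\<^sub>2\<^sub>K)\<close>, whose solutions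
  decay like the power \<open>- 1 / \<alpha>\<close> of the number of windows.
\<close>

section \<open>Orthogonal projections and adjoints in Hilbert spaces\<close>

text \<open>
  A minimising sequence for the distance to \<open>x\<close> is Cauchy by the parallelogram identity, and its limit
  is the foot of the perpendicular.
\<close>
lemma orthogonal_projection_exists:
  fixes S :: "'x::{real_inner, complete_space} set"
  assumes S: "subspace S" and cl: "closed S"
  shows "\<exists>y\<in>S. \<forall>v\<in>S. (x - y) \<bullet> v = 0"
proof -
  define d where "d = (INF y\<in>S. (norm (x - y))\<^sup>2)"
  have ne: "S \<noteq> {}" using subspace_0[OF S] by auto
  have bdd: "bdd_below ((\<lambda>y. (norm (x - y))\<^sup>2) ` S)" by (intro bdd_belowI2[where m=0]) simp
  have dle: "d \<le> (norm (x - y))\<^sup>2" if "y \<in> S" for y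
    unfolding d_def by (rule cINF_lower[OF bdd that])
  have "\<exists>y\<in>S. (norm (x - y))\<^sup>2 < d + 1 / real (Suc n)" for n
    using cInf_lessD[of "(\<lambda>y. (norm (x - y))\<^sup>2) ` S" "d + 1 / real (Suc n)"] ne
    unfolding d_def by auto
  then obtain f where f: "\<And>n. f n \<in> S" "\<And>n. (norm (x - f n))\<^sup>2 < d + 1 / real (Suc n)"
    by metis
  have par: "(norm (f m - f n))\<^sup>2 \<le> 2 / real (Suc m) + 2 / real (Suc n)" for m n
  proof -
    have "(1/2) *\<^sub>R (f m + f n) \<in> S"
      using S f(1) by (intro subspace_scale subspace_add) auto
    from dle[OF this] have "4 * d \<le> (norm (2 *\<^sub>R (x - (1/2) *\<^sub>R (f m + f n))))\<^sup>2"
      by (simp add: power_mult_distrib)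
    also have "2 *\<^sub>R (x - (1/2) *\<^sub>R (f m + f n)) = (x - f m) + (x - f n)"
      by (simp add: scaleR_right_diff_distrib scaleR_2)
    finally have 1: "4 * d \<le> (norm ((x - f m) + (x - f n)))\<^sup>2" .
    have "(norm ((x - f m) + (x - f n)))\<^sup>2 + (norm (f m - f n))\<^sup>2
        = 2 * (norm (x - f m))\<^sup>2 + 2 * (norm (x - f n))\<^sup>2"
      by (simp add: power2_norm_eq_inner inner_diff_left inner_diff_right inner_add_left
          inner_add_right inner_commute algebra_simps)
    with 1 f(2)[of m] f(2)[of n] show ?thesis by simp
  qed
  have "Cauchy f"
  proof (rule metric_CauchyI)
    fix e :: real assume e: "e > 0"
    obtain N where N: "real N > 4 / e\<^sup>2" using reals_Archimedean2 by blast
    have "dist (f m) (f n) < e" if "m \<ge> N" "n \<ge> N" for m n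
    proof -
      have N0: "real N > 0" using N e by (smt (verit) divide_pos_pos zero_less_power)
      have "2 / real (Suc m) < 2 / real N" "2 / real (Suc n) < 2 / real N"
        using that N0 by (auto intro!: divide_strict_left_mono)
      moreover have "2 / real N + 2 / real N < e\<^sup>2" using N N0 e by (simp add: field_simps)
      ultimately have "(norm (f m - f n))\<^sup>2 < e\<^sup>2" using par[of m n] by linarith
      then show ?thesis using e by (simp add: dist_norm power_less_imp_less_base)
    qed
    then show "\<exists>M. \<forall>m\<ge>M. \<forall>n\<ge>M. dist (f m) (f n) < e" by blast
  qed
  then obtain y where y: "f \<longlonglongrightarrow> y" using Cauchy_convergent convergent_def by blast
  have yS: "y \<in> S" using cl f(1) y closed_sequentially by blast
  have "(\<lambda>n. (norm (x - f n))\<^sup>2) \<longlonglongrightarrow> (norm (x - y))\<^sup>2" by (intro tendsto_intros y)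
  moreover have "(\<lambda>n. d + 1 / real (Suc n)) \<longlonglongrightarrow> d + 0"
    by (intro tendsto_intros LIMSEQ_Suc lim_1_over_n)
  ultimately have ny: "(norm (x - y))\<^sup>2 \<le> d"
    by (metis (no_types, lifting) add.right_neutral f(2) LIMSEQ_le less_imp_le)
  have "(x - y) \<bullet> v = 0" if v: "v \<in> S" for v
  proof (rule ccontr)
    assume n0: "(x - y) \<bullet> v \<noteq> 0"
    then have v0: "v \<bullet> v > 0" by auto
    \<comment> \<open>The minimiser of the distance from \<open>x\<close> on the line \<open>y + t v\<close>.\<close>
    define t where "t = ((x - y) \<bullet> v) / (v \<bullet> v)"
    have "y + t *\<^sub>R v \<in> S" using S yS v by (intro subspace_add subspace_scale) auto
    then have "(norm (x - y))\<^sup>2 \<le> (norm (x - (y + t *\<^sub>R v)))\<^sup>2"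
      using dle ny order_trans by blast
    also have "\<dots> = (norm (x - y))\<^sup>2 - 2 * t * ((x - y) \<bullet> v) + t * t * (v \<bullet> v)"
      by (simp add: power2_norm_eq_inner inner_diff_left inner_diff_right inner_add_left
          inner_add_right inner_commute algebra_simps)
    also have "t * t * (v \<bullet> v) = t * ((x - y) \<bullet> v)" using v0 by (simp add: t_def)
    finally have "t * ((x - y) \<bullet> v) \<le> 0" by simp
    moreover have "t * ((x - y) \<bullet> v) = ((x - y) \<bullet> v)\<^sup>2 / (v \<bullet> v)"
      by (simp add: t_def power2_eq_square)
    ultimately show False using n0 v0 by (smt (verit) divide_pos_pos zero_less_power2)
  qed
  then show ?thesis using yS by blast
qed

lemma orth_proj_props:
  fixes S :: "'x::{real_inner, complete_space} set"
  assumes S: "subspace S" and cl: "closed S"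
  shows "orth_proj S x \<in> S" and "v \<in> S \<Longrightarrow> (x - orth_proj S x) \<bullet> v = 0"
proof -
  have "\<exists>!y. y \<in> S \<and> (\<forall>v\<in>S. (x - y) \<bullet> v = 0)"
  proof (rule ex_ex1I)
    show "\<exists>y. y \<in> S \<and> (\<forall>v\<in>S. (x - y) \<bullet> v = 0)"
      using orthogonal_projection_exists[OF S cl, of x] by blast
    fix y z assume y: "y \<in> S \<and> (\<forall>v\<in>S. (x - y) \<bullet> v = 0)" and z: "z \<in> S \<and> (\<forall>v\<in>S. (x - z) \<bullet> v = 0)"
    then have "z - y \<in> S" using S subspace_diff by blast
    then have "(x - y) \<bullet> (z - y) = 0" "(x - z) \<bullet> (z - y) = 0" using y z by auto
    then have "(z - y) \<bullet> (z - y) = 0" by (simp add: inner_diff_left)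
    then show "y = z" by simp
  qed
  from theI'[OF this] show "orth_proj S x \<in> S" "v \<in> S \<Longrightarrow> (x - orth_proj S x) \<bullet> v = 0"
    unfolding orth_proj_def by auto
qed

text \<open>
  The representing vector is a multiple of a normal of the kernel.
\<close>
lemma Riesz_representation:
  fixes f :: "'y::{real_inner, complete_space} \<Rightarrow> real"
  assumes "bounded_linear f"
  shows "\<exists>r. \<forall>x. f x = x \<bullet> r"
proof (cases "\<forall>x. f x = 0")
  case True
  then show ?thesis by (intro exI[of _ 0]) simp
next
  case False
  then obtain x where x: "f x \<noteq> 0" by blast
  interpret f: bounded_linear f by fact
  have sub: "subspace {x. f x = 0}" by (simp add: subspace_def f.add f.scaleR)
  have cl: "closed {x. f x = 0}"
    by (intro closed_Collect_eq continuous_intros f.continuous_on)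
  obtain y where y: "f y = 0" "\<And>v. f v = 0 \<Longrightarrow> (x - y) \<bullet> v = 0"
    using orthogonal_projection_exists[OF sub cl, of x] by auto
  define v where "v = x - y"
  have fv: "f v = f x" using y(1) by (simp add: v_def f.diff)
  then have v0: "v \<bullet> v > 0" using x f.zero by (auto simp: inner_gt_zero_iff)
  have "f w = w \<bullet> ((f v / (v \<bullet> v)) *\<^sub>R v)" for w
  proof -
    have "f (w - (f w / f v) *\<^sub>R v) = 0" using x fv by (simp add: f.diff f.scaleR)
    from y(2)[OF this] have "v \<bullet> w = (f w / f v) * (v \<bullet> v)"
      by (simp add: v_def[symmetric] inner_diff_right)
    then show ?thesis using x fv v0 by (simp add: inner_commute field_simps)
  qed
  then show ?thesis by blast
qed

text \<open>
  The constant \<^const>\<open>adjoint\<close> is a choice of a formal adjoint; the Riesz representation shows that one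
  exists.
\<close>
lemma adjoint_inner:
  fixes f :: "'y::{real_inner, complete_space} \<Rightarrow> 'x::real_inner"
  assumes "bounded_linear f"
  shows "f x \<bullet> y = x \<bullet> adjoint f y"
proof -
  have "\<exists>r. \<forall>x. f x \<bullet> y = x \<bullet> r" for y
    by (rule Riesz_representation) (intro bounded_linear_inner_left_comp assms)
  then have "\<exists>f'. \<forall>x y. f x \<bullet> y = x \<bullet> f' y" by metis
  from someI_ex[OF this] show ?thesis unfolding adjoint_def by blast
qed

lemma adjoint_bounded_linear:
  fixes f :: "'y::{real_inner, complete_space} \<Rightarrow> 'x::real_inner"
  assumes f: "bounded_linear f"
  shows "bounded_linear (adjoint f)"
proof -
  obtain K where K0: "0 \<le> K" and K: "\<And>x. norm (f x) \<le> norm x * K"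
    using bounded_linear.nonneg_bounded[OF f] by blast
  note ai = adjoint_inner[OF f, symmetric]
  show ?thesis
  proof (rule bounded_linear_intro)
    show "adjoint f (x + y) = adjoint f x + adjoint f y" for x y
      by (rule vector_eq_ldot[THEN iffD1]) (simp add: ai inner_add_right)
    show "adjoint f (r *\<^sub>R x) = r *\<^sub>R adjoint f x" for r x
      by (rule vector_eq_ldot[THEN iffD1]) (simp add: ai)
    show "norm (adjoint f y) \<le> norm y * K" for y
    proof (cases "adjoint f y = 0")
      case True
      then show ?thesis using K0 by simp
    next
      case False
      have "norm (adjoint f y) * norm (adjoint f y) = f (adjoint f y) \<bullet> y"
        by (simp add: ai[symmetric] power2_norm_eq_inner[symmetric] power2_eq_square)
      also have "\<dots> \<le> norm (f (adjoint f y)) * norm y" by (rule norm_cauchy_schwarz)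
      also have "\<dots> \<le> norm (adjoint f y) * K * norm y" by (intro mult_right_mono K) simp
      finally show ?thesis using False by (simp add: mult.commute mult.left_commute)
    qed
  qed
qed

lemma orth_proj_eqI:
  fixes S :: "'x::{real_inner, complete_space} set"
  assumes S: "subspace S" "closed S" and y: "y \<in> S" "\<And>v. v \<in> S \<Longrightarrow> (x - y) \<bullet> v = 0"
  shows "orth_proj S x = y"
proof -
  have "orth_proj S x - y \<in> S" using S y(1) orth_proj_props(1) subspace_diff by blast
  then have "(x - orth_proj S x) \<bullet> (orth_proj S x - y) = 0" "(x - y) \<bullet> (orth_proj S x - y) = 0"
    using orth_proj_props(2)[OF S] y(2) by auto
  then have "(orth_proj S x - y) \<bullet> (orth_proj S x - y) = 0" by (simp add: inner_diff_left)
  then show ?thesis by simp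
qed

lemma orth_proj_linear:
  fixes S :: "'x::{real_inner, complete_space} set"
  assumes S: "subspace S" "closed S"
  shows "linear (orth_proj S)"
proof (rule linearI)
  note p = orth_proj_props[OF S]
  show "orth_proj S (x + y) = orth_proj S x + orth_proj S y" for x y
  proof (rule orth_proj_eqI[OF S])
    show "orth_proj S x + orth_proj S y \<in> S" using S p(1) by (intro subspace_add) auto
    show "(x + y - (orth_proj S x + orth_proj S y)) \<bullet> v = 0" if "v \<in> S" for v
      using p(2)[OF that, of x] p(2)[OF that, of y] by (simp add: inner_diff_left inner_add_left)
  qed
  show "orth_proj S (r *\<^sub>R x) = r *\<^sub>R orth_proj S x" for r x
  proof (rule orth_proj_eqI[OF S])
    show "r *\<^sub>R orth_proj S x \<in> S" using S p(1) by (intro subspace_scale) auto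
    show "(r *\<^sub>R x - r *\<^sub>R orth_proj S x) \<bullet> v = 0" if "v \<in> S" for v
      using p(2)[OF that, of x] by (simp flip: scaleR_diff_right)
  qed
qed

lemma orth_proj_inner:
  fixes S :: "'x::{real_inner, complete_space} set"
  assumes S: "subspace S" "closed S"
  shows "orth_proj S x \<bullet> y = x \<bullet> orth_proj S y"
proof -
  note p = orth_proj_props[OF S]
  have "(y - orth_proj S y) \<bullet> orth_proj S x = 0" "(x - orth_proj S x) \<bullet> orth_proj S y = 0"
    using p by auto
  then show ?thesis by (simp add: inner_diff_left inner_diff_right inner_commute)
qed

section \<open>Diagonalised operators\<close>

text \<open>
  On an eigenspace with eigenvalue \<open>l\<close> the operator \<open>I - dt A\<close> acts by \<open>(a, b) \<mapsto> (a - t b, b + t a)\<close> with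
  \<open>t = dt \<surd>l\<close>, a rotation followed by a dilation; the cross terms cancel.
\<close>
lemma resolvent_symbol_norm:
  fixes a b :: "'x::real_inner"
  shows "(norm (a - t *\<^sub>R b))\<^sup>2 + (norm (b + t *\<^sub>R a))\<^sup>2 = (1 + t\<^sup>2) * ((norm a)\<^sup>2 + (norm b)\<^sup>2)"
  unfolding power2_norm_eq_inner
  by (simp add: inner_diff_left inner_diff_right inner_add_left
      inner_add_right inner_commute algebra_simps power2_eq_square)

text \<open>
  The bound \<open>1 \<le> 2 \<eta> l / (1 + dt\<^sup>2 l) + (\<eta> l)\<^sup>-\<^sup>\<alpha> + dt\<^sup>2 l\<close>, multiplied by \<open>1 + dt\<^sup>2 l\<close>. One of the three
  terms on the right always dominates: the last one if \<open>dt\<^sup>2 l \<ge> 1\<close>, the second one if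
  \<open>\<eta> l \<le> 1\<close>, and otherwise the first one.
\<close>
lemma interpolation_multiplier:
  fixes l :: real
  assumes l: "l > 0" and \<eta>: "\<eta> > 0" and dt: "dt > 0" and \<alpha>: "\<alpha> \<ge> 0"
  shows "1 + dt\<^sup>2 * l \<le> 2 * \<eta> * l + \<eta> powr (- \<alpha>) * (l powr (- \<alpha>) * (1 + dt\<^sup>2 * l)) + dt\<^sup>2 * (l * (1 + dt\<^sup>2 * l))"
proof -
  define A B where "A = \<eta> powr (- \<alpha>) * l powr (- \<alpha>)" and "B = dt\<^sup>2 * l"
  have pos: "0 \<le> A" "0 \<le> B" "0 \<le> \<eta> * l" using l \<eta> by (auto simp: A_def B_def)
  have "1 \<le> B \<or> 1 \<le> A \<or> (B \<le> 1 \<and> 1 \<le> \<eta> * l)"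
  proof (cases "\<eta> * l \<le> 1")
    case True
    have "1 powr (-\<alpha>) \<le> (\<eta> * l) powr (- \<alpha>)"
      using True \<alpha> l \<eta> by (intro powr_mono2') auto
    then show ?thesis using l \<eta> by (simp add: powr_mult A_def)
  qed auto
  moreover define C where "C = 1 + B"
  ultimately have "C \<le> 2 * (\<eta> * l) + A * C + B * C"
  proof (elim disjE conjE)
    assume "1 \<le> B"
    then have "1 * C \<le> B * C" "0 \<le> A * C" using pos by (auto simp: C_def)
    then show ?thesis using pos by linarith
  next
    assume "1 \<le> A"
    then have "1 * C \<le> A * C" "0 \<le> B * C" using pos by (auto simp: C_def mult_right_mono)
    then show ?thesis using pos by linarith
  next
    assume "B \<le> 1" "1 \<le> \<eta> * l"
    moreover have "0 \<le> A * C" "0 \<le> B * C" using pos by (simp_all add: C_def)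
    ultimately show ?thesis unfolding C_def by linarith
  qed
  then show ?thesis by (simp add: A_def B_def C_def mult.assoc)
qed

text \<open>
  A pure point spectral decomposition: \<open>P l\<close> is the orthogonal projection onto the eigenspace of \<open>l\<close>.
  Completeness is stated as injectivity of the family of coordinates, which is what the
  spectral theorem delivers most directly; the expansion of vectors is derived from it.
\<close>
locale spectral_resolution =
  fixes \<Lambda> :: "real set" and P :: "real \<Rightarrow> 'x::{real_inner, complete_space} \<Rightarrow> 'x" and l0 :: real
  assumes P_linear: "l \<in> \<Lambda> \<Longrightarrow> linear (P l)"
    and P_sym: "l \<in> \<Lambda> \<Longrightarrow> P l x \<bullet> y = x \<bullet> P l y"
    and P_P: "l \<in> \<Lambda> \<Longrightarrow> m \<in> \<Lambda> \<Longrightarrow> P l (P m x) = (if l = m then P l x else 0)"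
    and P_complete: "(\<And>l. l \<in> \<Lambda> \<Longrightarrow> P l x = 0) \<Longrightarrow> x = 0"
    and l0_pos: "0 < l0" and l0_le: "l \<in> \<Lambda> \<Longrightarrow> l0 \<le> l"
begin

lemma \<Lambda>_pos: "l \<in> \<Lambda> \<Longrightarrow> 0 < l"
  using l0_pos l0_le by fastforce

lemma P_inner_P: "l \<in> \<Lambda> \<Longrightarrow> m \<in> \<Lambda> \<Longrightarrow> P l x \<bullet> P m y = (if l = m then P l x \<bullet> y else 0)"
  by (metis P_P P_sym inner_zero_left inner_commute)

lemma P_add: "l \<in> \<Lambda> \<Longrightarrow> P l (x + y) = P l x + P l y"
  and P_diff: "l \<in> \<Lambda> \<Longrightarrow> P l (x - y) = P l x - P l y"
  and P_scale: "l \<in> \<Lambda> \<Longrightarrow> P l (r *\<^sub>R x) = r *\<^sub>R P l x"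
  and P_zero: "l \<in> \<Lambda> \<Longrightarrow> P l 0 = 0"
  and P_minus: "l \<in> \<Lambda> \<Longrightarrow> P l (- x) = - P l x"
  using P_linear by (simp_all add: linear_add linear_diff linear_scale linear_0 linear_neg)

lemma P_norm_le:
  assumes "l \<in> \<Lambda>" shows "norm (P l x) \<le> norm x"
proof -
  have "(norm (P l x))\<^sup>2 = P l x \<bullet> x"
    using P_inner_P[OF assms assms, of x x] by (simp add: power2_norm_eq_inner)
  also have "\<dots> \<le> norm (P l x) * norm x" by (rule norm_cauchy_schwarz)
  finally show ?thesis by (cases "P l x = 0") (simp_all add: power2_eq_square)
qed

lemma P_bounded_linear: "l \<in> \<Lambda> \<Longrightarrow> bounded_linear (P l)"
  by (rule bounded_linear_intro[where K=1]) (simp_all add: P_add P_scale P_norm_le)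

lemma eqI_P: "(\<And>l. l \<in> \<Lambda> \<Longrightarrow> P l x = P l y) \<Longrightarrow> x = y"
  using P_complete[of "x - y"] by (simp add: P_diff)

lemma finite_Bessel:
  assumes "finite F" "F \<subseteq> \<Lambda>"
  shows "(\<Sum>l\<in>F. (norm (P l x))\<^sup>2) \<le> (norm x)\<^sup>2"
proof -
  define s where "s = (\<Sum>l\<in>F. P l x)"
  have 1: "x \<bullet> s = (\<Sum>l\<in>F. (norm (P l x))\<^sup>2)"
    unfolding s_def inner_sum_right power2_norm_eq_inner using assms P_inner_P
    by (intro sum.cong) (auto simp: inner_commute subset_iff)
  have 2: "s \<bullet> s = (\<Sum>l\<in>F. (norm (P l x))\<^sup>2)"
    unfolding power2_norm_eq_inner[symmetric] s_def using assms P_inner_P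
    by (intro norm_sum_Pythagorean) (auto simp: pairwise_def orthogonal_def subset_iff)
  have "0 \<le> (x - s) \<bullet> (x - s)" by simp
  also have "\<dots> = x \<bullet> x - x \<bullet> s" using 1 2 by (simp add: inner_diff_left inner_diff_right inner_commute)
  finally show ?thesis using 1 by (simp add: power2_norm_eq_inner)
qed

lemma Bessel_summable: "(\<lambda>l. (norm (P l x))\<^sup>2) summable_on \<Lambda>"
  by (rule nonneg_bdd_above_summable_on)
    (auto intro!: bdd_aboveI2[where M="(norm x)\<^sup>2"] finite_Bessel)

text \<open>
  Unconditional convergence of orthogonal series: by Pythagoras the partial sums inherit the Cauchy
  property from those of the squared norms.
\<close>
lemma orthogonal_series_converges:
  assumes sm: "(\<lambda>l. (norm (v l))\<^sup>2) summable_on \<Lambda>" and v: "\<And>l. l \<in> \<Lambda> \<Longrightarrow> P l (v l) = v l"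
  shows "v summable_on \<Lambda>"
proof -
  define q where "q l = (norm (v l))\<^sup>2" for l
  obtain L where L: "(q has_sum L) \<Lambda>" using sm unfolding summable_on_def q_def by blast
  have pyth: "(norm (sum v F))\<^sup>2 = sum q F" if "finite F" "F \<subseteq> \<Lambda>" for F
    unfolding q_def
  proof (rule norm_sum_Pythagorean[OF that(1)])
    show "pairwise (\<lambda>i j. orthogonal (v i) (v j)) F"
      unfolding pairwise_def orthogonal_def
      by (metis P_inner_P v subsetD that(2))
  qed
  have "\<exists>E. eventually E (finite_subsets_at_top \<Lambda>) \<and>
              (\<forall>F F'. E F \<and> E F' \<longrightarrow> dist (sum v F) (sum v F') < e)" if "e > 0" for e
  proof -
    from L obtain F0 where F0: "finite F0" "F0 \<subseteq> \<Lambda>" "dist (sum q F0) L < (e/2)\<^sup>2"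
      unfolding has_sum_def tendsto_iff eventually_finite_subsets_at_top
      using \<open>e > 0\<close> by (metis half_gt_zero order_refl zero_less_power)
    have near: "norm (sum v F - sum v F0) < e/2" if F: "finite F" "F0 \<subseteq> F" "F \<subseteq> \<Lambda>" for F
    proof -
      have "sum v F - sum v F0 = sum v (F - F0)" "sum q F - sum q F0 = sum q (F - F0)"
        using F by (simp_all add: sum_diff)
      then have "(norm (sum v F - sum v F0))\<^sup>2 = sum q F - sum q F0"
        using pyth[of "F - F0"] F by auto
      also have "sum q F \<le> L"
        using finite_sum_le_has_sum[OF L F(1,3)] by (simp add: q_def)
      finally have "(norm (sum v F - sum v F0))\<^sup>2 < (e/2)\<^sup>2"
        using F0(3) by (simp add: dist_real_def)
      then show ?thesis by (rule power_less_imp_less_base) (use \<open>e > 0\<close> in simp)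
    qed
    let ?E = "\<lambda>F. finite F \<and> F0 \<subseteq> F \<and> F \<subseteq> \<Lambda>"
    have ev: "eventually ?E (finite_subsets_at_top \<Lambda>)"
      unfolding eventually_finite_subsets_at_top using F0 by blast
    have "dist (sum v F) (sum v F') < e" if "?E F" "?E F'" for F F'
    proof -
      have "dist (sum v F) (sum v F') = norm ((sum v F - sum v F0) - (sum v F' - sum v F0))"
        by (simp add: dist_norm)
      also have "\<dots> \<le> norm (sum v F - sum v F0) + norm (sum v F' - sum v F0)"
        by (rule norm_triangle_ineq4)
      also have "\<dots> < e" using near[of F] near[of F'] that by linarith
      finally show ?thesis .
    qed
    then show ?thesis using ev by (intro exI[of _ ?E]) simp
  qed
  then have "cauchy_filter (filtermap (sum v) (finite_subsets_at_top \<Lambda>))"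
    by (simp add: cauchy_filter_metric_filtermap)
  moreover have "complete (UNIV::'x set)"
    by (meson Cauchy_convergent UNIV_I complete_def convergent_def)
  ultimately obtain y where "(sum v \<longlongrightarrow> y) (finite_subsets_at_top \<Lambda>)"
    using complete_uniform[where S="UNIV::'x set"] by (force simp add: filterlim_def)
  then show ?thesis using summable_on_def has_sum_def by blast
qed

lemma P_has_sum:
  assumes y: "(v has_sum y) \<Lambda>" and v: "\<And>l. l \<in> \<Lambda> \<Longrightarrow> P l (v l) = v l" and l: "l \<in> \<Lambda>"
  shows "P l y = v l"
proof -
  have "((\<lambda>m. P l (v m)) has_sum P l y) \<Lambda>"
    by (rule has_sum_bounded_linear[OF P_bounded_linear[OF l] y])
  moreover have "((\<lambda>m. P l (v m)) has_sum v l) \<Lambda>"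
  proof -
    have "P l (v m) = (if m = l then v l else 0)" if "m \<in> \<Lambda>" for m
      using P_P[OF l that, of "v m"] v[OF that] by auto
    moreover have "((\<lambda>m. if m = l then v l else 0) has_sum v l) \<Lambda>"
      by (rule has_sum_cong_neutral[THEN iffD1, OF _ _ _ has_sum_finiteI[of "{l}" "v l" v]])
        (use l in auto)
    ultimately show ?thesis by (simp cong: has_sum_cong)
  qed
  ultimately show ?thesis by (rule has_sum_unique)
qed

text \<open>
  The series of the components converges by Bessel's inequality, and its sum has the same components
  as \<open>x\<close>.
\<close>
lemma expansion: "((\<lambda>l. P l x) has_sum x) \<Lambda>"
proof -
  have idem: "\<And>l. l \<in> \<Lambda> \<Longrightarrow> P l (P l x) = P l x" by (simp add: P_P)
  obtain y where y: "((\<lambda>l. P l x) has_sum y) \<Lambda>"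
    using orthogonal_series_converges[OF Bessel_summable[of x]] idem unfolding summable_on_def by blast
  have "y = x" by (rule eqI_P) (use P_has_sum[OF y] idem in auto)
  with y show ?thesis by simp
qed

lemma inner_expansion: "((\<lambda>l. P l x \<bullet> P l y) has_sum (x \<bullet> y)) \<Lambda>"
proof -
  have "((\<lambda>l. P l x \<bullet> y) has_sum (x \<bullet> y)) \<Lambda>"
    by (rule has_sum_bounded_linear[OF bounded_linear_inner_left expansion])
  then show ?thesis by (simp add: P_inner_P cong: has_sum_cong)
qed

lemma Parseval: "((\<lambda>l. (norm (P l x))\<^sup>2) has_sum (norm x)\<^sup>2) \<Lambda>"
  unfolding power2_norm_eq_inner by (rule inner_expansion)

lemma multiplier_P:
  assumes "(\<lambda>l. (g l)\<^sup>2 * (norm (P l x))\<^sup>2) summable_on \<Lambda>" and "l \<in> \<Lambda>"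
  shows "P l (\<Sum>\<^sub>\<infinity>l\<in>\<Lambda>. g l *\<^sub>R P l x) = g l *\<^sub>R P l x"
proof -
  have v: "\<And>l. l \<in> \<Lambda> \<Longrightarrow> P l (g l *\<^sub>R P l x) = g l *\<^sub>R P l x" by (simp add: P_P P_scale)
  have "(\<lambda>l. g l *\<^sub>R P l x) summable_on \<Lambda>"
    by (rule orthogonal_series_converges) (use assms(1) v in \<open>auto simp: power_mult_distrib\<close>)
  then show ?thesis using P_has_sum[OF has_sum_infsum v assms(2)] by blast
qed

lemma bounded_multiplier_summable:
  assumes "\<And>l. l \<in> \<Lambda> \<Longrightarrow> \<bar>g l\<bar> \<le> C"
  shows "(\<lambda>l. (g l)\<^sup>2 * (norm (P l x))\<^sup>2) summable_on \<Lambda>"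
proof (rule summable_on_comparison_test)
  show "(\<lambda>l. C\<^sup>2 * (norm (P l x))\<^sup>2) summable_on \<Lambda>"
    by (intro summable_on_cmult_right Bessel_summable)
  show "(g l)\<^sup>2 * (norm (P l x))\<^sup>2 \<le> C\<^sup>2 * (norm (P l x))\<^sup>2" if "l \<in> \<Lambda>" for l
    using power_mono[OF assms[OF that], of 2] by (intro mult_right_mono) auto
qed auto

text \<open>
  \<open>half_op\<close> is the square root of the operator with eigenvalues \<open>l\<close> and eigenprojections \<open>P l\<close>.
\<close>
definition half_dom :: "'x set" where
  "half_dom = {x. (\<lambda>l. l * (norm (P l x))\<^sup>2) summable_on \<Lambda>}"

definition half_op :: "'x \<Rightarrow> 'x" where
  "half_op x = (\<Sum>\<^sub>\<infinity>l\<in>\<Lambda>. sqrt l *\<^sub>R P l x)"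

lemma P_half_op:
  assumes "x \<in> half_dom" "l \<in> \<Lambda>"
  shows "P l (half_op x) = sqrt l *\<^sub>R P l x"
proof -
  have "(\<lambda>l. (sqrt l)\<^sup>2 * (norm (P l x))\<^sup>2) summable_on \<Lambda>"
    using assms(1) unfolding half_dom_def
    by (auto simp: \<Lambda>_pos less_imp_le cong: summable_on_cong)
  from multiplier_P[OF this assms(2)] show ?thesis by (simp add: half_op_def)
qed

lemma P_half_op_norm:
  "x \<in> half_dom \<Longrightarrow> l \<in> \<Lambda> \<Longrightarrow> (norm (P l (half_op x)))\<^sup>2 = l * (norm (P l x))\<^sup>2"
  by (simp add: P_half_op power_mult_distrib \<Lambda>_pos less_imp_le)

text \<open>
  Membership in the domain and the value can both be read off from components, so that algebraic
  properties of the square root are checked componentwise.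
\<close>
lemma half_domI:
  assumes "\<And>l. l \<in> \<Lambda> \<Longrightarrow> P l y = sqrt l *\<^sub>R P l x"
  shows "x \<in> half_dom" "half_op x = y"
proof -
  have "l * (norm (P l x))\<^sup>2 = (norm (P l y))\<^sup>2" if "l \<in> \<Lambda>" for l
    using assms[OF that] \<Lambda>_pos[OF that] by (simp add: power_mult_distrib)
  then show *: "x \<in> half_dom"
    unfolding half_dom_def using Bessel_summable[of y] by (simp cong: summable_on_cong)
  show "half_op x = y" by (rule eqI_P) (simp add: P_half_op[OF *] assms)
qed

lemma half_op_zero: "0 \<in> half_dom" "half_op 0 = 0"
  using half_domI[of 0 0] by (simp_all add: P_zero)

lemma half_op_add:
  assumes "x \<in> half_dom" "y \<in> half_dom"
  shows "x + y \<in> half_dom" "half_op (x + y) = half_op x + half_op y"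
  using half_domI[of "half_op x + half_op y" "x + y"] assms
  by (simp_all add: P_add P_half_op scaleR_add_right)

lemma half_op_scale:
  assumes "x \<in> half_dom"
  shows "r *\<^sub>R x \<in> half_dom" "half_op (r *\<^sub>R x) = r *\<^sub>R half_op x"
  using half_domI[of "r *\<^sub>R half_op x" "r *\<^sub>R x"] assms
  by (simp_all add: P_scale P_half_op)

lemma half_op_diff:
  assumes "x \<in> half_dom" "y \<in> half_dom"
  shows "x - y \<in> half_dom" "half_op (x - y) = half_op x - half_op y"
  using half_op_add[OF assms(1) half_op_scale(1)[OF assms(2)], of "-1"] half_op_scale(2)[OF assms(2), of "-1"]
  by simp_all

lemma half_dom_subspace: "subspace half_dom"
  by (simp add: subspace_def half_op_zero half_op_add half_op_scale)

lemma half_op_surj: "\<exists>x\<in>half_dom. half_op x = y"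
proof -
  define x where "x = (\<Sum>\<^sub>\<infinity>l\<in>\<Lambda>. (1 / sqrt l) *\<^sub>R P l y)"
  have "\<bar>1 / sqrt l\<bar> \<le> 1 / sqrt l0" if "l \<in> \<Lambda>" for l
    using l0_pos l0_le[OF that] by (auto intro!: frac_le)
  note sm = bounded_multiplier_summable[of "\<lambda>l. 1 / sqrt l", OF this]
  have "P l x = (1 / sqrt l) *\<^sub>R P l y" if "l \<in> \<Lambda>" for l
    unfolding x_def by (rule multiplier_P[OF sm that])
  then have "P l y = sqrt l *\<^sub>R P l x" if "l \<in> \<Lambda>" for l
    using that \<Lambda>_pos[OF that] by simp
  from half_domI[OF this] show ?thesis by blast
qed

lemma half_op_inj: "x \<in> half_dom \<Longrightarrow> y \<in> half_dom \<Longrightarrow> half_op x = half_op y \<Longrightarrow> x = y"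
  by (rule eqI_P) (metis P_half_op \<Lambda>_pos real_sqrt_gt_0_iff less_irrefl scaleR_cancel_left)

lemma half_op_sym:
  assumes "x \<in> half_dom" "y \<in> half_dom"
  shows "half_op x \<bullet> y = x \<bullet> half_op y"
proof (rule has_sum_unique[OF inner_expansion])
  show "((\<lambda>l. P l (half_op x) \<bullet> P l y) has_sum (x \<bullet> half_op y)) \<Lambda>"
    using inner_expansion[of x "half_op y"] assms by (simp add: P_half_op cong: has_sum_cong)
qed

lemma half_op_twiceI:
  assumes y: "\<And>l. l \<in> \<Lambda> \<Longrightarrow> P l y = l *\<^sub>R P l x"
  shows "x \<in> half_dom" "half_op x \<in> half_dom" "half_op (half_op x) = y"
proof -
  obtain q where q: "q \<in> half_dom" "half_op q = y" using half_op_surj by blast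
  have "P l q = sqrt l *\<^sub>R P l x" if l: "l \<in> \<Lambda>" for l
  proof -
    have "sqrt l *\<^sub>R P l q = sqrt l *\<^sub>R (sqrt l *\<^sub>R P l x)"
      using P_half_op[OF q(1) l] y[OF l] q(2) \<Lambda>_pos[OF l] by simp
    then show ?thesis using \<Lambda>_pos[OF l] by (simp only: scaleR_cancel_left) simp
  qed
  from half_domI[OF this] q show "x \<in> half_dom" "half_op x \<in> half_dom" "half_op (half_op x) = y"
    by auto
qed

text \<open>
  The solution is given by the bounded multiplier \<open>1 / (1 + \<epsilon>\<^sup>2 l)\<close>.
\<close>
lemma half_op_square_resolvent:
  assumes "\<epsilon> \<noteq> 0"
  shows "\<exists>x\<in>half_dom. half_op x \<in> half_dom \<and> x + \<epsilon>\<^sup>2 *\<^sub>R half_op (half_op x) = f"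
proof -
  define x where "x = (\<Sum>\<^sub>\<infinity>l\<in>\<Lambda>. (1 / (1 + \<epsilon>\<^sup>2 * l)) *\<^sub>R P l f)"
  have pos: "1 + \<epsilon>\<^sup>2 * l > 0" if "l \<in> \<Lambda>" for l
    using \<Lambda>_pos[OF that] by (simp add: add_pos_nonneg)
  have "\<bar>1 / (1 + \<epsilon>\<^sup>2 * l)\<bar> \<le> 1" if "l \<in> \<Lambda>" for l
    using \<Lambda>_pos[OF that] pos[OF that] by simp
  note sm = bounded_multiplier_summable[of "\<lambda>l. 1 / (1 + \<epsilon>\<^sup>2 * l)", OF this]
  have Px: "P l x = (1 / (1 + \<epsilon>\<^sup>2 * l)) *\<^sub>R P l f" if "l \<in> \<Lambda>" for l
    unfolding x_def by (rule multiplier_P[OF sm that])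
  have "P l ((1 / \<epsilon>\<^sup>2) *\<^sub>R (f - x)) = l *\<^sub>R P l x" if l: "l \<in> \<Lambda>" for l
  proof -
    have "P l f = (1 + \<epsilon>\<^sup>2 * l) *\<^sub>R P l x" using Px[OF l] pos[OF l] by simp
    then show ?thesis using assms l by (simp add: P_scale P_diff scaleR_left_distrib)
  qed
  from half_op_twiceI[OF this] show ?thesis using assms by (intro bexI[of _ x]) auto
qed

text \<open>
  The wave operator \<open>(a, b) \<mapsto> (b, - \<A> a)\<close> in the unknowns \<open>(\<A>\<^sup>1\<^sup>/\<^sup>2 a, b)\<close>.
\<close>
definition wave_gen :: "'x \<times> 'x \<Rightarrow> 'x \<times> 'x" where
  "wave_gen w = (half_op (snd w), - half_op (fst w))"

text \<open>
  The squared norm of \<open>X\<^sub>-\<^sub>\<beta> \<times> X\<^sub>-\<^sub>\<beta>\<^sub>-\<^sub>1\<^sub>/\<^sub>2\<close> in the same unknowns, for \<open>\<alpha> = 1 + 2 \<beta>\<close>.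
\<close>
definition weak_energy :: "real \<Rightarrow> 'x \<times> 'x \<Rightarrow> real" where
  "weak_energy \<alpha> w = (\<Sum>\<^sub>\<infinity>l\<in>\<Lambda>. l powr (- \<alpha>) * ((norm (P l (fst w)))\<^sup>2 + (norm (P l (snd w)))\<^sup>2))"

lemma Parseval_pair:
  "((\<lambda>l. (norm (P l (fst w)))\<^sup>2 + (norm (P l (snd w)))\<^sup>2) has_sum (norm w)\<^sup>2) \<Lambda>"
  using has_sum_add[OF Parseval[of "fst w"] Parseval[of "snd w"]] by (simp add: norm_prod_def)

lemma Parseval_wave_gen:
  assumes "w \<in> half_dom \<times> half_dom"
  shows "((\<lambda>l. l * ((norm (P l (fst w)))\<^sup>2 + (norm (P l (snd w)))\<^sup>2)) has_sum (norm (wave_gen w))\<^sup>2) \<Lambda>"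
proof -
  from assms have w: "fst w \<in> half_dom" "snd w \<in> half_dom" by auto
  show ?thesis using Parseval_pair[of "wave_gen w"]
    by (simp add: wave_gen_def P_minus P_half_op_norm[OF w(1)] P_half_op_norm[OF w(2)]
        algebra_simps cong: has_sum_cong)
qed

lemma weak_energy_has_sum:
  assumes "\<alpha> \<ge> 0"
  shows "((\<lambda>l. l powr (- \<alpha>) * ((norm (P l (fst w)))\<^sup>2 + (norm (P l (snd w)))\<^sup>2)) has_sum weak_energy \<alpha> w) \<Lambda>"
  unfolding weak_energy_def
proof (rule has_sum_infsum, rule summable_on_comparison_test)
  show "(\<lambda>l. l0 powr (- \<alpha>) * ((norm (P l (fst w)))\<^sup>2 + (norm (P l (snd w)))\<^sup>2)) summable_on \<Lambda>"
    by (intro summable_on_cmult_right has_sum_imp_summable[OF Parseval_pair])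
  show "l powr (- \<alpha>) * ((norm (P l (fst w)))\<^sup>2 + (norm (P l (snd w)))\<^sup>2)
      \<le> l0 powr (- \<alpha>) * ((norm (P l (fst w)))\<^sup>2 + (norm (P l (snd w)))\<^sup>2)" if "l \<in> \<Lambda>" for l
    using l0_le[OF that] l0_pos assms by (intro mult_right_mono powr_mono2') auto
qed auto

lemma wave_gen_skew:
  assumes "v \<in> half_dom \<times> half_dom" "w \<in> half_dom \<times> half_dom"
  shows "wave_gen v \<bullet> w = - (v \<bullet> wave_gen w)"
proof -
  from assms have "fst v \<in> half_dom" "snd v \<in> half_dom" "fst w \<in> half_dom" "snd w \<in> half_dom"
    by auto
  then show ?thesis by (simp add: wave_gen_def inner_prod_def half_op_sym)
qed

lemma wave_gen_linear: "linear_op_on (half_dom \<times> half_dom) wave_gen"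
  unfolding linear_op_on_def
  using subspace_Times[OF half_dom_subspace half_dom_subspace]
  by (auto simp: wave_gen_def half_op_add half_op_scale)

text \<open>
  Eliminating one component leaves the equation of \<open>half_op_square_resolvent\<close>; equivalently,
  \<open>(I - \<epsilon> A)\<^sup>-\<^sup>1 = (I + \<epsilon> A) (I - \<epsilon>\<^sup>2 A\<^sup>2)\<^sup>-\<^sup>1\<close>.
\<close>
lemma wave_gen_resolvent:
  assumes e: "\<epsilon> \<noteq> 0"
  shows "\<exists>w\<in>half_dom \<times> half_dom. w - \<epsilon> *\<^sub>R wave_gen w = f"
proof -
  obtain p where p: "p \<in> half_dom" "half_op p \<in> half_dom" "p + \<epsilon>\<^sup>2 *\<^sub>R half_op (half_op p) = fst f"
    using half_op_square_resolvent[OF e] by blast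
  obtain q where q: "q \<in> half_dom" "half_op q \<in> half_dom" "q + \<epsilon>\<^sup>2 *\<^sub>R half_op (half_op q) = snd f"
    using half_op_square_resolvent[OF e] by blast
  define w where "w = (p + \<epsilon> *\<^sub>R half_op q, q - \<epsilon> *\<^sub>R half_op p)"
  have "w \<in> half_dom \<times> half_dom"
    using p q unfolding w_def by (auto intro!: half_op_add half_op_diff half_op_scale)
  moreover have "w - \<epsilon> *\<^sub>R wave_gen w = f"
    using p q unfolding w_def wave_gen_def
    by (intro prod_eqI) (simp_all add: half_op_add half_op_diff half_op_scale scaleR_diff_right
        scaleR_add_right power2_eq_square algebra_simps)
  ultimately show ?thesis by blast
qed

lemma wave_gen_coercive:
  assumes "w \<in> half_dom \<times> half_dom"
  shows "l0 * (norm w)\<^sup>2 \<le> (norm (wave_gen w))\<^sup>2"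
  by (rule has_sum_mono[OF has_sum_cmult_right[OF Parseval_pair] Parseval_wave_gen[OF assms]])
    (auto intro!: mult_right_mono l0_le)

text \<open>
  Here \<open>y = (I - dt A)\<^sup>-\<^sup>1 z\<close>. On the eigenspace of \<open>l\<close> the squared norm of \<open>A y\<close> is \<open>l / (1 + dt\<^sup>2 l)\<close> times
  that of \<open>z\<close>, so it measures the graph norm of \<open>z\<close> below the frequency \<open>1 / dt\<close>. Optimising
  over \<open>\<eta>\<close> would give a multiplicative interpolation inequality; the additive form is kept because it
  can be summed over time steps.
\<close>
lemma viscous_interpolation:
  assumes y: "y \<in> half_dom \<times> half_dom" and z: "z \<in> half_dom \<times> half_dom"
    and zy: "y - dt *\<^sub>R wave_gen y = z"
    and dt: "dt > 0" and \<eta>: "\<eta> > 0" and \<alpha>: "\<alpha> \<ge> 0"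
  shows "(norm z)\<^sup>2 \<le> 2 * \<eta> * (norm (wave_gen y))\<^sup>2 + \<eta> powr (- \<alpha>) * weak_energy \<alpha> z
           + dt\<^sup>2 * (norm (wave_gen z))\<^sup>2"
proof -
  define n where "n w l = (norm (P l (fst w)))\<^sup>2 + (norm (P l (snd w)))\<^sup>2" for w :: "'x \<times> 'x" and l
  have nz: "n z l = (1 + dt\<^sup>2 * l) * n y l" if l: "l \<in> \<Lambda>" for l
  proof -
    have "P l (fst z) = P l (fst y) - (dt * sqrt l) *\<^sub>R P l (snd y)"
      "P l (snd z) = P l (snd y) + (dt * sqrt l) *\<^sub>R P l (fst y)"
      using y l by (auto simp: zy[symmetric] wave_gen_def P_diff P_add P_scale P_half_op P_minus)
    then show ?thesis unfolding n_def
      using resolvent_symbol_norm[of "P l (fst y)" "dt * sqrt l" "P l (snd y)"] \<Lambda>_pos[OF l]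
      by (simp add: power_mult_distrib)
  qed
  have rhs: "((\<lambda>l. 2 * \<eta> * (l * n y l) + \<eta> powr (- \<alpha>) * (l powr (- \<alpha>) * n z l) + dt\<^sup>2 * (l * n z l)) has_sum
        (2 * \<eta> * (norm (wave_gen y))\<^sup>2 + \<eta> powr (- \<alpha>) * weak_energy \<alpha> z
           + dt\<^sup>2 * (norm (wave_gen z))\<^sup>2)) \<Lambda>"
    unfolding n_def
    by (intro has_sum_add has_sum_cmult_right Parseval_wave_gen weak_energy_has_sum y z \<alpha>)
  have lhs: "((\<lambda>l. n z l) has_sum (norm z)\<^sup>2) \<Lambda>" unfolding n_def by (rule Parseval_pair)
  have "n z l \<le> 2 * \<eta> * (l * n y l) + \<eta> powr (- \<alpha>) * (l powr (- \<alpha>) * n z l) + dt\<^sup>2 * (l * n z l)"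
    if l: "l \<in> \<Lambda>" for l
  proof -
    have "0 \<le> n y l" by (simp add: n_def)
    from mult_right_mono[OF interpolation_multiplier[OF \<Lambda>_pos[OF l] \<eta> dt \<alpha>] this]
    show ?thesis unfolding nz[OF l] by (simp add: algebra_simps)
  qed
  from has_sum_mono[OF lhs rhs this] show ?thesis by simp
qed

end

section \<open>Diagonalisation of a positive operator with compact inverse\<close>

text \<open>
  All spectral information comes from the inverse \<open>R\<close>, which is compact, symmetric and positive.
\<close>
locale compact_positive_operator =
  fixes D :: "'x::{real_inner, complete_space} set" and \<A> :: "'x \<Rightarrow> 'x"
  assumes self_adjoint: "self_adjoint_op D \<A>"
    and positive: "positive_op D \<A>"
    and compact_inverse: "has_compact_inverse D \<A>"
begin

abbreviation \<Lambda> :: "real set" where "\<Lambda> \<equiv> eigenvalues_op D \<A>"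
abbreviation E :: "real \<Rightarrow> 'x set" where "E \<equiv> eigenspace_op D \<A>"
abbreviation P :: "real \<Rightarrow> 'x \<Rightarrow> 'x" where "P l \<equiv> orth_proj (E l)"

definition R :: "'x \<Rightarrow> 'x" where "R = inv_into D \<A>"

lemma linear_\<A>: "linear_op_on D \<A>"
  using self_adjoint by (simp add: self_adjoint_op_def)

lemma D_subspace: "subspace D"
  and \<A>_scale: "x \<in> D \<Longrightarrow> \<A> (r *\<^sub>R x) = r *\<^sub>R \<A> x"
  using linear_\<A> by (auto simp: linear_op_on_def)

lemma \<A>_sym:
  assumes "x \<in> D" "y \<in> D" shows "\<A> x \<bullet> y = x \<bullet> \<A> y"
proof -
  have "(y, \<A> y) \<in> adjoint_graph D \<A>" using self_adjoint assms(2) by (auto simp: self_adjoint_op_def)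
  then show ?thesis using assms(1) by (auto simp: adjoint_graph_def)
qed

lemma bij_\<A>: "bij_betw \<A> D UNIV"
  using compact_inverse by (simp add: has_compact_inverse_def)

lemma R_in_D: "R y \<in> D" and \<A>_R: "\<A> (R y) = y" and R_\<A>: "x \<in> D \<Longrightarrow> R (\<A> x) = x"
  using bij_\<A> unfolding R_def
  by (auto simp: bij_betw_def inv_into_into f_inv_into_f inv_into_f_f)

lemma R_linear: "linear R" and R_compact: "compact (closure (R ` cball 0 1))"
  using compact_inverse by (simp_all add: has_compact_inverse_def compact_linear_map_def R_def)

lemma R_sym: "R x \<bullet> y = x \<bullet> R y"
  using \<A>_sym[OF R_in_D R_in_D, of x y] by (simp add: \<A>_R)

lemma R_pos: assumes "x \<noteq> 0" shows "R x \<bullet> x > 0"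
proof -
  have "R x \<noteq> 0"
    using \<A>_R[of x] \<A>_scale[OF R_in_D, of 0 0] assms by auto
  then have "\<A> (R x) \<bullet> R x > 0" using positive R_in_D by (auto simp: positive_op_def)
  then show ?thesis by (simp add: \<A>_R inner_commute)
qed

lemma R_bounded: "\<exists>C>0. \<forall>x. norm (R x) \<le> C * norm x"
proof -
  have "bounded (R ` cball 0 1)"
    using compact_imp_bounded[OF R_compact] closure_subset bounded_subset by blast
  then obtain C where C: "C > 0" "\<And>x. norm x \<le> 1 \<Longrightarrow> norm (R x) \<le> C"
    unfolding bounded_pos by auto
  have "norm (R x) \<le> C * norm x" for x
  proof (cases "x = 0")
    case True
    then show ?thesis by (simp add: linear_0[OF R_linear])
  next
    case False
    have "norm (R ((1 / norm x) *\<^sub>R x)) \<le> C" by (rule C(2)) (use False in simp)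
    then show ?thesis using False by (simp add: linear_scale[OF R_linear] field_simps)
  qed
  then show ?thesis using C(1) by blast
qed

lemma R_bounded_linear: "bounded_linear R"
proof -
  obtain C where "\<And>x. norm (R x) \<le> C * norm x" using R_bounded by blast
  then show ?thesis
    using R_linear by (intro bounded_linear_intro[where K = C]) (simp_all add: linear_add linear_scale mult.commute)
qed

lemma eigenvalues_lower_bound: "\<exists>l0>0. \<forall>l\<in>\<Lambda>. l0 \<le> l"
proof -
  obtain C where C: "C > 0" "\<And>x. norm (R x) \<le> C * norm x" using R_bounded by blast
  have "1 / C \<le> l" if "l \<in> \<Lambda>" for l
  proof -
    from that obtain x where x: "x \<in> D" "\<A> x = l *\<^sub>R x" "x \<noteq> 0"
      by (auto simp: eigenvalues_op_def eigenspace_op_def)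
    have "\<A> x \<bullet> x > 0" using positive x by (auto simp: positive_op_def)
    then have l: "l > 0" using x(2) inner_ge_zero[of x] by (auto simp: zero_less_mult_iff)
    have "norm x \<le> C * norm (l *\<^sub>R x)" using C(2)[of "\<A> x"] R_\<A>[OF x(1)] x(2) by simp
    also have "\<dots> = (C * l) * norm x" using l by simp
    finally have "1 \<le> C * l" using x(3) by simp
    then show ?thesis using C(1) by (simp add: field_simps)
  qed
  then show ?thesis using C(1) by (intro exI[of _ "1 / C"]) auto
qed

definition l0 :: real where "l0 = (SOME l0. 0 < l0 \<and> (\<forall>l\<in>\<Lambda>. l0 \<le> l))"

lemma l0: "0 < l0" "l \<in> \<Lambda> \<Longrightarrow> l0 \<le> l"
  using someI_ex[of "\<lambda>l0. 0 < l0 \<and> (\<forall>l\<in>\<Lambda>. l0 \<le> l)"] eigenvalues_lower_bound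
  unfolding l0_def by blast+

text \<open>
  Rewriting the eigenvalue equation with the bounded operator \<open>R\<close> makes it evident that eigenspaces are closed.
\<close>
lemma eigenspace_eq:
  assumes "l > 0" shows "E l = {x. l *\<^sub>R R x = x}"
proof (intro set_eqI iffI; simp)
  fix x assume "x \<in> E l"
  then have "x \<in> D" "\<A> x = l *\<^sub>R x" by (auto simp: eigenspace_op_def)
  then show "l *\<^sub>R R x = x" using R_\<A> by (metis linear_scale[OF R_linear])
next
  fix x assume x: "l *\<^sub>R R x = x"
  have "x \<in> D" using subspace_scale[OF D_subspace R_in_D, of l x] x by simp
  moreover have "\<A> x = l *\<^sub>R x" using \<A>_scale[OF R_in_D, of l x] x by (simp add: \<A>_R)
  ultimately show "x \<in> E l" by (simp add: eigenspace_op_def)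
qed

lemma eigenspace_subspace: "l \<in> \<Lambda> \<Longrightarrow> subspace (E l)"
  and eigenspace_closed: "l \<in> \<Lambda> \<Longrightarrow> closed (E l)"
proof -
  assume "l \<in> \<Lambda>"
  then have l: "l > 0" using l0 by fastforce
  interpret R: bounded_linear R by (rule R_bounded_linear)
  show "subspace (E l)" unfolding eigenspace_eq[OF l]
  proof (rule subspaceI)
    show "c *\<^sub>R x \<in> {x. l *\<^sub>R R x = x}" if "x \<in> {x. l *\<^sub>R R x = x}" for c x
      using that by (simp only: mem_Collect_eq R.scaleR scaleR_left_commute[of l c])
  qed (simp_all add: R.add R.zero scaleR_add_right)
  show "closed (E l)" unfolding eigenspace_eq[OF l]
    by (intro closed_Collect_eq continuous_intros R.continuous_on)
qed

lemma eigenspaces_orthogonal: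
  assumes "x \<in> E l" "y \<in> E m" "l \<noteq> m" shows "x \<bullet> y = 0"
proof -
  have "l * (x \<bullet> y) = m * (x \<bullet> y)"
    using assms(1,2) \<A>_sym[of x y] by (auto simp: eigenspace_op_def)
  then show ?thesis using assms(3) by simp
qed

text \<open>
  Let \<open>\<sigma>\<close> be the norm of \<open>R\<close> on \<open>M\<close>. Along a maximising sequence \<open>R\<^sup>2 x\<^sub>n - \<sigma>\<^sup>2 x\<^sub>n\<close> tends to 0, and
  compactness extracts a limit \<open>x\<close> with \<open>R\<^sup>2 x = \<sigma>\<^sup>2 x\<close>. Then \<open>R x + \<sigma> x\<close> is an eigenvector of \<open>R\<close>
  for \<open>\<sigma>\<close>; it does not vanish because \<open>R\<close> is positive.
\<close>
lemma eigenvector_in_orthogonal_invariant: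
  assumes M: "subspace M" "closed M" "\<And>x. x \<in> M \<Longrightarrow> R x \<in> M" and x0: "x0 \<in> M" "x0 \<noteq> 0"
  shows "\<exists>l\<in>\<Lambda>. \<exists>v\<in>E l. v \<in> M \<and> v \<noteq> 0"
proof -
  interpret R: bounded_linear R by (rule R_bounded_linear)
  obtain C where C: "C > 0" "\<And>x. norm (R x) \<le> C * norm x" using R_bounded by blast
  define U where "U = {x \<in> M. norm x \<le> 1}"
  define \<sigma> where "\<sigma> = (SUP x\<in>U. norm (R x))"
  have U0: "0 \<in> U" using M(1) by (simp add: U_def subspace_0)
  have bdd: "bdd_above ((\<lambda>x. norm (R x)) ` U)"
  proof (rule bdd_aboveI2[where M = C])
    fix x assume "x \<in> U"
    then have "C * norm x \<le> C * 1" using C(1) by (intro mult_left_mono) (auto simp: U_def)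
    then show "norm (R x) \<le> C" using C(2)[of x] by simp
  qed
  have le: "norm (R x) \<le> \<sigma>" if "x \<in> U" for x unfolding \<sigma>_def by (rule cSUP_upper[OF that bdd])
  have le': "norm (R x) \<le> \<sigma> * norm x" if "x \<in> M" for x
  proof (cases "x = 0")
    case True
    then show ?thesis by (simp add: R.zero)
  next
    case False
    have "(1 / norm x) *\<^sub>R x \<in> U" using that M(1) False by (simp add: U_def subspace_scale)
    from le[OF this] show ?thesis using False by (simp add: R.scaleR field_simps)
  qed
  have "R x0 \<noteq> 0" using R_pos[OF x0(2)] by auto
  then have "0 < norm (R x0)" by simp
  also have "\<dots> \<le> \<sigma> * norm x0" by (rule le'[OF x0(1)])
  finally have \<sigma>: "\<sigma> > 0" using x0(2) by (simp add: zero_less_mult_iff)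
  have "\<exists>x\<in>U. \<sigma> - 1 / real (Suc n) < norm (R x)" for n
    using less_cSUP_iff[of U "\<lambda>x. norm (R x)" "\<sigma> - 1 / real (Suc n)"] U0 bdd
    unfolding \<sigma>_def by auto
  then obtain X where X: "\<And>n. X n \<in> U" "\<And>n. \<sigma> - 1 / real (Suc n) < norm (R (X n))" by metis
  have lim\<sigma>: "(\<lambda>n. norm (R (X n))) \<longlonglongrightarrow> \<sigma>"
  proof (rule tendsto_sandwich)
    show "(\<lambda>n. \<sigma> - 1 / real (Suc n)) \<longlonglongrightarrow> \<sigma>"
      using tendsto_diff[OF tendsto_const LIMSEQ_Suc[OF lim_1_over_n], of \<sigma>] by simp
    show "(\<lambda>n. \<sigma>) \<longlonglongrightarrow> \<sigma>" by simp
  qed (use X le in \<open>auto intro!: always_eventually less_imp_le\<close>)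
  have near: "(norm (R (R (X n)) - \<sigma>\<^sup>2 *\<^sub>R X n))\<^sup>2 \<le> \<sigma> ^ 4 - \<sigma>\<^sup>2 * (norm (R (X n)))\<^sup>2" for n
  proof -
    have XM: "X n \<in> M" "norm (X n) \<le> 1" using X(1) by (auto simp: U_def)
    have "(norm (R (R (X n))))\<^sup>2 \<le> (\<sigma> * norm (R (X n)))\<^sup>2"
      using le'[OF M(3)[OF XM(1)]] by (intro power_mono) auto
    moreover have "(norm (X n))\<^sup>2 \<le> 1" using XM(2) by (simp add: power_le_one)
    then have "\<sigma> ^ 4 * (norm (X n))\<^sup>2 \<le> \<sigma> ^ 4 * 1" using \<sigma> by (intro mult_left_mono) auto
    moreover have "R (R (X n)) \<bullet> X n = (norm (R (X n)))\<^sup>2"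
      by (simp add: R_sym[of "R (X n)"] power2_norm_eq_inner)
    then have "(norm (R (R (X n)) - \<sigma>\<^sup>2 *\<^sub>R X n))\<^sup>2
        = (norm (R (R (X n))))\<^sup>2 - 2 * \<sigma>\<^sup>2 * (norm (R (X n)))\<^sup>2 + \<sigma> ^ 4 * (norm (X n))\<^sup>2"
      unfolding power2_norm_eq_inner
      by (simp add: inner_diff_left inner_diff_right inner_commute eval_nat_numeral algebra_simps)
    ultimately show ?thesis by (simp add: power_mult_distrib)
  qed
  have "(\<lambda>n. \<sigma> ^ 4 - \<sigma>\<^sup>2 * (norm (R (X n)))\<^sup>2) \<longlonglongrightarrow> \<sigma> ^ 4 - \<sigma>\<^sup>2 * \<sigma>\<^sup>2"
    by (intro tendsto_intros lim\<sigma>)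
  then have "(\<lambda>n. \<sigma> ^ 4 - \<sigma>\<^sup>2 * (norm (R (X n)))\<^sup>2) \<longlonglongrightarrow> 0"
    by (simp add: eval_nat_numeral)
  then have "(\<lambda>n. (norm (R (R (X n)) - \<sigma>\<^sup>2 *\<^sub>R X n))\<^sup>2) \<longlonglongrightarrow> 0"
    by (rule tendsto_sandwich[OF _ _ tendsto_const, rotated 2]) (auto intro!: always_eventually near)
  from tendsto_real_sqrt[OF this] have diff0: "(\<lambda>n. R (R (X n)) - \<sigma>\<^sup>2 *\<^sub>R X n) \<longlonglongrightarrow> 0"
    by (simp add: tendsto_norm_zero_iff)
  have "seq_compact (closure (R ` cball 0 1))" using R_compact compact_imp_seq_compact by blast
  moreover have "\<forall>n. R (X n) \<in> closure (R ` cball 0 1)"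
    using X(1) by (auto simp: U_def intro!: closure_subset[THEN subsetD])
  ultimately obtain y r where r: "strict_mono (r :: nat \<Rightarrow> nat)" "((\<lambda>n. R (X n)) \<circ> r) \<longlonglongrightarrow> y"
    by (rule seq_compactE)
  have y: "(\<lambda>n. R (X (r n))) \<longlonglongrightarrow> y" using r(2) by (simp add: o_def)
  have "(\<lambda>n. R (R (X (r n)))) \<longlonglongrightarrow> R y" by (rule R.tendsto[OF y])
  moreover have "(\<lambda>n. R (R (X (r n))) - \<sigma>\<^sup>2 *\<^sub>R X (r n)) \<longlonglongrightarrow> 0"
    using LIMSEQ_subseq_LIMSEQ[OF diff0 r(1)] by (simp add: o_def)
  ultimately have "(\<lambda>n. R (R (X (r n))) - (R (R (X (r n))) - \<sigma>\<^sup>2 *\<^sub>R X (r n))) \<longlonglongrightarrow> R y - 0"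
    by (rule tendsto_diff)
  then have "(\<lambda>n. (1 / \<sigma>\<^sup>2) *\<^sub>R (\<sigma>\<^sup>2 *\<^sub>R X (r n))) \<longlonglongrightarrow> (1 / \<sigma>\<^sup>2) *\<^sub>R R y"
    by (intro tendsto_intros) simp
  then have Xlim: "(\<lambda>n. X (r n)) \<longlonglongrightarrow> (1 / \<sigma>\<^sup>2) *\<^sub>R R y" using \<sigma> by simp
  define x where "x = (1 / \<sigma>\<^sup>2) *\<^sub>R R y"
  have "(\<lambda>n. R (X (r n))) \<longlonglongrightarrow> R x" using R.tendsto[OF Xlim] by (simp add: x_def)
  then have yx: "y = R x" using y LIMSEQ_unique by blast
  have RRx: "R (R x) = \<sigma>\<^sup>2 *\<^sub>R x" unfolding yx[symmetric] using \<sigma> by (simp add: x_def)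
  have "(\<lambda>n. norm (R (X (r n)))) \<longlonglongrightarrow> \<sigma>" using LIMSEQ_subseq_LIMSEQ[OF lim\<sigma> r(1)] by (simp add: o_def)
  then have "norm y = \<sigma>" using tendsto_norm[OF y] LIMSEQ_unique by blast
  then have x0: "x \<noteq> 0" using \<sigma> yx R.zero by auto
  have xM: "x \<in> M"
    using closed_sequentially[OF M(2) _ Xlim] X(1) by (auto simp: x_def U_def)
  define v where "v = R x + \<sigma> *\<^sub>R x"
  have Rv: "R v = \<sigma> *\<^sub>R v" by (simp add: v_def R.add R.scaleR RRx scaleR_add_right power2_eq_square)
  have "v \<bullet> x = R x \<bullet> x + \<sigma> * (x \<bullet> x)" by (simp add: v_def inner_add_left)
  also have "\<dots> > 0" using R_pos[OF x0] \<sigma> by (simp add: add_pos_nonneg)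
  finally have v0: "v \<noteq> 0" by auto
  have vM: "v \<in> M" using xM M(1,3) by (simp add: v_def subspace_add subspace_scale)
  have "(1 / \<sigma>) *\<^sub>R R v = v" using Rv \<sigma> by simp
  then have vE: "v \<in> E (1 / \<sigma>)" using \<sigma> by (simp add: eigenspace_eq)
  then have "1 / \<sigma> \<in> \<Lambda>" using v0 by (auto simp: eigenvalues_op_def)
  then show ?thesis using vE vM v0 by blast
qed

text \<open>
  The orthogonal complement of all eigenspaces is closed and invariant under \<open>R\<close>; if it were nontrivial
  it would contain an eigenvector, which would be orthogonal to itself.
\<close>
lemma eigenspaces_complete:
  assumes x: "\<And>l. l \<in> \<Lambda> \<Longrightarrow> P l x = 0" shows "x = 0"
proof (rule ccontr)
  assume "x \<noteq> 0"
  define M where "M = (\<Inter>l\<in>\<Lambda>. \<Inter>e\<in>E l. {x. x \<bullet> e = 0})"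
  have xM: "x \<in> M"
    unfolding M_def using x orth_proj_props(2)[OF eigenspace_subspace eigenspace_closed, of _ _ x]
    by auto
  have "subspace M" unfolding M_def
    by (intro subspace_Inter ballI) (auto simp: subspace_def inner_add_left)
  moreover have "closed M" unfolding M_def
    by (intro closed_INT ballI closed_Collect_eq continuous_intros)
  moreover have "R y \<in> M" if "y \<in> M" for y
  proof -
    have "R y \<bullet> e = 0" if l: "l \<in> \<Lambda>" and e: "e \<in> E l" for l e
    proof -
      have l1: "l > 0" using l0(1) l0(2)[OF l] by simp
      have "l * (R y \<bullet> e) = y \<bullet> (l *\<^sub>R R e)" by (simp add: R_sym)
      also have "l *\<^sub>R R e = e" using e by (simp add: eigenspace_eq[OF l1])
      also have "y \<bullet> e = 0" using \<open>y \<in> M\<close> l e by (auto simp: M_def)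
      finally show ?thesis using l1 by simp
    qed
    then show ?thesis by (auto simp: M_def)
  qed
  ultimately obtain l v where "l \<in> \<Lambda>" "v \<in> E l" "v \<in> M" "v \<noteq> 0"
    using eigenvector_in_orthogonal_invariant[OF _ _ _ xM \<open>x \<noteq> 0\<close>] by blast
  then have "v \<bullet> v = 0" by (auto simp: M_def)
  then show False using \<open>v \<noteq> 0\<close> by simp
qed

sublocale spectral_resolution \<Lambda> P l0
proof (rule spectral_resolution.intro)
  note cl = eigenspace_subspace eigenspace_closed
  show "linear (P l)" if "l \<in> \<Lambda>" for l by (rule orth_proj_linear[OF cl[OF that]])
  show "P l x \<bullet> y = x \<bullet> P l y" if "l \<in> \<Lambda>" for l x y by (rule orth_proj_inner[OF cl[OF that]])
  show "P l (P m x) = (if l = m then P l x else 0)" if l: "l \<in> \<Lambda>" and m: "m \<in> \<Lambda>" for l m x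
  proof (cases "l = m")
    case True
    then show ?thesis using orth_proj_props(1)[OF cl[OF m]] by (auto intro!: orth_proj_eqI cl m)
  next
    case False
    have "P l (P m x) = 0"
      using False orth_proj_props(1)[OF cl[OF m], of x]
      by (intro orth_proj_eqI cl l subspace_0) (auto intro: eigenspaces_orthogonal)
    then show ?thesis using False by simp
  qed
  show "x = 0" if "\<And>l. l \<in> \<Lambda> \<Longrightarrow> P l x = 0" for x by (rule eigenspaces_complete[OF that])
qed (rule l0)+

lemma P_\<A>:
  assumes x: "x \<in> D" and l: "l \<in> \<Lambda>"
  shows "P l (\<A> x) = l *\<^sub>R P l x"
proof (rule orth_proj_eqI[OF eigenspace_subspace[OF l] eigenspace_closed[OF l]])
  note p = orth_proj_props[OF eigenspace_subspace[OF l] eigenspace_closed[OF l]]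
  show "l *\<^sub>R P l x \<in> E l" by (intro subspace_scale eigenspace_subspace l p)
  fix v assume v: "v \<in> E l"
  then have "\<A> x \<bullet> v = l * (x \<bullet> v)" using \<A>_sym[OF x, of v] by (auto simp: eigenspace_op_def)
  then show "(\<A> x - l *\<^sub>R P l x) \<bullet> v = 0"
    using p(2)[OF v, of x] by (simp add: inner_diff_left)
qed

text \<open>
  If \<open>half_op\<close> can be applied twice to \<open>x\<close>, then \<open>x\<close> and \<open>R\<close> of the result have the same components.
\<close>
lemma D_iff_half_dom: "x \<in> D \<longleftrightarrow> x \<in> half_dom \<and> half_op x \<in> half_dom"
  and \<A>_eq_half_op_twice: "x \<in> D \<Longrightarrow> \<A> x = half_op (half_op x)"
proof -
  have *: "x \<in> half_dom" "half_op x \<in> half_dom" "half_op (half_op x) = \<A> x" if "x \<in> D" for x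
    using half_op_twiceI[OF P_\<A>[OF that]] by auto
  then show "x \<in> D \<Longrightarrow> \<A> x = half_op (half_op x)" by simp
  have "x \<in> D" if x: "x \<in> half_dom" "half_op x \<in> half_dom"
  proof -
    define y where "y = half_op (half_op x)"
    have "R y = x"
    proof (rule eqI_P)
      fix l assume l: "l \<in> \<Lambda>"
      have "l *\<^sub>R P l (R y) = P l y" using P_\<A>[OF R_in_D l, of y] by (simp add: \<A>_R)
      also have "\<dots> = l *\<^sub>R P l x" using \<Lambda>_pos[OF l] by (simp add: y_def P_half_op x l)
      finally show "P l (R y) = P l x" using \<Lambda>_pos[OF l] by (simp only: scaleR_cancel_left) simp
    qed
    then show ?thesis using R_in_D by metis
  qed
  then show "x \<in> D \<longleftrightarrow> x \<in> half_dom \<and> half_op x \<in> half_dom" using * by blast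
qed

lemma power_dom_half: "power_dom D \<A> (1/2) = half_dom"
  unfolding power_dom_def half_dom_def
  by (intro Collect_cong summable_on_cong) (simp add: \<Lambda>_pos less_imp_le)

lemma power_op_half: "power_op D \<A> (1/2) x = half_op x"
  unfolding power_op_def half_op_def
  by (intro infsum_cong) (simp add: \<Lambda>_pos less_imp_le powr_half_sqrt)

lemma X_norm_has_sum:
  assumes "(\<lambda>l. (l powr s)\<^sup>2 * (norm (P l x))\<^sup>2) summable_on \<Lambda>"
  shows "((\<lambda>l. (l powr s)\<^sup>2 * (norm (P l x))\<^sup>2) has_sum (X_norm D \<A> s x)\<^sup>2) \<Lambda>"
proof -
  have "P l (power_op D \<A> s x) = (l powr s) *\<^sub>R P l x" if "l \<in> \<Lambda>" for l
    unfolding power_op_def by (rule multiplier_P[OF assms that])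
  then show ?thesis
    unfolding X_norm_def using Parseval[of "power_op D \<A> s x"]
    by (simp add: power_mult_distrib cong: has_sum_cong)
qed

text \<open>
  The factor \<open>l\<close> gained by passing from \<open>a\<close> to \<open>half_op a\<close> shifts the exponent \<open>- 2 \<beta>\<close> to \<open>- 2 \<beta> - 1\<close>.
\<close>
lemma X_norms_eq_weak_energy:
  assumes a: "a \<in> half_dom" and \<beta>: "\<beta> \<ge> - 1/2"
  shows "(X_norm D \<A> (- \<beta>) a)\<^sup>2 + (X_norm D \<A> (- \<beta> - 1/2) b)\<^sup>2 = weak_energy (1 + 2 * \<beta>) (half_op a, b)"
proof -
  define s where "s = - \<beta> - 1/2"
  have "- (1 + 2 * \<beta>) = s + s" by (simp add: s_def)
  then have s: "l powr (- (1 + 2 * \<beta>)) = (l powr s)\<^sup>2" for l :: real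
    by (simp only: power2_eq_square powr_add)
  have bd: "\<bar>l powr s\<bar> \<le> l0 powr s" if "l \<in> \<Lambda>" for l
    using l0_le[OF that] l0_pos \<beta> by (simp add: s_def powr_mono2')
  note sm = bounded_multiplier_summable[of "\<lambda>l. l powr s", OF bd]
  have conv: "(l powr s)\<^sup>2 * (norm (P l (half_op a)))\<^sup>2 = (l powr (- \<beta>))\<^sup>2 * (norm (P l a))\<^sup>2"
    if l: "l \<in> \<Lambda>" for l
  proof -
    have "(l powr (- \<beta>))\<^sup>2 = (l powr s)\<^sup>2 * l powr 1"
      unfolding power2_eq_square powr_add[symmetric] by (simp add: s_def)
    then show ?thesis using \<Lambda>_pos[OF l] by (simp add: P_half_op_norm[OF a l])
  qed
  have "(\<lambda>l. (l powr (- \<beta>))\<^sup>2 * (norm (P l a))\<^sup>2) summable_on \<Lambda>"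
    using sm[of "half_op a"] conv by (simp cong: summable_on_cong)
  from has_sum_add[OF X_norm_has_sum[OF this] X_norm_has_sum[OF sm[of b]]]
  have "((\<lambda>l. (l powr s)\<^sup>2 * (norm (P l (half_op a)))\<^sup>2 + (l powr s)\<^sup>2 * (norm (P l b))\<^sup>2) has_sum
      ((X_norm D \<A> (- \<beta>) a)\<^sup>2 + (X_norm D \<A> s b)\<^sup>2)) \<Lambda>"
    using conv by (simp cong: has_sum_cong)
  moreover have "((\<lambda>l. (l powr s)\<^sup>2 * (norm (P l (half_op a)))\<^sup>2 + (l powr s)\<^sup>2 * (norm (P l b))\<^sup>2) has_sum
      weak_energy (1 + 2 * \<beta>) (half_op a, b)) \<Lambda>"
    using weak_energy_has_sum[of "1 + 2 * \<beta>" "(half_op a, b)"] \<beta> s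
    by (simp add: distrib_left cong: has_sum_cong)
  ultimately show ?thesis using has_sum_unique s_def by blast
qed

end

section \<open>Skew operators and the viscous midpoint scheme\<close>

text \<open>
  On a Hilbert space the range condition singles out the skew-adjoint operators among the
  skew-symmetric ones. In this form it directly solves the implicit equations of the scheme.
\<close>
locale skew_operator =
  fixes dom :: "'h::real_inner set" and A :: "'h \<Rightarrow> 'h"
  assumes linear_A: "linear_op_on dom A"
    and skew: "x \<in> dom \<Longrightarrow> y \<in> dom \<Longrightarrow> A x \<bullet> y = - (x \<bullet> A y)"
    and resolvent: "\<epsilon> \<noteq> 0 \<Longrightarrow> \<exists>x\<in>dom. x - \<epsilon> *\<^sub>R A x = f"
begin

lemma dom_subspace: "subspace dom"
  and A_add: "x \<in> dom \<Longrightarrow> y \<in> dom \<Longrightarrow> A (x + y) = A x + A y"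
  and A_scale: "x \<in> dom \<Longrightarrow> A (r *\<^sub>R x) = r *\<^sub>R A x"
  using linear_A unfolding linear_op_on_def by auto

lemma dom_add: "x \<in> dom \<Longrightarrow> y \<in> dom \<Longrightarrow> x + y \<in> dom"
  and dom_diff: "x \<in> dom \<Longrightarrow> y \<in> dom \<Longrightarrow> x - y \<in> dom"
  and dom_scale: "x \<in> dom \<Longrightarrow> r *\<^sub>R x \<in> dom"
  using dom_subspace by (auto intro: subspace_add subspace_diff subspace_scale)

lemma A_diff: "x \<in> dom \<Longrightarrow> y \<in> dom \<Longrightarrow> A (x - y) = A x - A y"
  using A_add[of x "- 1 *\<^sub>R y"] A_scale[of y "-1"] dom_scale[of y "-1"] by simp

lemma A_inner_self: "x \<in> dom \<Longrightarrow> A x \<bullet> x = 0"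
  using skew[of x x] by (simp add: inner_commute)

lemma A_A_inner_self: "x \<in> dom \<Longrightarrow> A x \<in> dom \<Longrightarrow> A (A x) \<bullet> x = - (norm (A x))\<^sup>2"
  using skew[of "A x" x] by (simp add: power2_norm_eq_inner)

lemma resolvent_norm:
  assumes "x \<in> dom"
  shows "(norm (x - \<epsilon> *\<^sub>R A x))\<^sup>2 = (norm x)\<^sup>2 + \<epsilon>\<^sup>2 * (norm (A x))\<^sup>2"
  using A_inner_self[OF assms] unfolding power2_norm_eq_inner
  by (simp add: inner_diff_left inner_diff_right inner_commute power2_eq_square algebra_simps)

lemma resolvent_norm_le:
  assumes "x \<in> dom"
  shows "norm x \<le> norm (x - \<epsilon> *\<^sub>R A x)" "\<bar>\<epsilon>\<bar> * norm (A x) \<le> norm (x - \<epsilon> *\<^sub>R A x)"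
proof -
  show "norm x \<le> norm (x - \<epsilon> *\<^sub>R A x)"
    by (rule power2_le_imp_le) (simp_all add: resolvent_norm[OF assms])
  show "\<bar>\<epsilon>\<bar> * norm (A x) \<le> norm (x - \<epsilon> *\<^sub>R A x)"
    by (rule power2_le_imp_le) (simp_all add: resolvent_norm[OF assms] power_mult_distrib)
qed

lemma viscosity_norm:
  assumes "x \<in> dom" "A x \<in> dom"
  shows "(norm (x - s *\<^sub>R A (A x)))\<^sup>2 = (norm x)\<^sup>2 + 2 * s * (norm (A x))\<^sup>2 + s\<^sup>2 * (norm (A (A x)))\<^sup>2"
  using A_A_inner_self[OF assms] unfolding power2_norm_eq_inner
  by (simp add: inner_diff_left inner_diff_right inner_commute power2_eq_square algebra_simps)

text \<open>
  With \<open>\<epsilon>\<^sup>2 = s\<close> the operator \<open>I - s A\<^sup>2\<close> factors as \<open>(I + \<epsilon> A) (I - \<epsilon> A)\<close>.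
\<close>
lemma viscosity_solvable:
  assumes "s > 0"
  shows "\<exists>x\<in>dom. A x \<in> dom \<and> x - s *\<^sub>R A (A x) = f"
proof -
  define \<epsilon> where "\<epsilon> = sqrt s"
  have e: "\<epsilon> \<noteq> 0" "\<epsilon> * \<epsilon> = s" using assms by (auto simp: \<epsilon>_def)
  obtain y where y: "y \<in> dom" "y - (- \<epsilon>) *\<^sub>R A y = f" using resolvent[of "- \<epsilon>" f] e by auto
  obtain x where x: "x \<in> dom" "x - \<epsilon> *\<^sub>R A x = y" using resolvent[of \<epsilon> y] e by auto
  have Ax: "A x = (1 / \<epsilon>) *\<^sub>R (x - y)" using e by (simp add: x(2)[symmetric])
  then have Axd: "A x \<in> dom" using x(1) y(1) by (simp add: dom_scale dom_diff)
  have "A y = A x - \<epsilon> *\<^sub>R A (A x)"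
    using x Axd by (simp add: x(2)[symmetric] A_diff A_scale dom_scale)
  then have "x - s *\<^sub>R A (A x) = f"
    using x(2) y(2) by (simp add: scaleR_diff_right e(2)) (simp add: algebra_simps)
  then show ?thesis using x(1) Axd by blast
qed

text \<open>
  Free orbits have the source \<open>f = 0\<close>. Damping enters as \<open>f = N m\<close> with \<open>m\<close> the midpoint of the damped
  orbit; for the difference of a damped and a free orbit this is not the midpoint of the step itself,
  which is why the source is a separate argument.
\<close>
definition viscous_step :: "real \<Rightarrow> 'h \<Rightarrow> 'h \<Rightarrow> 'h \<Rightarrow> 'h \<Rightarrow> bool" where
  "viscous_step dt f w wt w' \<longleftrightarrow>
     (w + wt) /\<^sub>R 2 \<in> dom \<and> wt - w = dt *\<^sub>R (A ((w + wt) /\<^sub>R 2) - f) \<and>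
     w' \<in> dom \<and> A w' \<in> dom \<and> w' - wt = dt ^ 3 *\<^sub>R A (A w')"

text \<open>
  The midpoint rule is conservative up to the source because \<open>A m \<bullet> m = 0\<close>; the implicit viscous step
  dissipates.
\<close>
lemma viscous_step_energy:
  assumes "viscous_step dt f w wt w'"
  shows "(norm w')\<^sup>2 + 2 * dt ^ 3 * (norm (A w'))\<^sup>2 + dt ^ 6 * (norm (A (A w')))\<^sup>2 = (norm wt)\<^sup>2"
    and "(norm wt)\<^sup>2 = (norm w)\<^sup>2 - 2 * dt * (f \<bullet> ((w + wt) /\<^sub>R 2))"
proof -
  from assms have w': "w' \<in> dom" "A w' \<in> dom" and wt: "wt = w' - dt ^ 3 *\<^sub>R A (A w')"
    by (auto simp: viscous_step_def algebra_simps)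
  show "(norm w')\<^sup>2 + 2 * dt ^ 3 * (norm (A w'))\<^sup>2 + dt ^ 6 * (norm (A (A w')))\<^sup>2 = (norm wt)\<^sup>2"
    unfolding wt viscosity_norm[OF w'] by (simp flip: power_mult)
  define m where "m = (w + wt) /\<^sub>R 2"
  have m: "m \<in> dom" "wt - w = dt *\<^sub>R (A m - f)" using assms by (auto simp: viscous_step_def m_def)
  have "(norm wt)\<^sup>2 - (norm w)\<^sup>2 = (wt - w) \<bullet> (2 *\<^sub>R m)"
    unfolding power2_norm_eq_inner m_def
    by (simp add: inner_diff_left inner_add_right inner_commute algebra_simps)
  also have "\<dots> = - 2 * dt * (f \<bullet> m)"
    unfolding m(2) using A_inner_self[OF m(1)] by (simp add: inner_diff_left)
  finally show "(norm wt)\<^sup>2 = (norm w)\<^sup>2 - 2 * dt * (f \<bullet> ((w + wt) /\<^sub>R 2))" by (simp add: m_def)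
qed

lemma viscous_step_diff:
  assumes "viscous_step dt f v vt v'" "viscous_step dt g w wt w'"
  shows "viscous_step dt (f - g) (v - w) (vt - wt) (v' - w')"
proof -
  have e: "((v - w) + (vt - wt)) /\<^sub>R 2 = (v + vt) /\<^sub>R 2 - (w + wt) /\<^sub>R 2"
    by (simp add: algebra_simps)
  note vv = assms(1)[unfolded viscous_step_def] and ww = assms(2)[unfolded viscous_step_def]
  have "(vt - wt) - (v - w) = (vt - v) - (wt - w)" "(v' - w') - (vt - wt) = (v' - vt) - (w' - wt)"
    by simp_all
  moreover have "A ((v + vt) /\<^sub>R 2 - (w + wt) /\<^sub>R 2) = A ((v + vt) /\<^sub>R 2) - A ((w + wt) /\<^sub>R 2)"
    "A (v' - w') = A v' - A w'" "A (A v' - A w') = A (A v') - A (A w')"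
    using vv ww by (auto intro!: A_diff)
  ultimately show ?thesis
    unfolding viscous_step_def e using vv ww by (simp add: dom_diff scaleR_diff_right)
qed

lemma viscous_step_exists:
  assumes "dt > 0"
  shows "\<exists>wt w'. viscous_step dt 0 w wt w'"
proof -
  obtain m where m: "m \<in> dom" "m - (dt/2) *\<^sub>R A m = w" using resolvent[of "dt/2" w] assms by auto
  define wt where "wt = 2 *\<^sub>R m - w"
  have mm: "(w + wt) /\<^sub>R 2 = m" by (simp add: wt_def)
  have "2 *\<^sub>R m - w - w = 2 *\<^sub>R (m - w)" by (simp add: scaleR_2)
  also have "m - w = (dt/2) *\<^sub>R A m" by (simp flip: m(2))
  finally have "wt - w = dt *\<^sub>R A m" by (simp add: wt_def)
  moreover obtain w' where "w' \<in> dom" "A w' \<in> dom" "w' - dt ^ 3 *\<^sub>R A (A w') = wt"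
    using viscosity_solvable[of "dt ^ 3" wt] assms by auto
  ultimately have "viscous_step dt 0 w wt w'"
    unfolding viscous_step_def mm using m(1) by (auto simp: algebra_simps)
  then show ?thesis by blast
qed

definition viscous_orbit :: "real \<Rightarrow> (nat \<Rightarrow> 'h) \<Rightarrow> (nat \<Rightarrow> 'h) \<Rightarrow> (nat \<Rightarrow> 'h) \<Rightarrow> bool" where
  "viscous_orbit dt f w wt \<longleftrightarrow> (\<forall>k. viscous_step dt (f k) (w k) (wt (Suc k)) (w (Suc k)))"

lemma viscous_orbit_energy:
  assumes "viscous_orbit dt f w wt"
  shows "(norm (w (Suc k)))\<^sup>2 + 2 * dt ^ 3 * (norm (A (w (Suc k))))\<^sup>2
      + dt ^ 6 * (norm (A (A (w (Suc k)))))\<^sup>2 = (norm (wt (Suc k)))\<^sup>2"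
    and "(norm (wt (Suc k)))\<^sup>2 = (norm (w k))\<^sup>2 - 2 * dt * (f k \<bullet> midpt w wt k)"
  using viscous_step_energy[of dt "f k" "w k" "wt (Suc k)" "w (Suc k)"] assms
  unfolding viscous_orbit_def midpt_def by blast+

lemma free_orbit_exists:
  assumes "dt > 0"
  shows "\<exists>u ut. u 0 = w \<and> viscous_orbit dt (\<lambda>k. 0) u ut"
proof -
  have "\<forall>w. \<exists>p. viscous_step dt 0 w (fst p) (snd p)"
    using viscous_step_exists[OF assms] by simp
  from choice[OF this] obtain p where p: "\<forall>w. viscous_step dt 0 w (fst (p w)) (snd (p w))" ..
  define s s' where "s w = fst (p w)" and "s' w = snd (p w)" for w
  have s: "viscous_step dt 0 w (s w) (s' w)" for w using p by (simp add: s_def s'_def)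
  define u where "u k = (s' ^^ k) w" for k
  have "viscous_orbit dt (\<lambda>k. 0) u (\<lambda>k. s (u (k - 1)))"
    unfolding viscous_orbit_def using s by (simp add: u_def)
  moreover have "u 0 = w" by (simp add: u_def)
  ultimately show ?thesis by blast
qed

end

section \<open>Dissipation of the damped scheme\<close>

text \<open>
  \<open>C\<close> stands for \<open>B\<^sup>*\<close> and \<open>N\<close> for \<open>B B\<^sup>*\<close>.
\<close>
locale damped_skew_operator = skew_operator dom A
  for dom :: "'h::real_inner set" and A +
  fixes C :: "'h \<Rightarrow> 'y::real_inner" and N :: "'h \<Rightarrow> 'h" and b \<kappa> :: real
  assumes C_linear: "linear C"
    and C_bound: "norm (C x) \<le> b * norm x"
    and N_inner: "N x \<bullet> y = C x \<bullet> C y"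
    and b_nonneg: "b \<ge> 0"
    and coercive: "x \<in> dom \<Longrightarrow> norm x \<le> \<kappa> * norm (A x)"
    and \<kappa>_pos: "\<kappa> > 0"
begin

lemma N_diff: "N (x - y) = N x - N y"
  by (rule vector_eq_rdot[THEN iffD1])
    (simp add: N_inner inner_diff_left linear_diff[OF C_linear])

lemma N_scale: "N (r *\<^sub>R x) = r *\<^sub>R N x"
  by (rule vector_eq_rdot[THEN iffD1]) (simp add: N_inner linear_scale[OF C_linear])

lemma N_bound: "norm (N x) \<le> b\<^sup>2 * norm x"
proof (cases "N x = 0")
  case False
  have "norm (N x) * norm (N x) = C x \<bullet> C (N x)"
    by (simp flip: N_inner power2_eq_square add: power2_norm_eq_inner)
  also have "\<dots> \<le> norm (C x) * norm (C (N x))" by (rule norm_cauchy_schwarz)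
  also have "\<dots> \<le> (b * norm x) * (b * norm (N x))"
    using b_nonneg by (intro mult_mono C_bound) auto
  finally show ?thesis using False by (simp add: power2_eq_square mult.assoc mult.left_commute)
qed simp

definition damped_orbit :: "real \<Rightarrow> (nat \<Rightarrow> 'h) \<Rightarrow> (nat \<Rightarrow> 'h) \<Rightarrow> bool" where
  "damped_orbit dt z zt \<longleftrightarrow> viscous_orbit dt (\<lambda>k. N (midpt z zt k)) z zt"

lemma damped_orbit_step:
  "damped_orbit dt z zt \<Longrightarrow> viscous_step dt (N (midpt z zt k)) (z k) (zt (Suc k)) (z (Suc k))"
  by (simp add: damped_orbit_def viscous_orbit_def)

lemma damped_orbit_shift:
  "damped_orbit dt z zt \<Longrightarrow> damped_orbit dt (\<lambda>k. z (j + k)) (\<lambda>k. zt (j + k))"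
  unfolding damped_orbit_def viscous_orbit_def midpt_def by (metis add_Suc_right)

lemma damped_energy:
  assumes "damped_orbit dt z zt"
  shows "2 * dt * (norm (C (midpt z zt k)))\<^sup>2 + 2 * dt ^ 3 * (norm (A (z (Suc k))))\<^sup>2
      + dt ^ 6 * (norm (A (A (z (Suc k)))))\<^sup>2 = (norm (z k))\<^sup>2 - (norm (z (Suc k)))\<^sup>2"
  using viscous_orbit_energy[OF assms[unfolded damped_orbit_def], of k]
  unfolding N_inner power2_norm_eq_inner by linarith

lemma damped_energy_window:
  assumes "damped_orbit dt z zt"
  shows "(\<Sum>k<K. 2 * dt * (norm (C (midpt z zt k)))\<^sup>2 + 2 * dt ^ 3 * (norm (A (z (Suc k))))\<^sup>2
      + dt ^ 6 * (norm (A (A (z (Suc k)))))\<^sup>2) = (norm (z 0))\<^sup>2 - (norm (z K))\<^sup>2"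
  unfolding damped_energy[OF assms] by (rule sum_lessThan_telescope')

lemma damped_norm_decreasing:
  assumes z: "damped_orbit dt z zt" and dt: "dt > 0" and "i \<le> j"
  shows "norm (z j) \<le> norm (z i)"
proof -
  have "decseq (\<lambda>k. norm (z k))"
  proof (rule decseq_SucI)
    fix k
    have "0 \<le> 2 * dt * (norm (C (midpt z zt k)))\<^sup>2 + 2 * dt ^ 3 * (norm (A (z (Suc k))))\<^sup>2
      + dt ^ 6 * (norm (A (A (z (Suc k)))))\<^sup>2" using dt by (intro add_nonneg_nonneg) auto
    then show "norm (z (Suc k)) \<le> norm (z k)"
      unfolding damped_energy[OF z] by (simp add: power2_le_iff_abs_le)
  qed
  then show ?thesis using \<open>i \<le> j\<close> by (simp add: decseq_def)
qed

lemma midpt_norm_le: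
  "norm (midpt z zt k) \<le> (norm (z k) + norm (zt (Suc k))) / 2"
  using norm_triangle_ineq[of "z k" "zt (Suc k)"] by (simp add: midpt_def)

lemma damped_midpt_norm_le:
  assumes z: "damped_orbit dt z zt" and dt: "dt > 0"
  shows "norm (midpt z zt k) \<le> norm (z k)"
proof -
  have "(norm (zt (Suc k)))\<^sup>2 \<le> (norm (z k))\<^sup>2"
    using viscous_orbit_energy(2)[OF z[unfolded damped_orbit_def], of k] dt by (simp add: N_inner)
  then have "norm (zt (Suc k)) \<le> norm (z k)" by (rule power2_le_imp_le) simp
  then show ?thesis using midpt_norm_le[of z zt k] by simp
qed

section \<open>Observing the damped orbit through the free one\<close>

text \<open>
  The energy identity of a step reads \<open>a'\<^sup>2 - a\<^sup>2 \<le> \<gamma> (a + a')\<close> for the norms \<open>a\<close> before and \<open>a'\<close>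
  after the midpoint rule, hence the norm grows at most by \<open>\<gamma> = dt b \<parallel>C m\<parallel>\<close>, and the growth adds up
  over the steps.
\<close>
lemma forced_orbit_bound:
  assumes w: "viscous_orbit dt (\<lambda>k. N (m k)) w wt" and w0: "w 0 = 0"
    and dt: "dt > 0" and k: "k < K"
  shows "norm (w k) \<le> dt * b * (\<Sum>i<K. norm (C (m i)))"
    and "norm (wt (Suc k)) \<le> dt * b * (\<Sum>i<K. norm (C (m i)))"
proof -
  define c where "c i = norm (C (m i))" for i
  have half: "norm (wt (Suc k)) \<le> norm (w k) + dt * b * c k" for k
  proof -
    define p where "p = midpt w wt k"
    have "- (C (m k) \<bullet> C p) \<le> c k * (b * norm p)"
      using norm_cauchy_schwarz[of "- C (m k)" "C p"] mult_left_mono[OF C_bound[of p], of "c k"]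
      by (simp add: c_def)
    also have "\<dots> \<le> c k * (b * ((norm (w k) + norm (wt (Suc k))) / 2))"
      using midpt_norm_le b_nonneg by (intro mult_left_mono) (auto simp: p_def c_def)
    finally have "2 * dt * - (C (m k) \<bullet> C p) \<le> 2 * dt * (c k * (b * ((norm (w k) + norm (wt (Suc k))) / 2)))"
      using dt by (intro mult_left_mono) auto
    then have "(norm (wt (Suc k)) - norm (w k)) * (norm (wt (Suc k)) + norm (w k))
        \<le> (dt * b * c k) * (norm (wt (Suc k)) + norm (w k))"
      using viscous_orbit_energy(2)[OF w, of k]
      by (simp add: N_inner p_def power2_eq_square algebra_simps)
    moreover have "0 \<le> dt * b * c k" using dt b_nonneg by (simp add: c_def)
    ultimately show ?thesis
      using mult_right_le_imp_le[of "norm (wt (Suc k)) - norm (w k)" "norm (wt (Suc k)) + norm (w k)" "dt * b * c k"]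
      by (cases "norm (wt (Suc k)) + norm (w k) > 0") (auto simp: not_less add_nonneg_eq_0_iff add_nonneg_nonneg antisym_conv)
  qed
  have full: "norm (w (Suc k)) \<le> norm (wt (Suc k))" for k
  proof (rule power2_le_imp_le)
    have "0 \<le> 2 * dt ^ 3 * (norm (A (w (Suc k))))\<^sup>2" "0 \<le> dt ^ 6 * (norm (A (A (w (Suc k)))))\<^sup>2"
      using dt by simp_all
    then show "(norm (w (Suc k)))\<^sup>2 \<le> (norm (wt (Suc k)))\<^sup>2"
      using viscous_orbit_energy(1)[OF w, of k] by linarith
  qed simp
  have wk: "norm (w k) \<le> dt * b * (\<Sum>i<k. c i)" for k
  proof (induction k)
    case (Suc k)
    then show ?case using half[of k] full[of k] by (simp add: algebra_simps)
  qed (simp add: w0)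
  have mono: "dt * b * (\<Sum>i<j. c i) \<le> dt * b * (\<Sum>i<K. c i)" if "j \<le> K" for j
    using dt b_nonneg that by (intro mult_left_mono sum_mono2) (auto simp: c_def)
  show "norm (w k) \<le> dt * b * (\<Sum>i<K. norm (C (m i)))"
    using wk[of k] mono[of k] k by (simp add: c_def)
  show "norm (wt (Suc k)) \<le> dt * b * (\<Sum>i<K. norm (C (m i)))"
    using wk[of k] half[of k] mono[of "Suc k"] k by (simp add: c_def algebra_simps)
qed

text \<open>
  The right-hand side of the observability inequality for the first \<open>K\<close> steps.
\<close>
definition observation :: "real \<Rightarrow> (nat \<Rightarrow> 'h) \<Rightarrow> (nat \<Rightarrow> 'h) \<Rightarrow> nat \<Rightarrow> real" where
  "observation dt u ut K = dt * (\<Sum>k<K. (norm (C (midpt u ut k)))\<^sup>2)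
     + dt * (\<Sum>k<K. dt\<^sup>2 * (norm (A (u (Suc k))))\<^sup>2)
     + dt * (\<Sum>k<K. dt ^ 5 * (norm (A (A (u (Suc k)))))\<^sup>2)"

lemma observation_alt:
  "observation dt u ut K = (\<Sum>k<K. dt * (norm (C (midpt u ut k)))\<^sup>2 + dt ^ 3 * (norm (A (u (Suc k))))\<^sup>2
     + dt ^ 6 * (norm (A (A (u (Suc k)))))\<^sup>2)"
  unfolding observation_def sum_distrib_left sum.distrib[symmetric]
  by (intro sum.cong) (auto simp: eval_nat_numeral)

text \<open>
  Apply Cauchy--Schwarz to the sum in \<open>forced_orbit_bound\<close> for the first part of the observation. The
  viscous parts telescope in the energy identity, up to the work done by the source.
\<close>
lemma forced_orbit_observation:
  assumes w: "viscous_orbit dt (\<lambda>k. N (m k)) w wt" and w0: "w 0 = 0"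
    and dt: "dt > 0" and S: "real K * dt \<le> S"
  shows "observation dt w wt K \<le> (1 + 2 * S\<^sup>2 * b ^ 4) * (dt * (\<Sum>k<K. (norm (C (m k)))\<^sup>2))"
proof -
  define c where "c i = norm (C (m i))" for i
  define s where "s = dt * (\<Sum>k<K. (c k)\<^sup>2)"
  define \<rho> where "\<rho> = dt * b * (\<Sum>i<K. c i)"
  define q where "q k = (norm (C (midpt w wt k)))\<^sup>2" for k
  have S0: "0 \<le> S" using S dt by (meson less_imp_le mult_nonneg_nonneg of_nat_0_le_iff order_trans)
  have s0: "0 \<le> s" using dt by (simp add: s_def sum_nonneg)
  have \<rho>0: "0 \<le> \<rho>" using dt b_nonneg by (simp add: \<rho>_def c_def sum_nonneg)
  have "(\<Sum>i<K. c i)\<^sup>2 \<le> real K * (\<Sum>k<K. (c k)\<^sup>2)"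
    using sum_squared_le_sum_of_squares[of c "{..<K}"] by (simp add: mult.commute)
  then have "\<rho>\<^sup>2 \<le> (dt * b)\<^sup>2 * (real K * (\<Sum>k<K. (c k)\<^sup>2))"
    unfolding \<rho>_def power_mult_distrib[of "dt * b"] by (intro mult_left_mono) auto
  also have "\<dots> = b\<^sup>2 * s * (real K * dt)" by (simp add: s_def power2_eq_square)
  also have "\<dots> \<le> b\<^sup>2 * s * S" using S s0 by (intro mult_left_mono) auto
  finally have \<rho>2: "\<rho>\<^sup>2 \<le> b\<^sup>2 * s * S" .
  have "q k \<le> b\<^sup>2 * \<rho>\<^sup>2" if "k < K" for k
  proof -
    have "norm (midpt w wt k) \<le> \<rho>"
      using forced_orbit_bound[OF w w0 dt that] midpt_norm_le[of w wt k] by (simp add: \<rho>_def c_def)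
    then have "norm (C (midpt w wt k)) \<le> b * \<rho>"
      using C_bound[of "midpt w wt k"] b_nonneg by (meson mult_left_mono order_trans)
    from power_mono[OF this, of 2] show ?thesis by (simp add: q_def power_mult_distrib)
  qed
  then have "(\<Sum>k<K. q k) \<le> (\<Sum>k<K. b\<^sup>2 * \<rho>\<^sup>2)" by (intro sum_mono) auto
  then have "dt * (\<Sum>k<K. q k) \<le> dt * (real K * (b\<^sup>2 * \<rho>\<^sup>2))" using dt by simp
  also have "\<dots> = (b\<^sup>2 * \<rho>\<^sup>2) * (real K * dt)" by simp
  also have "\<dots> \<le> (b\<^sup>2 * (b\<^sup>2 * s * S)) * S"
    using S S0 \<rho>2 s0 dt by (intro mult_mono) auto
  finally have qs: "dt * (\<Sum>k<K. q k) \<le> S\<^sup>2 * b ^ 4 * s"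
    by (simp add: power2_eq_square power4_eq_xxxx algebra_simps)
  have each: "2 * dt ^ 3 * (norm (A (w (Suc k))))\<^sup>2 + dt ^ 6 * (norm (A (A (w (Suc k)))))\<^sup>2
      \<le> (norm (w k))\<^sup>2 - (norm (w (Suc k)))\<^sup>2 + dt * ((c k)\<^sup>2 + q k)" for k
  proof -
    define x y where "x = C (m k)" and "y = C (midpt w wt k)"
    have "0 \<le> (x + y) \<bullet> (x + y)" by simp
    \<comment> \<open>Young's inequality bounds the work of the source.\<close>
    then have "- 2 * (x \<bullet> y) \<le> (c k)\<^sup>2 + q k"
      unfolding c_def q_def x_def[symmetric] y_def[symmetric] power2_norm_eq_inner
      by (simp add: inner_add_left inner_add_right inner_commute)
    then have "dt * (- 2 * (x \<bullet> y)) \<le> dt * ((c k)\<^sup>2 + q k)" using dt by (intro mult_left_mono) auto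
    then show ?thesis
      using viscous_orbit_energy[OF w, of k] by (simp add: N_inner x_def y_def)
  qed
  have "observation dt w wt K \<le> (\<Sum>k<K. dt * q k + ((norm (w k))\<^sup>2 - (norm (w (Suc k)))\<^sup>2 + dt * ((c k)\<^sup>2 + q k)))"
    unfolding observation_alt
  proof (rule sum_mono)
    fix k
    have "0 \<le> dt ^ 3 * (norm (A (w (Suc k))))\<^sup>2" using dt by simp
    then show "dt * (norm (C (midpt w wt k)))\<^sup>2 + dt ^ 3 * (norm (A (w (Suc k))))\<^sup>2
     + dt ^ 6 * (norm (A (A (w (Suc k)))))\<^sup>2 \<le> dt * q k + ((norm (w k))\<^sup>2 - (norm (w (Suc k)))\<^sup>2 + dt * ((c k)\<^sup>2 + q k))"
      using each[of k] unfolding q_def by linarith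
  qed
  also have "\<dots> = 2 * (dt * (\<Sum>k<K. q k)) + s + (\<Sum>k<K. (norm (w k))\<^sup>2 - (norm (w (Suc k)))\<^sup>2)"
    by (simp add: s_def sum.distrib sum_subtractf distrib_left sum_distrib_left[symmetric])
  also have "(\<Sum>k<K. (norm (w k))\<^sup>2 - (norm (w (Suc k)))\<^sup>2) = (norm (w 0))\<^sup>2 - (norm (w K))\<^sup>2"
    by (rule sum_lessThan_telescope')
  finally have "observation dt w wt K \<le> 2 * (dt * (\<Sum>k<K. q k)) + s"
    using zero_le_power2[of "norm (w K)"] unfolding w0 norm_zero zero_power2 by linarith
  then have "observation dt w wt K \<le> 2 * (S\<^sup>2 * b ^ 4 * s) + s" using qs by simp
  then show ?thesis by (simp add: s_def c_def algebra_simps)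
qed

lemma observation_diff_le:
  assumes "\<And>k. u (Suc k) \<in> dom" "\<And>k. A (u (Suc k)) \<in> dom" 
    and "\<And>k. w (Suc k) \<in> dom" "\<And>k. A (w (Suc k)) \<in> dom" and dt: "dt > 0"
  shows "observation dt (\<lambda>k. u k - w k) (\<lambda>k. ut k - wt k) K
    \<le> 2 * observation dt u ut K + 2 * observation dt w wt K"
proof -
  have sq: "(norm (x - y))\<^sup>2 \<le> 2 * (norm x)\<^sup>2 + 2 * (norm y)\<^sup>2" for x y :: "'z::real_inner"
  proof -
    have "0 \<le> (x + y) \<bullet> (x + y)" by simp
    then show ?thesis unfolding power2_norm_eq_inner
      by (simp add: inner_add_left inner_add_right inner_diff_left inner_diff_right inner_commute)
  qed
  have mid: "C (midpt (\<lambda>k. u k - w k) (\<lambda>k. ut k - wt k) k) = C (midpt u ut k) - C (midpt w wt k)" for k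
    unfolding linear_diff[OF C_linear, symmetric] midpt_def by (simp add: algebra_simps)
  have A1: "A (u (Suc k) - w (Suc k)) = A (u (Suc k)) - A (w (Suc k))" for k
    using assms by (simp add: A_diff)
  have A2: "A (A (u (Suc k)) - A (w (Suc k))) = A (A (u (Suc k))) - A (A (w (Suc k)))" for k
    using assms by (simp add: A_diff)
  show ?thesis unfolding observation_alt sum_distrib_left sum.distrib[symmetric]
  proof (rule sum_mono)
    fix k
    define a1 a2 a3 where "a1 = dt" "a2 = dt^3" "a3 = dt ^ 6"
    have "a1 * (norm (C (midpt u ut k) - C (midpt w wt k)))\<^sup>2 \<le> a1 * (2 * (norm (C (midpt u ut k)))\<^sup>2 + 2 * (norm (C (midpt w wt k)))\<^sup>2)"
     "a2 * (norm (A (u (Suc k)) - A (w (Suc k))))\<^sup>2 \<le> a2 * (2 * (norm (A (u (Suc k))))\<^sup>2 + 2 * (norm (A (w (Suc k))))\<^sup>2)"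
     "a3 * (norm (A (A (u (Suc k))) - A (A (w (Suc k)))))\<^sup>2 \<le> a3 * (2 * (norm (A (A (u (Suc k)))))\<^sup>2 + 2 * (norm (A (A (w (Suc k)))))\<^sup>2)"
      using dt by (auto intro!: mult_left_mono sq simp: a1_a2_a3_def)
    then show "dt * (norm (C (midpt (\<lambda>k. u k - w k) (\<lambda>k. ut k - wt k) k)))\<^sup>2
         + dt ^ 3 * (norm (A (u (Suc k) - w (Suc k))))\<^sup>2 + dt ^ 6 * (norm (A (A (u (Suc k) - w (Suc k)))))\<^sup>2
      \<le> 2 * (dt * (norm (C (midpt u ut k)))\<^sup>2 + dt ^ 3 * (norm (A (u (Suc k))))\<^sup>2 + dt ^ 6 * (norm (A (A (u (Suc k)))))\<^sup>2)
        + 2 * (dt * (norm (C (midpt w wt k)))\<^sup>2 + dt ^ 3 * (norm (A (w (Suc k))))\<^sup>2 + dt ^ 6 * (norm (A (A (w (Suc k)))))\<^sup>2)"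
      unfolding mid A1 A2 a1_a2_a3_def by (simp add: algebra_simps)
  qed
qed

text \<open>
  The free orbit is the damped orbit minus an orbit that starts at 0 and is forced by the damping of
  the former. Both are observed by at most a constant times the dissipated energy.
\<close>
lemma free_observation_le_dissipation:
  assumes z: "damped_orbit dt z zt" and u: "viscous_orbit dt (\<lambda>k. 0) u ut" and u0: "u 0 = z 0"
    and dt: "dt > 0" and S: "real K * dt \<le> S"
  shows "observation dt u ut K \<le> (3 + 2 * S\<^sup>2 * b ^ 4) * ((norm (z 0))\<^sup>2 - (norm (z K))\<^sup>2)"
proof -
  define w where "w k = z k - u k" for k
  define wt where "wt k = zt k - ut k" for k
  define \<Delta> where "\<Delta> = (norm (z 0))\<^sup>2 - (norm (z K))\<^sup>2"
  have zdom: "\<And>k. z (Suc k) \<in> dom" "\<And>k. A (z (Suc k)) \<in> dom"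
    using damped_orbit_step[OF z] by (auto simp: viscous_step_def)
  have w: "viscous_orbit dt (\<lambda>k. N (midpt z zt k)) w wt"
    unfolding viscous_orbit_def w_def wt_def
  proof
    fix k
    show "viscous_step dt (N (midpt z zt k)) (z k - u k) (zt (Suc k) - ut (Suc k)) (z (Suc k) - u (Suc k))"
      using viscous_step_diff[OF damped_orbit_step[OF z, of k]] u
      unfolding viscous_orbit_def by (metis diff_zero)
  qed
  then have wdom: "\<And>k. w (Suc k) \<in> dom" "\<And>k. A (w (Suc k)) \<in> dom"
    by (auto simp: viscous_orbit_def viscous_step_def)
  define s where "s = dt * (\<Sum>k<K. (norm (C (midpt z zt k)))\<^sup>2)"
  have win: "2 * s + (\<Sum>k<K. 2 * dt ^ 3 * (norm (A (z (Suc k))))\<^sup>2)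
      + (\<Sum>k<K. dt ^ 6 * (norm (A (A (z (Suc k)))))\<^sup>2) = \<Delta>"
    using damped_energy_window[OF z, of K]
    by (simp add: \<Delta>_def s_def sum.distrib sum_distrib_left mult.assoc)
  have nn: "0 \<le> (\<Sum>k<K. 2 * dt ^ 3 * (norm (A (z (Suc k))))\<^sup>2)"
    "0 \<le> (\<Sum>k<K. dt ^ 6 * (norm (A (A (z (Suc k)))))\<^sup>2)" "0 \<le> s"
    unfolding s_def using dt by (intro sum_nonneg mult_nonneg_nonneg; simp)+
  have s: "s \<le> \<Delta> / 2" using win nn by linarith
  have oz: "observation dt z zt K \<le> \<Delta>"
    unfolding \<Delta>_def damped_energy_window[OF z, of K, symmetric] observation_alt
    using dt by (intro sum_mono add_mono) auto
  have ow: "observation dt w wt K \<le> (1 + 2 * S\<^sup>2 * b ^ 4) * (\<Delta> / 2)"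
  proof -
    have "observation dt w wt K \<le> (1 + 2 * S\<^sup>2 * b ^ 4) * s"
      using forced_orbit_observation[OF w _ dt S] u0 by (simp add: w_def s_def)
    also have "\<dots> \<le> (1 + 2 * S\<^sup>2 * b ^ 4) * (\<Delta> / 2)"
      using s by (intro mult_left_mono) (auto intro!: add_nonneg_nonneg)
    finally show ?thesis .
  qed
  have "observation dt (\<lambda>k. z k - w k) (\<lambda>k. zt k - wt k) K \<le> 2 * observation dt z zt K + 2 * observation dt w wt K"
    by (rule observation_diff_le) (auto simp: zdom wdom dt)
  moreover have "(\<lambda>k. z k - w k) = u" "(\<lambda>k. zt k - wt k) = ut" by (auto simp: w_def wt_def)
  ultimately have "observation dt u ut K \<le> 2 * \<Delta> + 2 * ((1 + 2 * S\<^sup>2 * b ^ 4) * (\<Delta> / 2))"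
    using oz ow by simp
  also have "\<dots> = (3 + 2 * S\<^sup>2 * b ^ 4) * \<Delta>" by (simp add: algebra_simps)
  finally show ?thesis by (simp add: \<Delta>_def)
qed

section \<open>Regularity of damped orbits\<close>

lemma damped_difference_orbit:
  assumes z: "damped_orbit dt z zt"
  shows "damped_orbit dt (\<lambda>k. z (Suc k) - z k) (\<lambda>k. zt (Suc k) - zt k)"
  unfolding damped_orbit_def viscous_orbit_def
proof
  fix k
  have mid: "midpt (\<lambda>k. z (Suc k) - z k) (\<lambda>k. zt (Suc k) - zt k) k = midpt z zt (Suc k) - midpt z zt k"
    by (simp add: midpt_def algebra_simps)
  show "viscous_step dt (N (midpt (\<lambda>k. z (Suc k) - z k) (\<lambda>k. zt (Suc k) - zt k) k))
      (z (Suc k) - z k) (zt (Suc (Suc k)) - zt (Suc k)) (z (Suc (Suc k)) - z (Suc k))"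
    unfolding mid N_diff
    by (intro viscous_step_diff damped_orbit_step[OF z])
qed

definition first_step_const :: real where
  "first_step_const = (6 + b\<^sup>2) * (1 + b\<^sup>2 * \<kappa>)"

text \<open>
  Write \<open>\<delta> = (A - N) m\<close> for the velocity of the midpoint rule. It solves the resolvent equation of the
  dissipative operator \<open>A - N\<close> with right-hand side \<open>(A - N) w\<close>, which bounds it by the graph norm of
  \<open>w\<close>. The same equation bounds \<open>dt A \<delta>\<close>, hence \<open>A wt\<close>. Since \<open>A w'\<close> solves the viscous equation with
  right-hand side \<open>A wt\<close>, also \<open>dt\<^sup>2 A\<^sup>2 w'\<close> is bounded; this uses \<open>dt < 1\<close>.
\<close>
lemma first_difference_le:
  assumes step: "viscous_step dt (N ((w + wt) /\<^sub>R 2)) w wt w'" and w: "w \<in> dom"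
    and dt: "0 < dt" "dt < 1"
  shows "norm (w' - w) \<le> dt * (first_step_const * norm (A w))"
proof -
  define a where "a = (1 + b\<^sup>2 * \<kappa>) * norm (A w)"
  have a0: "0 \<le> a" using \<kappa>_pos by (simp add: a_def)
  define m where "m = (w + wt) /\<^sub>R 2"
  define \<delta> where "\<delta> = A m - N m"
  from step have m: "m \<in> dom" and wt: "wt - w = dt *\<^sub>R \<delta>" and w': "w' \<in> dom" "A w' \<in> dom"
    and visc: "w' - wt = dt ^ 3 *\<^sub>R A (A w')"
    by (auto simp: viscous_step_def m_def \<delta>_def)
  have "m - w = (1/2) *\<^sub>R (wt - w)" by (simp add: m_def algebra_simps flip: scaleR_left_distrib)
  then have mw: "m - w = (dt/2) *\<^sub>R \<delta>" by (simp add: wt)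
  then have "\<delta> = (2/dt) *\<^sub>R (m - w)" using dt by simp
  then have \<delta>: "\<delta> \<in> dom" using m w by (simp add: dom_scale dom_diff)
  have rhs: "norm (A w - N w) \<le> a"
  proof -
    have "norm (A w - N w) \<le> norm (A w) + norm (N w)" by (rule norm_triangle_ineq4)
    also have "norm (N w) \<le> b\<^sup>2 * (\<kappa> * norm (A w))"
      using N_bound[of w] coercive[OF w] by (meson mult_left_mono order_trans zero_le_power2)
    finally show ?thesis by (simp add: a_def algebra_simps)
  qed
  have eq: "\<delta> - (dt/2) *\<^sub>R (A \<delta> - N \<delta>) = A w - N w"
  proof -
    have "A m - A w = (dt/2) *\<^sub>R A \<delta>" using A_diff[OF m w] mw A_scale[OF \<delta>] by simp
    moreover have "N m - N w = (dt/2) *\<^sub>R N \<delta>" using N_diff[of m w] mw N_scale by simp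
    ultimately have "(dt/2) *\<^sub>R (A \<delta> - N \<delta>) = (A m - A w) - (N m - N w)"
      by (simp only: scaleR_diff_right)
    then show ?thesis by (simp only:) (simp add: \<delta>_def)
  qed
  have \<delta>a: "norm \<delta> \<le> a"
  proof (cases "\<delta> = 0")
    case False
    have "norm \<delta> * norm \<delta> \<le> norm \<delta> * norm \<delta> + (dt/2) * (C \<delta> \<bullet> C \<delta>)" using dt by simp
    also have "\<dots> = (A w - N w) \<bullet> \<delta>"
      using A_inner_self[OF \<delta>] unfolding eq[symmetric]
      by (simp add: inner_diff_left N_inner norm_eq_sqrt_inner)
    also have "\<dots> \<le> norm (A w - N w) * norm \<delta>" by (rule norm_cauchy_schwarz)
    also have "\<dots> \<le> a * norm \<delta>" using rhs by (intro mult_right_mono) auto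
    finally show ?thesis using False by simp
  qed (simp add: a0)
  have "wt = w + dt *\<^sub>R \<delta>" using wt by (simp add: algebra_simps)
  then have wtd: "wt \<in> dom" and Awt: "A wt = A w + dt *\<^sub>R A \<delta>"
    using w \<delta> by (simp_all add: dom_add dom_scale A_add A_scale)
  have "dt *\<^sub>R A \<delta> = 2 *\<^sub>R \<delta> - 2 *\<^sub>R (A w - N w) + dt *\<^sub>R N \<delta>"
    unfolding eq[symmetric] by (simp add: algebra_simps)
  then have "norm (dt *\<^sub>R A \<delta>) \<le> norm (2 *\<^sub>R \<delta>) + norm (2 *\<^sub>R (A w - N w)) + norm (dt *\<^sub>R N \<delta>)"
    using norm_triangle_ineq[of "2 *\<^sub>R \<delta> - 2 *\<^sub>R (A w - N w)" "dt *\<^sub>R N \<delta>"]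
      norm_triangle_ineq4[of "2 *\<^sub>R \<delta>" "2 *\<^sub>R (A w - N w)"] by simp
  moreover have "norm (dt *\<^sub>R N \<delta>) \<le> 1 * (b\<^sup>2 * a)"
  proof -
    have "norm (N \<delta>) \<le> b\<^sup>2 * a" by (rule order_trans[OF N_bound mult_left_mono[OF \<delta>a]]) simp
    then have "dt * norm (N \<delta>) \<le> 1 * (b\<^sup>2 * a)" using dt by (intro mult_mono) auto
    then show ?thesis using dt by simp
  qed
  moreover have "norm (2 *\<^sub>R \<delta>) + norm (2 *\<^sub>R (A w - N w)) \<le> 4 * a" using \<delta>a rhs by simp
  ultimately have "norm (dt *\<^sub>R A \<delta>) \<le> (4 + b\<^sup>2) * a" unfolding distrib_right by linarith
  moreover have "norm (A w) \<le> a" using \<kappa>_pos by (simp add: a_def algebra_simps)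
  ultimately have Awt_le: "norm (A wt) \<le> (5 + b\<^sup>2) * a"
    unfolding Awt using norm_triangle_ineq[of "A w" "dt *\<^sub>R A \<delta>"] by (simp add: algebra_simps)
  have visc': "wt = w' - dt ^ 3 *\<^sub>R A (A w')" using visc by (simp add: algebra_simps)
  have AA: "A (A w') = (1 / dt ^ 3) *\<^sub>R (w' - wt)" using dt by (simp add: visc)
  have AAd: "A (A w') \<in> dom" unfolding AA using w' wtd by (simp add: dom_scale dom_diff)
  have "A wt = A w' - dt ^ 3 *\<^sub>R A (A (A w'))"
    unfolding visc' using w' AAd by (simp add: A_diff A_scale dom_scale)
  then have "(norm (A wt))\<^sup>2 = (norm (A w'))\<^sup>2 + 2 * dt ^ 3 * (norm (A (A w')))\<^sup>2
     + (dt ^ 3)\<^sup>2 * (norm (A (A (A w'))))\<^sup>2"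
    using viscosity_norm[OF w'(2) AAd, of "dt ^ 3"] by simp
  moreover have "dt * (dt ^ 3 * (norm (A (A w')))\<^sup>2) \<le> 1 * (dt ^ 3 * (norm (A (A w')))\<^sup>2)"
    using dt by (intro mult_right_mono) auto
  moreover have "0 \<le> dt ^ 3 * (norm (A (A w')))\<^sup>2" "0 \<le> (dt ^ 3)\<^sup>2 * (norm (A (A (A w'))))\<^sup>2"
    "0 \<le> (norm (A w'))\<^sup>2" using dt by auto
  ultimately have "dt * (dt ^ 3 * (norm (A (A w')))\<^sup>2) \<le> (norm (A wt))\<^sup>2" by linarith
  moreover have "dt * (dt ^ 3 * (norm (A (A w')))\<^sup>2) = (norm (dt\<^sup>2 *\<^sub>R A (A w')))\<^sup>2"
    by (simp add: power_mult_distrib eval_nat_numeral)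
  ultimately have vis_le: "norm (dt\<^sup>2 *\<^sub>R A (A w')) \<le> norm (A wt)"
    by (simp add: power2_le_iff_abs_le)
  have "w' - w = (wt - w) + (w' - wt)" by simp
  then have "w' - w = dt *\<^sub>R (\<delta> + dt\<^sup>2 *\<^sub>R A (A w'))"
    unfolding wt visc by (simp add: scaleR_add_right eval_nat_numeral)
  then have "norm (w' - w) = dt * norm (\<delta> + dt\<^sup>2 *\<^sub>R A (A w'))" using dt by simp
  also have "\<dots> \<le> dt * (a + (5 + b\<^sup>2) * a)"
    using dt norm_triangle_ineq[of \<delta> "dt\<^sup>2 *\<^sub>R A (A w')"] \<delta>a vis_le Awt_le
    by (intro mult_left_mono) auto
  also have "\<dots> = dt * (first_step_const * norm (A w))"
    by (simp add: first_step_const_def a_def algebra_simps)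
  finally show ?thesis .
qed

text \<open>
  The differences of consecutive values form a damped orbit, so their norms do not increase.
\<close>
lemma damped_difference_le:
  assumes z: "damped_orbit dt z zt" and z0: "z 0 \<in> dom" and dt: "0 < dt" "dt < 1"
  shows "norm (z (Suc k) - z k) \<le> dt * (first_step_const * norm (A (z 0)))"
proof -
  have "norm (z (Suc k) - z k) \<le> norm (z (Suc 0) - z 0)"
    using damped_norm_decreasing[OF damped_difference_orbit[OF z] dt(1), of 0 k] by simp
  also have "\<dots> \<le> dt * (first_step_const * norm (A (z 0)))"
    using first_difference_le[OF damped_orbit_step[OF z, of 0, unfolded midpt_def] z0 dt] .
  finally show ?thesis .
qed

text \<open>
  Let \<open>J = (I - dt A)\<^sup>-\<^sup>1\<close> and \<open>G = (w' - w) / dt\<close>. The two halves of the step add up to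
  \<open>A m + dt\<^sup>2 A\<^sup>2 w' = G + f\<close>. Expressing \<open>m\<close> by \<open>w'\<close> and \<open>G\<close> and applying \<open>J\<close>, the vector
  \<open>v = A J w'\<close> satisfies
  \<open>v - (dt\<^sup>3 / 2) A\<^sup>2 v + dt\<^sup>2 A v = J (G + f) + (dt / 2) A J G\<close>.
  The right-hand side is bounded because \<open>J\<close> and \<open>dt A J\<close> are contractions, and the left-hand side is
  coercive when tested with \<open>v\<close>. Without \<open>J\<close> the term \<open>(dt / 2) A G\<close> would be out of control.
\<close>
lemma filtered_graph_bound:
  assumes step: "viscous_step dt f w wt w'" and dt: "dt > 0"
    and y: "y \<in> dom" "y - dt *\<^sub>R A y = w'"
    and G: "norm (w' - w) \<le> dt * g" and f: "norm f \<le> h"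
  shows "norm (A y) \<le> 2 * g + h"
proof -
  define G where "G = (1/dt) *\<^sub>R (w' - w)"
  have Gg: "norm G \<le> g" using G dt unfolding G_def norm_scaleR by (simp add: field_simps)
  define m where "m = (w + wt) /\<^sub>R 2"
  define v where "v = A y"
  from step have m: "m \<in> dom" and wt: "wt - w = dt *\<^sub>R (A m - f)" and w': "w' \<in> dom" "A w' \<in> dom"
    and visc: "w' - wt = dt ^ 3 *\<^sub>R A (A w')"
    by (auto simp: viscous_step_def m_def)
  have "w' - w = (wt - w) + (w' - wt)" by simp
  then have "w' - w = dt *\<^sub>R (A m - f + dt\<^sup>2 *\<^sub>R A (A w'))"
    unfolding wt visc by (simp add: scaleR_add_right eval_nat_numeral)
  then have GF: "A m + dt\<^sup>2 *\<^sub>R A (A w') = G + f" using dt by (simp add: G_def)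
  have wG: "w = w' - dt *\<^sub>R G" using dt by (simp add: G_def)
  have wtv: "wt = w' - dt ^ 3 *\<^sub>R A (A w')" using visc by (simp add: algebra_simps)
  have mm: "m = w' - (dt ^ 3 / 2) *\<^sub>R A (A w') - (dt/2) *\<^sub>R G"
  proof -
    have "2 *\<^sub>R m = w + wt" by (simp add: m_def)
    also have "\<dots> = (w' - dt *\<^sub>R G) + (w' - dt ^ 3 *\<^sub>R A (A w'))"
      using wG wtv by (rule arg_cong2[where f = "(+)"])
    also have "\<dots> = 2 *\<^sub>R (w' - (dt ^ 3 / 2) *\<^sub>R A (A w') - (dt/2) *\<^sub>R G)"
      by (simp add: scaleR_diff_right scaleR_2)
    finally show ?thesis by (simp only: scaleR_cancel_left) simp
  qed
  \<comment> \<open>The resolvent commutes with \<open>A\<close> and gains one order of regularity.\<close>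
  have key: "A x \<in> dom \<and> A x - dt *\<^sub>R A (A x) = A (x - dt *\<^sub>R A x)"
    if "x \<in> dom" "x - dt *\<^sub>R A x \<in> dom" for x
  proof -
    have "A x = (1/dt) *\<^sub>R (x - (x - dt *\<^sub>R A x))" using dt by simp
    also have "\<dots> \<in> dom" by (intro dom_scale dom_diff[OF that])
    finally have "A x \<in> dom" .
    then show ?thesis using that by (simp add: A_diff A_scale dom_scale)
  qed
  have v: "v \<in> dom" "v - dt *\<^sub>R A v = A w'"
    using key[OF y(1)] y(2) w'(1) by (simp_all add: v_def)
  have Av: "A v \<in> dom" "A v - dt *\<^sub>R A (A v) = A (A w')"
    using key[OF v(1)] v(2) w'(2) by simp_all
  obtain q where q: "q \<in> dom" "q - dt *\<^sub>R A q = G" using resolvent[of dt G] dt by auto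
  \<comment> \<open>\<open>q = J G\<close>, \<open>p = J m\<close> and below \<open>e = J (G + f)\<close>.\<close>
  define p where "p = y - (dt ^ 3 / 2) *\<^sub>R A v - (dt/2) *\<^sub>R q"
  have p: "p \<in> dom" unfolding p_def by (intro dom_diff dom_scale y Av q)
  have Ap: "A p = v - (dt ^ 3 / 2) *\<^sub>R A (A v) - (dt/2) *\<^sub>R A q"
    unfolding p_def v_def using y Av q by (simp add: A_diff A_scale dom_diff dom_scale v_def)
  have pm: "p - dt *\<^sub>R A p = m"
  proof -
    have "p - dt *\<^sub>R A p = (y - dt *\<^sub>R v) - (dt ^ 3 / 2) *\<^sub>R (A v - dt *\<^sub>R A (A v)) - (dt/2) *\<^sub>R (q - dt *\<^sub>R A q)"
      unfolding Ap unfolding p_def by (simp add: scaleR_diff_right mult.commute)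
    also have "\<dots> = m" unfolding mm Av(2) q(2) using y(2) by (simp add: v_def)
    finally show ?thesis .
  qed
  have App: "A p \<in> dom" "A p - dt *\<^sub>R A (A p) = A m" using key[OF p] pm m by simp_all
  define e where "e = A p + dt\<^sup>2 *\<^sub>R A v"
  have e: "e \<in> dom" unfolding e_def by (intro dom_add dom_scale App Av)
  have "A e = A (A p) + dt\<^sup>2 *\<^sub>R A (A v)"
    unfolding e_def using App Av by (simp add: A_add A_scale dom_scale)
  then have "e - dt *\<^sub>R A e = (A p - dt *\<^sub>R A (A p)) + dt\<^sup>2 *\<^sub>R (A v - dt *\<^sub>R A (A v))"
    unfolding e_def by (simp add: algebra_simps)
  also have "\<dots> = G + f" using App(2) Av(2) GF by simp
  finally have "norm e \<le> norm (G + f)" using resolvent_norm_le(1)[OF e, of dt] by simp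
  then have e_le: "norm e \<le> g + h" using norm_triangle_ineq[of G f] Gg f by linarith
  have q_le: "norm ((dt/2) *\<^sub>R A q) \<le> g / 2"
    using resolvent_norm_le(2)[OF q(1), of dt] q(2) Gg dt by simp
  have veq: "v - (dt ^ 3 / 2) *\<^sub>R A (A v) + dt\<^sup>2 *\<^sub>R A v = e + (dt/2) *\<^sub>R A q"
    unfolding e_def Ap by (simp add: algebra_simps)
  show ?thesis
  proof (cases "v = 0")
    case True
    have "0 \<le> g" using Gg norm_ge_zero order_trans by blast
    moreover have "0 \<le> h" using f norm_ge_zero order_trans by blast
    ultimately show ?thesis using True by (simp add: v_def)
  next
    case False
    have "norm v * norm v \<le> norm v * norm v + (dt ^ 3 / 2) * (norm (A v))\<^sup>2" using dt by simp
    also have "\<dots> = (v - (dt ^ 3 / 2) *\<^sub>R A (A v) + dt\<^sup>2 *\<^sub>R A v) \<bullet> v"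
      using A_inner_self[OF v(1)] A_A_inner_self[OF v(1) Av(1)]
      by (simp add: inner_diff_left inner_add_left norm_eq_sqrt_inner)
    also have "\<dots> = (e + (dt/2) *\<^sub>R A q) \<bullet> v" by (simp only: veq)
    also have "\<dots> \<le> norm (e + (dt/2) *\<^sub>R A q) * norm v" by (rule norm_cauchy_schwarz)
    also have "\<dots> \<le> (g + h + g / 2) * norm v"
      using norm_triangle_ineq[of e "(dt/2) *\<^sub>R A q"] e_le q_le by (intro mult_right_mono) auto
    finally have "norm v \<le> g + h + g / 2" using False by simp
    moreover have "0 \<le> g" using Gg norm_ge_zero order_trans by blast
    ultimately show ?thesis by (simp add: v_def)
  qed
qed

definition filtered_const :: real where
  "filtered_const = 2 * first_step_const + b\<^sup>2 * \<kappa>"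

lemma damped_filtered_graph_bound:
  assumes z: "damped_orbit dt z zt" and z0: "z 0 \<in> dom" and dt: "0 < dt" "dt < 1"
    and y: "y \<in> dom" "y - dt *\<^sub>R A y = z (Suc k)"
  shows "norm (A y) \<le> filtered_const * norm (A (z 0))"
proof -
  have "norm (N (midpt z zt k)) \<le> b\<^sup>2 * (\<kappa> * norm (A (z 0)))"
  proof -
    have "norm (midpt z zt k) \<le> norm (z 0)"
      using damped_midpt_norm_le[OF z dt(1), of k] damped_norm_decreasing[OF z dt(1), of 0 k] by simp
    also have "\<dots> \<le> \<kappa> * norm (A (z 0))" by (rule coercive[OF z0])
    finally show ?thesis using N_bound[of "midpt z zt k"] by (meson mult_left_mono order_trans zero_le_power2)
  qed
  from filtered_graph_bound[OF damped_orbit_step[OF z] dt(1) y damped_difference_le[OF z z0 dt] this]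
  show ?thesis by (simp add: filtered_const_def algebra_simps)
qed

text \<open>
  Average the interpolation inequality over the \<open>K\<close> steps after \<open>j\<close>. The weak energy of each of them is
  controlled by the dissipation in the \<open>K\<close> steps that follow it, hence by the dissipation in \<open>2 K\<close> steps
  from \<open>j\<close>; the viscous terms sum up to at most the dissipation.
\<close>
lemma window_recursion:
  fixes W :: "'h \<Rightarrow> real"
  assumes interp: "\<And>y x. \<lbrakk>y \<in> dom; x \<in> dom; y - dt *\<^sub>R A y = x\<rbrakk> \<Longrightarrow>
      (norm x)\<^sup>2 \<le> 2 * \<eta> * (norm (A y))\<^sup>2 + \<eta>' * W x + dt\<^sup>2 * (norm (A x))\<^sup>2"
    and obs: "\<And>u ut. u 0 \<in> dom \<Longrightarrow> viscous_orbit dt (\<lambda>k. 0) u ut \<Longrightarrow> c * W (u 0) \<le> observation dt u ut K"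
    and c: "c > 0" and \<eta>: "\<eta> > 0" "\<eta>' \<ge> 0"
    and z: "damped_orbit dt z zt" and z0: "z 0 \<in> dom" and dt: "0 < dt" "dt < 1"
    and T: "0 < T" "T \<le> real K * dt" and S: "real K * dt \<le> S"
  shows "(norm (z (j + 2 * K)))\<^sup>2 \<le> 2 * \<eta> * (filtered_const\<^sup>2 * (norm (A (z 0)))\<^sup>2)
    + (\<eta>' * ((3 + 2 * S\<^sup>2 * b ^ 4) / c) + 1 / T) * ((norm (z j))\<^sup>2 - (norm (z (j + 2 * K)))\<^sup>2)"
proof -
  define \<Delta> where "\<Delta> = (norm (z j))\<^sup>2 - (norm (z (j + 2 * K)))\<^sup>2"
  define Co where "Co = 3 + 2 * S\<^sup>2 * b ^ 4"
  have Co: "Co \<ge> 0" by (simp add: Co_def)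
  have zdom: "z k \<in> dom" for k
    using damped_orbit_step[OF z] z0 by (cases k) (auto simp: viscous_step_def)
  have dec: "(norm (z j'))\<^sup>2 \<le> (norm (z i))\<^sup>2" if "i \<le> j'" for i j'
    using damped_norm_decreasing[OF z dt(1) that] by (intro power_mono) auto
  have W: "W (z i) \<le> Co / c * \<Delta>" if i: "j \<le> i" "i \<le> j + K" for i
  proof -
    obtain u ut where u: "u 0 = z i" "viscous_orbit dt (\<lambda>k. 0) u ut"
      using free_orbit_exists[OF dt(1)] by blast
    have "c * W (z i) \<le> observation dt u ut K" using obs[OF _ u(2)] u(1) zdom by simp
    also have "\<dots> \<le> Co * ((norm (z i))\<^sup>2 - (norm (z (i + K)))\<^sup>2)"
      using free_observation_le_dissipation[OF damped_orbit_shift[OF z, of i] u(2) _ dt(1) S] u(1)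
      by (simp add: Co_def)
    also have "\<dots> \<le> Co * \<Delta>"
    proof (rule mult_left_mono[OF _ Co])
      show "(norm (z i))\<^sup>2 - (norm (z (i + K)))\<^sup>2 \<le> \<Delta>"
        using dec[of j i] dec[of "i + K" "j + 2 * K"] i unfolding \<Delta>_def by linarith
    qed
    finally show ?thesis using c by (simp add: field_simps)
  qed
  define F where "F = filtered_const\<^sup>2 * (norm (A (z 0)))\<^sup>2"
  have each: "(norm (z (j + 2 * K)))\<^sup>2 \<le> 2 * \<eta> * F + \<eta>' * (Co / c * \<Delta>) + dt\<^sup>2 * (norm (A (z (j + Suc k))))\<^sup>2"
    if k: "k < K" for k
  proof -
    obtain y where y: "y \<in> dom" "y - dt *\<^sub>R A y = z (j + Suc k)"
      using resolvent[of dt] dt by auto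
    have "norm (A y) \<le> filtered_const * norm (A (z 0))"
      using damped_filtered_graph_bound[OF z z0 dt y(1)] y(2) by simp
    from power_mono[OF this, of 2] have yF: "(norm (A y))\<^sup>2 \<le> F" by (simp add: F_def power_mult_distrib)
    have "(norm (z (j + 2 * K)))\<^sup>2 \<le> (norm (z (j + Suc k)))\<^sup>2" using k by (intro dec) auto
    also have "\<dots> \<le> 2 * \<eta> * (norm (A y))\<^sup>2 + \<eta>' * W (z (j + Suc k)) + dt\<^sup>2 * (norm (A (z (j + Suc k))))\<^sup>2"
      by (rule interp[OF y(1) zdom y(2)])
    also have "\<dots> \<le> 2 * \<eta> * F + \<eta>' * (Co / c * \<Delta>) + dt\<^sup>2 * (norm (A (z (j + Suc k))))\<^sup>2"
      using \<eta> k by (intro add_mono mult_left_mono yF W) auto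
    finally show ?thesis .
  qed
  have diss: "(\<Sum>k<K. dt * (dt\<^sup>2 * (norm (A (z (j + Suc k))))\<^sup>2)) \<le> \<Delta>"
  proof -
    have "(\<Sum>k<K. dt * (dt\<^sup>2 * (norm (A (z (j + Suc k))))\<^sup>2))
        \<le> (norm (z j))\<^sup>2 - (norm (z (j + K)))\<^sup>2"
    proof -
      have "dt * (dt\<^sup>2 * (norm (A (z (j + Suc k))))\<^sup>2) \<le> (norm (z (j + k)))\<^sup>2 - (norm (z (j + Suc k)))\<^sup>2" for k
      proof -
        have "dt * (dt\<^sup>2 * (norm (A (z (j + Suc k))))\<^sup>2) = dt ^ 3 * (norm (A (z (j + Suc k))))\<^sup>2"
          by (simp add: eval_nat_numeral)
        moreover have "0 \<le> dt ^ 3 * (norm (A (z (j + Suc k))))\<^sup>2"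
          "0 \<le> dt * (norm (C (midpt z zt (j + k))))\<^sup>2" "0 \<le> dt ^ 6 * (norm (A (A (z (j + Suc k)))))\<^sup>2"
          using dt by auto
        ultimately show ?thesis using damped_energy[OF z, of "j + k"] unfolding add_Suc_right by linarith
      qed
      then have "(\<Sum>k<K. dt * (dt\<^sup>2 * (norm (A (z (j + Suc k))))\<^sup>2))
         \<le> (\<Sum>k<K. (norm (z (j + k)))\<^sup>2 - (norm (z (j + Suc k)))\<^sup>2)" by (intro sum_mono)
      also have "\<dots> = (norm (z (j + 0)))\<^sup>2 - (norm (z (j + K)))\<^sup>2" by (rule sum_lessThan_telescope')
      finally show ?thesis by simp
    qed
    also have "\<dots> \<le> \<Delta>" unfolding \<Delta>_def using dec[of "j + K" "j + 2 * K"] by simp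
    finally show ?thesis .
  qed
  have \<Delta>0: "0 \<le> \<Delta>" using dec[of j "j + 2 * K"] by (simp add: \<Delta>_def)
  define R where "R = (norm (z (j + 2 * K)))\<^sup>2 - (2 * \<eta> * F + \<eta>' * (Co / c * \<Delta>))"
  have "dt * R \<le> dt * (dt\<^sup>2 * (norm (A (z (j + Suc k))))\<^sup>2)" if "k < K" for k
    using each[OF that] dt unfolding R_def by (intro mult_left_mono) auto
  then have "(\<Sum>k<K. dt * R) \<le> (\<Sum>k<K. dt * (dt\<^sup>2 * (norm (A (z (j + Suc k))))\<^sup>2))"
    by (intro sum_mono) auto
  then have KR: "real K * dt * R \<le> \<Delta>" using diss by simp
  \<comment> \<open>\<open>R\<close> is the part of the energy left over by the averaged terms; if it is positive,
    \<open>T \<le> K dt\<close> turns the averaged bound into one on \<open>R\<close> itself.\<close>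
  have "R \<le> \<Delta> / T"
  proof (cases "R \<le> 0")
    case True
    then show ?thesis using \<Delta>0 T by (meson divide_nonneg_pos order_trans)
  next
    case False
    then have "T * R \<le> real K * dt * R" using T by (intro mult_right_mono) auto
    then have "T * R \<le> \<Delta>" using KR by linarith
    then show ?thesis using T by (simp add: field_simps)
  qed
  then show ?thesis unfolding R_def F_def[symmetric] \<Delta>_def[symmetric] Co_def[symmetric]
    by (simp add: algebra_simps)
qed

end

section \<open>Polynomial rates from scalar recursions\<close>

text \<open>
  The discrete analogue of \<open>y' \<le> - y\<^sup>1\<^sup>+\<^sup>\<alpha> / \<gamma>\<close>, for which \<open>y\<^sup>-\<^sup>\<alpha>\<close> grows at least linearly. If \<open>x \<le> 2 y\<close> the
  mean value theorem applies to \<open>s \<mapsto> s\<^sup>-\<^sup>\<alpha>\<close>; otherwise \<open>y\<^sup>-\<^sup>\<alpha>\<close> exceeds \<open>x\<^sup>-\<^sup>\<alpha>\<close> by a fixed factor.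
\<close>
lemma powr_reciprocal_gap:
  fixes x y X \<gamma> \<alpha> :: real
  assumes \<alpha>: "\<alpha> > 0" and y: "0 < y" "y \<le> x" "x \<le> X" and \<gamma>: "\<gamma> > 0" and d: "y powr (1 + \<alpha>) \<le> \<gamma> * (x - y)"
  shows "x powr (- \<alpha>) + min (\<alpha> * 2 powr (- \<alpha> - 1) / \<gamma>) ((1 - 2 powr (- \<alpha>)) * X powr (- \<alpha>)) \<le> y powr (- \<alpha>)"
proof -
  define s where "s = x / y"
  have s: "1 \<le> s" "x = s * y" using y by (auto simp: s_def)
  have s1: "s > 1"
  proof -
    have "0 < y powr (1 + \<alpha>)" using y by simp
    then have "0 < \<gamma> * (x - y)" using d by linarith
    then show ?thesis using \<gamma> y by (simp add: s_def zero_less_mult_iff)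
  qed
  have xs: "x powr (- \<alpha>) = s powr (- \<alpha>) * y powr (- \<alpha>)" using s y by (simp add: powr_mult)
  have gap: "y powr (- \<alpha>) - x powr (- \<alpha>) = (1 - s powr (- \<alpha>)) * y powr (- \<alpha>)" by (simp add: xs algebra_simps)
  show ?thesis
  proof (cases "s \<le> 2")
    case True
    have "\<exists>t>1. t < s \<and> s powr (- \<alpha>) - 1 powr (- \<alpha>) = (s - 1) * (- \<alpha> * t powr (- \<alpha> - 1))"
      by (rule MVT2[OF s1]) (auto intro!: derivative_eq_intros)
    then obtain t where t: "1 < t" "t < s" "1 - s powr (- \<alpha>) = (s - 1) * (\<alpha> * t powr (- \<alpha> - 1))"
      by auto
    have "2 powr (- \<alpha> - 1) \<le> t powr (- \<alpha> - 1)" using t True \<alpha> by (intro powr_mono2') auto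
    then have "(s - 1) * (\<alpha> * 2 powr (- \<alpha> - 1)) \<le> 1 - s powr (- \<alpha>)"
      unfolding t(3) using s1 \<alpha> by (intro mult_left_mono) auto
    then have "((s - 1) * (\<alpha> * 2 powr (- \<alpha> - 1))) * y powr (- \<alpha>) \<le> y powr (- \<alpha>) - x powr (- \<alpha>)"
      unfolding gap by (intro mult_right_mono) auto
    moreover have "1 / \<gamma> \<le> (s - 1) * y powr (- \<alpha>)"
    proof -
      have "y powr (1 + \<alpha>) = y * y powr \<alpha>" using y by (simp add: powr_add)
      with d have "y * y powr \<alpha> \<le> y * (\<gamma> * (s - 1))" by (simp add: s(2) algebra_simps)
      then have "y powr \<alpha> \<le> \<gamma> * (s - 1)" using y by simp
      then show ?thesis using y \<gamma> by (simp add: powr_minus field_simps)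
    qed
    from mult_left_mono[OF this, of "\<alpha> * 2 powr (- \<alpha> - 1)"]
    have "\<alpha> * 2 powr (- \<alpha> - 1) / \<gamma> \<le> ((s - 1) * (\<alpha> * 2 powr (- \<alpha> - 1))) * y powr (- \<alpha>)"
      using \<alpha> by (simp add: algebra_simps)
    ultimately show ?thesis by linarith
  next
    case False
    have a: "s powr (- \<alpha>) \<le> 2 powr (- \<alpha>)" using False \<alpha> by (intro powr_mono2') auto
    have b: "2 powr (- \<alpha>) \<le> 1" using powr_mono2'[of "-\<alpha>" 1 2] \<alpha> by simp
    have "X powr (- \<alpha>) \<le> y powr (- \<alpha>)" using y \<alpha> by (intro powr_mono2') auto
    then have "(1 - 2 powr (- \<alpha>)) * X powr (- \<alpha>) \<le> (1 - s powr (- \<alpha>)) * y powr (- \<alpha>)"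
      using a b by (intro mult_mono) auto
    then show ?thesis using gap by linarith
  qed
qed

lemma polynomial_decay_of_power_recursion:
  fixes \<alpha> \<gamma> X :: real
  assumes \<alpha>: "\<alpha> > 0" and \<gamma>: "\<gamma> > 0" and X: "X > 0"
  shows "\<exists>B>0. \<forall>x :: nat \<Rightarrow> real. (\<forall>n. 0 \<le> x n \<and> x (Suc n) \<le> x n \<and> x n \<le> X \<and>
      x (Suc n) powr (1 + \<alpha>) \<le> \<gamma> * (x n - x (Suc n))) \<longrightarrow> (\<forall>n. x n \<le> B * (1 + real n) powr (- 1 / \<alpha>))"
proof -
  define c0 where "c0 = min (\<alpha> * 2 powr (- \<alpha> - 1) / \<gamma>) ((1 - 2 powr (- \<alpha>)) * X powr (- \<alpha>))"
  define c1 where "c1 = min c0 (X powr (- \<alpha>))"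
  have "2 powr (- \<alpha>) < (1::real)" using \<alpha> by (simp add: powr_minus field_simps)
  then have c0: "c0 > 0" using \<alpha> \<gamma> X by (simp add: c0_def)
  then have c1: "c1 > 0" using X by (simp add: c1_def)
  show ?thesis
  proof (intro exI[of _ "c1 powr (- 1 / \<alpha>)"] conjI allI impI)
    show "0 < c1 powr (- 1 / \<alpha>)" using c1 by simp
    fix x :: "nat \<Rightarrow> real" and n
    assume *: "\<forall>n. 0 \<le> x n \<and> x (Suc n) \<le> x n \<and> x n \<le> X \<and>
      x (Suc n) powr (1 + \<alpha>) \<le> \<gamma> * (x n - x (Suc n))"
    have rec: "x n = 0 \<or> c1 * (1 + real n) \<le> x n powr (- \<alpha>)" for n
    proof (induction n)
      case 0
      show ?case
      proof (cases "x 0 = 0")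
        case False
        then have "X powr (- \<alpha>) \<le> x 0 powr (- \<alpha>)"
          using * \<alpha> by (intro powr_mono2') (auto simp: order_less_le)
        then show ?thesis by (simp add: c1_def min_le_iff_disj)
      qed simp
    next
      case (Suc n)
      show ?case
      proof (cases "x (Suc n) = 0")
        case False
        then have pos: "0 < x (Suc n)" using * by (simp add: order_less_le)
        then have "x n \<noteq> 0" using * by (metis not_le)
        then have "c1 * (1 + real n) \<le> x n powr (- \<alpha>)" using Suc by simp
        moreover have "x n powr (- \<alpha>) + c0 \<le> x (Suc n) powr (- \<alpha>)"
          unfolding c0_def using * by (intro powr_reciprocal_gap \<alpha> \<gamma> pos) auto
        moreover have "c1 \<le> c0" by (simp add: c1_def)
        ultimately show ?thesis by (simp add: algebra_simps)
      qed simp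
    qed
    show "x n \<le> c1 powr (- 1 / \<alpha>) * (1 + real n) powr (- 1 / \<alpha>)"
    proof (cases "x n = 0")
      case True
      then show ?thesis by simp
    next
      case False
      then have pos: "0 < x n" using * by (simp add: order_less_le)
      have "x n = (x n powr (- \<alpha>)) powr (- 1 / \<alpha>)" using pos \<alpha> by (simp add: powr_powr)
      also have "\<dots> \<le> (c1 * (1 + real n)) powr (- 1 / \<alpha>)"
        using rec[of n] False c1 \<alpha> by (intro powr_mono2') auto
      also have "\<dots> = c1 powr (- 1 / \<alpha>) * (1 + real n) powr (- 1 / \<alpha>)"
        using c1 by (simp add: powr_mult)
      finally show ?thesis .
    qed
  qed
qed

text \<open>
  The two terms containing \<open>\<eta>\<close> balance for \<open>\<eta> = d\<^bsup>1/(1+\<alpha>)\<^esup>\<close>, where \<open>d\<close> is the decrement; the term with \<open>R\<close>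
  is then of the same order because \<open>d \<le> X\<close>. The constant is uniform in the sequence.
\<close>
lemma polynomial_decay_of_interpolated_recursion:
  fixes \<alpha> P Q R X :: real
  assumes \<alpha>: "\<alpha> > 0" and P: "P \<ge> 0" and Q: "Q \<ge> 0" and R: "R \<ge> 0" and X: "X > 0"
  shows "\<exists>B>0. \<forall>x :: nat \<Rightarrow> real. (\<forall>n. 0 \<le> x n \<and> x (Suc n) \<le> x n \<and> x n \<le> X \<and>
      (\<forall>\<eta>>0. x (Suc n) \<le> P * \<eta> + (Q * \<eta> powr (- \<alpha>) + R) * (x n - x (Suc n))))
      \<longrightarrow> (\<forall>n. x n \<le> B * (1 + real n) powr (- 1 / \<alpha>))"
proof -
  define C where "C = P + Q + R * X powr (\<alpha> / (1 + \<alpha>)) + 1"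
  have C: "C > 0" using P Q R by (simp add: C_def add_nonneg_pos)
  obtain B where B: "B > 0" and Bx: "\<And>x :: nat \<Rightarrow> real. (\<forall>n. 0 \<le> x n \<and> x (Suc n) \<le> x n \<and> x n \<le> X \<and>
      x (Suc n) powr (1 + \<alpha>) \<le> C powr (1 + \<alpha>) * (x n - x (Suc n))) \<Longrightarrow> (\<forall>n. x n \<le> B * (1 + real n) powr (- 1 / \<alpha>))"
    using polynomial_decay_of_power_recursion[OF \<alpha> _ X, of "C powr (1 + \<alpha>)"] C by auto
  have "x (Suc n) powr (1 + \<alpha>) \<le> C powr (1 + \<alpha>) * (x n - x (Suc n))"
    if *: "\<forall>n. 0 \<le> x n \<and> x (Suc n) \<le> x n \<and> x n \<le> X \<and>
      (\<forall>\<eta>>0. x (Suc n) \<le> P * \<eta> + (Q * \<eta> powr (- \<alpha>) + R) * (x n - x (Suc n)))" for x :: "nat \<Rightarrow> real" and n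
  proof -
    define d where "d = x n - x (Suc n)"
    define y where "y = x (Suc n)"
    have d: "0 \<le> d" "d \<le> X" and y: "0 \<le> y" using *[rule_format, of n] *[rule_format, of "Suc n"] by (auto simp: d_def y_def)
    have rec: "y \<le> P * \<eta> + (Q * \<eta> powr (- \<alpha>) + R) * d" if "\<eta> > 0" for \<eta>
      using * that by (simp add: d_def y_def)
    show ?thesis
    proof (cases "d = 0")
      case True
      have "y \<le> 0"
      proof (rule ccontr)
        assume "\<not> y \<le> 0"
        then have "y \<le> P * (y / (2 * (P + 1)))" using rec[of "y / (2 * (P + 1))"] P True by simp
        also have "\<dots> = y * (P / (2 * (P + 1)))" by simp
        also have "\<dots> < y * 1" using \<open>\<not> y \<le> 0\<close> P by (intro mult_strict_left_mono) auto
        finally show False by simp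
      qed
      then show ?thesis using y True by (simp add: d_def y_def)
    next
      case False
      then have d0: "d > 0" using d by simp
      define \<eta> where "\<eta> = d powr (1 / (1 + \<alpha>))"
      have \<eta>: "\<eta> > 0" using d0 by (simp add: \<eta>_def)
      have "\<eta> powr (- \<alpha>) * d powr 1 = d powr (1 / (1 + \<alpha>) * (- \<alpha>) + 1)"
        by (simp only: \<eta>_def powr_powr powr_add)
      also have "1 / (1 + \<alpha>) * (- \<alpha>) + 1 = 1 / (1 + \<alpha>)" using \<alpha> by (simp add: field_simps)
      finally have 1: "\<eta> powr (- \<alpha>) * d = \<eta>" using d0 by (simp add: \<eta>_def)
      have "\<alpha> / (1 + \<alpha>) + 1 / (1 + \<alpha>) = 1" using \<alpha> by (simp add: field_simps)
      then have "d = d powr (\<alpha> / (1 + \<alpha>) + 1 / (1 + \<alpha>))" using d0 by simp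
      also have "\<dots> = d powr (\<alpha> / (1 + \<alpha>)) * \<eta>" using d0 by (simp add: \<eta>_def powr_add)
      also have "\<dots> \<le> X powr (\<alpha> / (1 + \<alpha>)) * \<eta>"
        using d d0 \<alpha> \<eta> by (intro mult_right_mono powr_mono2) auto
      finally have 2: "d \<le> X powr (\<alpha> / (1 + \<alpha>)) * \<eta>" .
      have "y \<le> P * \<eta> + Q * (\<eta> powr (- \<alpha>) * d) + R * d" using rec[OF \<eta>] by (simp add: algebra_simps)
      also have "\<dots> \<le> P * \<eta> + Q * \<eta> + R * (X powr (\<alpha> / (1 + \<alpha>)) * \<eta>)"
        unfolding 1 using 2 P Q R by (intro add_mono mult_left_mono) auto
      also have "\<dots> \<le> C * \<eta>" using \<eta> by (simp add: C_def algebra_simps)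
      finally have "y powr (1 + \<alpha>) \<le> (C * \<eta>) powr (1 + \<alpha>)" using y \<alpha> by (intro powr_mono2) auto
      also have "\<dots> = C powr (1 + \<alpha>) * d"
        using C \<eta> d0 \<alpha> by (simp add: powr_mult \<eta>_def powr_powr)
      finally show ?thesis by (simp add: y_def d_def)
    qed
  qed
  then show ?thesis using B Bx by (intro exI[of _ B]) blast
qed

section \<open>Uniform decay of damped orbits\<close>

context damped_skew_operator
begin

text \<open>
  The window has \<open>K\<close> steps with \<open>T \<le> K dt \<le> T + 1\<close>. The energies at the times \<open>2 K n\<close>, divided by the
  squared graph norm of the initial value, satisfy the recursion with constants that do not depend on
  \<open>dt\<close>, and \<open>1 + k dt\<close> is comparable to the number of windows elapsed.
\<close>
lemma uniform_polynomial_decay: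
  fixes W :: "'h \<Rightarrow> real"
  assumes interp: "\<And>dt \<eta> y x. \<lbrakk>0 < dt; 0 < \<eta>; y \<in> dom; x \<in> dom; y - dt *\<^sub>R A y = x\<rbrakk> \<Longrightarrow>
      (norm x)\<^sup>2 \<le> 2 * \<eta> * (norm (A y))\<^sup>2 + \<eta> powr (- \<alpha>) * W x + dt\<^sup>2 * (norm (A x))\<^sup>2"
    and obs: "\<And>dt u ut. \<lbrakk>0 < dt; u 0 \<in> dom; viscous_orbit dt (\<lambda>k. 0) u ut\<rbrakk> \<Longrightarrow>
      c * W (u 0) \<le> observation dt u ut (Suc (nat \<lfloor>T / dt\<rfloor>))"
    and c: "c > 0" and T: "T > 0" and \<alpha>: "\<alpha> > 0"
  shows "\<exists>M>0. \<forall>dt z zt k. 0 < dt \<longrightarrow> dt < 1 \<longrightarrow> damped_orbit dt z zt \<longrightarrow> z 0 \<in> dom \<longrightarrow>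
      (norm (z k))\<^sup>2 \<le> M / (1 + real k * dt) powr (1 / \<alpha>) * (norm (A (z 0)))\<^sup>2"
proof -
  define P where "P = 2 * filtered_const\<^sup>2"
  define Q where "Q = (3 + 2 * (T + 1)\<^sup>2 * b ^ 4) / c"
  obtain B where B: "B > 0" and decay: "\<And>x :: nat \<Rightarrow> real. (\<forall>n. 0 \<le> x n \<and> x (Suc n) \<le> x n \<and> x n \<le> \<kappa>\<^sup>2 \<and>
      (\<forall>\<eta>>0. x (Suc n) \<le> P * \<eta> + (Q * \<eta> powr (- \<alpha>) + 1 / T) * (x n - x (Suc n))))
      \<Longrightarrow> (\<forall>n. x n \<le> B * (1 + real n) powr (- 1 / \<alpha>))"
    using polynomial_decay_of_interpolated_recursion[OF \<alpha>, of P Q "1 / T" "\<kappa>\<^sup>2"] c T \<kappa>_pos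
    by (auto simp: P_def Q_def add_nonneg_nonneg)
  define M where "M = B * (2 * T + 3) powr (1 / \<alpha>)"
  have M: "M > 0" using B T by (simp add: M_def)
  have "(norm (z k))\<^sup>2 \<le> M / (1 + real k * dt) powr (1 / \<alpha>) * (norm (A (z 0)))\<^sup>2"
    if dt: "0 < dt" "dt < 1" and z: "damped_orbit dt z zt" and z0: "z 0 \<in> dom" for dt z zt k
  proof (cases "A (z 0) = 0")
    case True
    then have "z 0 = 0" using coercive[OF z0] by simp
    then have "z k = 0" using damped_norm_decreasing[OF z dt(1), of 0 k] by simp
    then show ?thesis using M by simp
  next
    case False
    define a where "a = (norm (A (z 0)))\<^sup>2"
    have a: "a > 0" using False by (simp add: a_def)
    define K where "K = Suc (nat \<lfloor>T / dt\<rfloor>)"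
    have rK: "real K = of_int \<lfloor>T / dt\<rfloor> + 1" using T dt by (simp add: K_def)
    have K1: "T \<le> real K * dt"
    proof -
      have "T / dt \<le> real K" unfolding rK by linarith
      then show ?thesis using dt by (simp add: field_simps)
    qed
    have K2: "real K * dt \<le> T + 1"
    proof -
      have "real K \<le> T / dt + 1" unfolding rK by linarith
      then have "real K * dt \<le> (T / dt + 1) * dt" using dt by (intro mult_right_mono) auto
      then show ?thesis using dt by (simp add: algebra_simps)
    qed
    define e where "e j = (norm (z j))\<^sup>2" for j
    have edec: "e j \<le> e i" if "i \<le> j" for i j
      unfolding e_def using damped_norm_decreasing[OF z dt(1) that] by (intro power_mono) auto
    have e0: "e 0 \<le> \<kappa>\<^sup>2 * a"
      using power_mono[OF coercive[OF z0], of 2] by (simp add: e_def a_def power_mult_distrib)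
    have rec: "e (j + 2 * K) \<le> 2 * \<eta> * (filtered_const\<^sup>2 * a) + (\<eta> powr (- \<alpha>) * Q + 1 / T) * (e j - e (j + 2 * K))"
      if \<eta>: "\<eta> > 0" for \<eta> j
      unfolding e_def a_def Q_def
      by (rule window_recursion[where W = W, OF interp[OF dt(1) \<eta>] obs[OF dt(1), folded K_def] c \<eta> _ z z0 dt T K1 K2])
        auto
    define x where "x n = e (2 * K * n) / a" for n
    have "\<forall>n. x n \<le> B * (1 + real n) powr (- 1 / \<alpha>)"
    proof (rule decay, intro allI conjI impI)
      fix n
      show "0 \<le> x n" using a by (simp add: x_def e_def)
      have "e (2 * K * Suc n) \<le> e (2 * K * n)" by (rule edec) simp
      then show "x (Suc n) \<le> x n" using a by (simp add: x_def divide_right_mono)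
      have "e (2 * K * n) \<le> e 0" by (rule edec) simp
      then show "x n \<le> \<kappa>\<^sup>2" using a e0 by (simp add: x_def field_simps)
      fix \<eta> :: real assume \<eta>: "\<eta> > 0"
      have idx: "2 * K * n + 2 * K = 2 * K * Suc n" by simp
      have "e (2 * K * Suc n) / a \<le> (2 * \<eta> * (filtered_const\<^sup>2 * a)
          + (\<eta> powr (- \<alpha>) * Q + 1 / T) * (e (2 * K * n) - e (2 * K * Suc n))) / a"
        using rec[OF \<eta>, of "2 * K * n"] a unfolding idx by (intro divide_right_mono) auto
      also have "\<dots> = P * \<eta> + (Q * \<eta> powr (- \<alpha>) + 1 / T) * (x n - x (Suc n))"
        using a unfolding x_def P_def add_divide_distrib diff_divide_distrib[symmetric] by (simp add: mult.commute)
      finally show "x (Suc n) \<le> P * \<eta> + (Q * \<eta> powr (- \<alpha>) + 1 / T) * (x n - x (Suc n))"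
        by (simp add: x_def)
    qed
    define n where "n = k div (2 * K)"
    have K0: "K > 0" by (simp add: K_def)
    have "e k \<le> e (2 * K * n)" by (rule edec) (simp add: n_def)
    also have "\<dots> = x n * a" using a by (simp add: x_def)
    also have "\<dots> \<le> (B * (1 + real n) powr (- 1 / \<alpha>)) * a"
      using \<open>\<forall>n. x n \<le> B * (1 + real n) powr (- 1 / \<alpha>)\<close> a by (intro mult_right_mono) auto
    also have "(1 + real n) powr (- 1 / \<alpha>) \<le> ((1 + real k * dt) / (2 * T + 3)) powr (- 1 / \<alpha>)"
    proof (rule powr_mono2')
      have "k \<le> 2 * K * (1 + n)"
        using mod_less_divisor[of "2 * K" k] K0 mult_div_mod_eq[of "2 * K" k]
        unfolding n_def distrib_left by linarith
      then have "real k \<le> real (2 * K * (1 + n))" by (simp only: of_nat_le_iff)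
      then have "real k \<le> 2 * real K * (1 + real n)" by (simp add: distrib_left)
      then have "real k * dt \<le> (2 * real K * (1 + real n)) * dt" using dt by (intro mult_right_mono) auto
      also have "\<dots> = 2 * (real K * dt) * (1 + real n)" by simp
      also have "\<dots> \<le> 2 * (T + 1) * (1 + real n)" using K2 by (intro mult_right_mono) auto
      finally have "1 + real k * dt \<le> (1 + real n) * (2 * T + 3)" using T by (simp add: algebra_simps)
      then show "(1 + real k * dt) / (2 * T + 3) \<le> 1 + real n" using T by (simp add: field_simps)
      show "0 < (1 + real k * dt) / (2 * T + 3)" using dt T by (simp add: add_pos_nonneg)
    qed (use \<alpha> in auto)
    also have "((1 + real k * dt) / (2 * T + 3)) powr (- 1 / \<alpha>)
        = (2 * T + 3) powr (1 / \<alpha>) / (1 + real k * dt) powr (1 / \<alpha>)"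
      using dt T by (simp add: powr_minus powr_divide field_simps add_pos_nonneg)
    finally show ?thesis using B a by (simp add: e_def M_def a_def)
  qed
  then show ?thesis using M by blast
qed

end

section \<open>The damped wave equation\<close>

context compact_positive_operator
begin

lemma wave_dom_eq: "wave_dom D \<A> = D \<times> half_dom"
  by (simp add: wave_dom_def power_dom_half)

text \<open>
  The change of unknowns \<open>(a, b) \<mapsto> (\<A>\<^sup>1\<^sup>/\<^sup>2 a, b)\<close> from \<open>H\<close> onto \<open>X \<times> X\<close>.
\<close>
definition energy_map :: "'x \<times> 'x \<Rightarrow> 'x \<times> 'x" where
  "energy_map w = (half_op (fst w), snd w)"

definition energy_map_inv :: "'x \<times> 'x \<Rightarrow> 'x \<times> 'x" where
  "energy_map_inv w = (inv_into half_dom half_op (fst w), snd w)"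

lemma H_norm_eq: "H_norm D \<A> w = norm (energy_map w)"
  by (simp add: H_norm_def energy_map_def norm_prod_def power_op_half)

lemma half_op_inv: "inv_into half_dom half_op p \<in> half_dom" "half_op (inv_into half_dom half_op p) = p"
proof -
  have "p \<in> half_op ` half_dom" using half_op_surj[of p] by auto
  then show "inv_into half_dom half_op p \<in> half_dom" "half_op (inv_into half_dom half_op p) = p"
    by (simp_all add: inv_into_into f_inv_into_f)
qed

lemma inv_half_op: "x \<in> half_dom \<Longrightarrow> inv_into half_dom half_op (half_op x) = x"
  by (rule half_op_inj) (simp_all add: half_op_inv)

lemma energy_map_inv_dom: "w \<in> half_dom \<times> half_dom \<Longrightarrow> energy_map_inv w \<in> wave_dom D \<A>"
  by (auto simp: energy_map_inv_def wave_dom_eq D_iff_half_dom half_op_inv)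

lemma energy_map_energy_map_inv: "energy_map (energy_map_inv w) = w"
  by (simp add: energy_map_def energy_map_inv_def half_op_inv)

lemma energy_map_dom: "w \<in> wave_dom D \<A> \<Longrightarrow> energy_map w \<in> half_dom \<times> half_dom"
  by (auto simp: energy_map_def wave_dom_eq D_iff_half_dom)

lemma energy_map_wave_op:
  "w \<in> wave_dom D \<A> \<Longrightarrow> energy_map (wave_op \<A> w) = wave_gen (energy_map w)"
  by (auto simp: energy_map_def wave_op_def wave_gen_def wave_dom_eq \<A>_eq_half_op_twice)

lemma wave_op_energy_map_inv:
  assumes "w \<in> half_dom \<times> half_dom"
  shows "wave_op \<A> (energy_map_inv w) = energy_map_inv (wave_gen w)"
proof -
  from assms have w: "fst w \<in> half_dom" "snd w \<in> half_dom" by auto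
  then have "inv_into half_dom half_op (fst w) \<in> D" by (simp add: D_iff_half_dom half_op_inv)
  then show ?thesis using w
    by (simp add: energy_map_inv_def wave_op_def wave_gen_def \<A>_eq_half_op_twice half_op_inv inv_half_op)
qed

lemma inv_half_op_linear:
  "inv_into half_dom half_op (p + q) = inv_into half_dom half_op p + inv_into half_dom half_op q"
  "inv_into half_dom half_op (r *\<^sub>R p) = r *\<^sub>R inv_into half_dom half_op p"
  by (rule half_op_inj; simp add: half_op_inv half_op_add half_op_scale)+

lemma energy_map_inv_linear: "linear energy_map_inv"
  by (rule linearI) (simp_all add: energy_map_inv_def inv_half_op_linear)

lemma energy_map_add:
  "fst v \<in> half_dom \<Longrightarrow> fst w \<in> half_dom \<Longrightarrow> energy_map (v + w) = energy_map v + energy_map w"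
  and energy_map_diff:
  "fst v \<in> half_dom \<Longrightarrow> fst w \<in> half_dom \<Longrightarrow> energy_map (v - w) = energy_map v - energy_map w"
  and energy_map_scale: "fst v \<in> half_dom \<Longrightarrow> energy_map (r *\<^sub>R v) = r *\<^sub>R energy_map v"
  by (simp_all add: energy_map_def half_op_add half_op_diff half_op_scale)

lemma wave_dom_subspace: "subspace (wave_dom D \<A>)"
  unfolding wave_dom_eq by (rule subspace_Times[OF D_subspace half_dom_subspace])

lemma wave_skew: "skew_operator (half_dom \<times> half_dom) wave_gen"
proof (rule skew_operator.intro)
  show "\<exists>x\<in>half_dom \<times> half_dom. x - \<epsilon> *\<^sub>R wave_gen x = f" if "\<epsilon> \<noteq> 0" for \<epsilon> f
    by (rule wave_gen_resolvent[OF that])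
qed (fact wave_gen_linear wave_gen_skew)+

lemma wave_damped:
  fixes \<B> :: "'y::{real_inner, complete_space} \<Rightarrow> 'x"
  assumes \<B>: "bounded_linear \<B>"
  shows "\<exists>b. damped_skew_operator (half_dom \<times> half_dom) wave_gen (ctrl_adj \<B>)
    (\<lambda>w. ctrl_op \<B> (ctrl_adj \<B> w)) b (1 / sqrt l0)"
proof -
  interpret adj: bounded_linear "adjoint \<B>" by (rule adjoint_bounded_linear[OF \<B>])
  obtain b where b: "b \<ge> 0" "\<And>x. norm (adjoint \<B> x) \<le> norm x * b"
    using adj.nonneg_bounded by blast
  have snd_le: "norm (snd w) \<le> norm w" for w :: "'x \<times> 'x" by (metis norm_snd_le prod.collapse)
  have "damped_skew_operator_axioms (half_dom \<times> half_dom) wave_gen (ctrl_adj \<B>)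
    (\<lambda>w. ctrl_op \<B> (ctrl_adj \<B> w)) b (1 / sqrt l0)"
  proof (rule damped_skew_operator_axioms.intro)
    show "linear (ctrl_adj \<B>)"
      by (rule linearI) (simp_all add: ctrl_adj_def adj.add adj.scaleR)
    show "norm (ctrl_adj \<B> w) \<le> b * norm w" for w
    proof -
      have "norm (ctrl_adj \<B> w) \<le> norm (snd w) * b" using b(2) by (simp add: ctrl_adj_def)
      also have "\<dots> \<le> norm w * b" using snd_le b(1) by (intro mult_right_mono)
      finally show ?thesis by (simp add: mult.commute)
    qed
    show "ctrl_op \<B> (ctrl_adj \<B> v) \<bullet> w = ctrl_adj \<B> v \<bullet> ctrl_adj \<B> w" for v w
      by (simp add: ctrl_op_def ctrl_adj_def inner_prod_def adjoint_inner[OF \<B>])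
    show "norm w \<le> 1 / sqrt l0 * norm (wave_gen w)" if "w \<in> half_dom \<times> half_dom" for w
    proof -
      have "sqrt (l0 * (norm w)\<^sup>2) \<le> sqrt ((norm (wave_gen w))\<^sup>2)"
        using wave_gen_coercive[OF that] by (rule real_sqrt_le_mono)
      then show ?thesis using l0_pos by (simp add: real_sqrt_mult field_simps)
    qed
  qed (use b l0_pos in auto)
  then show ?thesis by (intro exI[of _ b] damped_skew_operator.intro wave_skew)
qed

text \<open>
  Damped solutions are transported to \<open>X \<times> X\<close> by the change of unknowns, while free orbits in \<open>X \<times> X\<close>
  are transported back, in \<open>energy_map_inv_free_orbit\<close>: the observability hypothesis speaks about
  solutions in \<open>H\<close>.
\<close>
lemma energy_map_damped_step:
  fixes \<B> :: "'y::{real_inner, complete_space} \<Rightarrow> 'x"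
  assumes z: "viscous_midpoint_solution D \<A> (\<lambda>w. wave_op \<A> w - ctrl_op \<B> (ctrl_adj \<B> w)) dt z0 z zt"
    and z0: "z0 \<in> wave_dom D \<A>" and dt: "dt > 0"
  shows "skew_operator.viscous_step (half_dom \<times> half_dom) wave_gen dt
      (ctrl_op \<B> (ctrl_adj \<B> (midpt (energy_map \<circ> z) (energy_map \<circ> zt) k)))
      ((energy_map \<circ> z) k) ((energy_map \<circ> zt) (Suc k)) ((energy_map \<circ> z) (Suc k))"
proof -
  let ?G = "\<lambda>w. ctrl_op \<B> (ctrl_adj \<B> w)"
  define m where "m = midpt z zt k"
  from z have m: "m \<in> wave_dom D \<A>" and zt: "(zt (Suc k) - z k) /\<^sub>R dt = wave_op \<A> m - ?G m"
    and z': "z (Suc k) \<in> wave_dom2 D \<A>"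
    and visc: "(z (Suc k) - zt (Suc k)) /\<^sub>R dt = dt\<^sup>2 *\<^sub>R wave_op \<A> (wave_op \<A> (z (Suc k)))"
    by (auto simp: viscous_midpoint_solution_def m_def)
  have zk: "z k \<in> wave_dom D \<A>"
    using z z0 by (cases k) (auto simp: viscous_midpoint_solution_def wave_dom2_def)
  have "zt (Suc k) = 2 *\<^sub>R m - z k" by (simp add: m_def midpt_def)
  then have ztk: "zt (Suc k) \<in> wave_dom D \<A>"
    using m zk wave_dom_subspace by (simp add: subspace_diff subspace_scale)
  from z' have z1: "z (Suc k) \<in> wave_dom D \<A>" "wave_op \<A> (z (Suc k)) \<in> wave_dom D \<A>"
    by (auto simp: wave_dom2_def)
  have fd: "fst w \<in> half_dom" if "w \<in> wave_dom D \<A>" for w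
    using that by (auto simp: wave_dom_eq D_iff_half_dom)
  note fds = fd[OF zk] fd[OF ztk] fd[OF z1(1)] fd[OF m]
  have mid: "((energy_map \<circ> z) k + (energy_map \<circ> zt) (Suc k)) /\<^sub>R 2 = energy_map m"
  proof -
    have "fst (z k + zt (Suc k)) \<in> half_dom" using fds half_op_add(1) by simp
    then show ?thesis using fds by (simp add: m_def midpt_def energy_map_scale energy_map_add)
  qed
  have G: "energy_map (?G m) = ?G m" "?G (energy_map m) = ?G m" and Gfst: "fst (?G m) = 0"
    by (simp_all add: energy_map_def ctrl_op_def ctrl_adj_def half_op_zero)
  have wfst: "fst (wave_op \<A> w) \<in> half_dom" if "w \<in> wave_dom D \<A>" for w
    using that by (auto simp: wave_op_def wave_dom_eq)
  have "zt (Suc k) - z k = dt *\<^sub>R (wave_op \<A> m - ?G m)" using dt by (simp flip: zt)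
  from arg_cong[OF this, of energy_map]
  have 1: "energy_map (zt (Suc k)) - energy_map (z k) = dt *\<^sub>R (wave_gen (energy_map m) - ?G m)"
    using fds wfst[OF m] half_op_zero(1) Gfst half_op_diff(1)
    by (simp add: energy_map_diff energy_map_scale energy_map_wave_op[OF m] G)
  have "z (Suc k) - zt (Suc k) = dt *\<^sub>R (dt\<^sup>2 *\<^sub>R wave_op \<A> (wave_op \<A> (z (Suc k))))"
    using dt by (simp flip: visc)
  also have "\<dots> = dt ^ 3 *\<^sub>R wave_op \<A> (wave_op \<A> (z (Suc k)))" by (simp add: eval_nat_numeral)
  finally have "z (Suc k) - zt (Suc k) = dt ^ 3 *\<^sub>R wave_op \<A> (wave_op \<A> (z (Suc k)))" .
  from arg_cong[OF this, of energy_map]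
  have 2: "energy_map (z (Suc k)) - energy_map (zt (Suc k)) = dt ^ 3 *\<^sub>R wave_gen (wave_gen (energy_map (z (Suc k))))"
    using fds wfst[OF z1(2)]
    by (simp add: energy_map_diff energy_map_scale energy_map_wave_op[OF z1(1)] energy_map_wave_op[OF z1(2)])
  have mm: "midpt (energy_map \<circ> z) (energy_map \<circ> zt) k = energy_map m" unfolding midpt_def by (rule mid)
  show ?thesis
    unfolding skew_operator.viscous_step_def[OF wave_skew] mm mid G(2)
    using 1 2 energy_map_dom[OF m] energy_map_dom[OF z1(1)] energy_map_dom[OF z1(2)]
    by (simp add: energy_map_wave_op[OF z1(1)])
qed

lemma energy_map_inv_free_orbit:
  assumes u: "skew_operator.viscous_orbit (half_dom \<times> half_dom) wave_gen dt (\<lambda>k. 0) u ut"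
    and dt: "dt > 0"
  shows "viscous_midpoint_solution D \<A> (wave_op \<A>) dt (energy_map_inv (u 0)) (energy_map_inv \<circ> u) (energy_map_inv \<circ> ut)"
  unfolding viscous_midpoint_solution_def
proof (intro conjI allI)
  interpret skew_operator "half_dom \<times> half_dom" wave_gen by (rule wave_skew)
  interpret \<Psi>: linear energy_map_inv by (rule energy_map_inv_linear)
  fix k
  have step: "viscous_step dt 0 (u k) (ut (Suc k)) (u (Suc k))" using u by (simp add: viscous_orbit_def)
  define m where "m = midpt u ut k"
  from step have m: "m \<in> half_dom \<times> half_dom" and ut: "ut (Suc k) - u k = dt *\<^sub>R wave_gen m"
    and u': "u (Suc k) \<in> half_dom \<times> half_dom" "wave_gen (u (Suc k)) \<in> half_dom \<times> half_dom"
    and visc: "u (Suc k) - ut (Suc k) = dt ^ 3 *\<^sub>R wave_gen (wave_gen (u (Suc k)))"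
    by (simp_all add: viscous_step_def m_def midpt_def)
  have mm: "midpt (energy_map_inv \<circ> u) (energy_map_inv \<circ> ut) k = energy_map_inv m"
    by (simp add: midpt_def m_def \<Psi>.add \<Psi>.scale)
  show "midpt (energy_map_inv \<circ> u) (energy_map_inv \<circ> ut) k \<in> wave_dom D \<A>"
    unfolding mm by (rule energy_map_inv_dom[OF m])
  show "((energy_map_inv \<circ> ut) (Suc k) - (energy_map_inv \<circ> u) k) /\<^sub>R dt
      = wave_op \<A> (midpt (energy_map_inv \<circ> u) (energy_map_inv \<circ> ut) k)"
    unfolding mm wave_op_energy_map_inv[OF m] using dt by (simp add: ut \<Psi>.scale flip: \<Psi>.diff)
  show "(energy_map_inv \<circ> u) (Suc k) \<in> wave_dom2 D \<A>"
    by (simp add: wave_dom2_def energy_map_inv_dom u' wave_op_energy_map_inv)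
  have "dt ^ 3 = dt * dt\<^sup>2" by (simp add: eval_nat_numeral)
  then show "((energy_map_inv \<circ> u) (Suc k) - (energy_map_inv \<circ> ut) (Suc k)) /\<^sub>R dt
      = dt\<^sup>2 *\<^sub>R wave_op \<A> (wave_op \<A> ((energy_map_inv \<circ> u) (Suc k)))"
    using dt by (simp add: wave_op_energy_map_inv u' visc \<Psi>.scale flip: \<Psi>.diff)
qed simp

end

lemma window_indices:
  assumes "dt > 0" "T > 0"
  shows "{k::nat. real k * dt \<in> {0..T}} = {..<Suc (nat \<lfloor>T / dt\<rfloor>)}"
proof -
  have "real k * dt \<in> {0..T} \<longleftrightarrow> k < Suc (nat \<lfloor>T / dt\<rfloor>)" for k
  proof -
    have "real k * dt \<in> {0..T} \<longleftrightarrow> real k * dt \<le> T" using assms(1) by simp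
    also have "real k * dt \<le> T \<longleftrightarrow> real_of_int (int k) \<le> T / dt" using assms by (simp add: field_simps)
    also have "\<dots> \<longleftrightarrow> int k \<le> \<lfloor>T / dt\<rfloor>" by (rule le_floor_iff[symmetric])
    also have "\<dots> \<longleftrightarrow> k \<le> nat \<lfloor>T / dt\<rfloor>" using assms by (simp add: le_nat_iff)
    also have "\<dots> \<longleftrightarrow> k < Suc (nat \<lfloor>T / dt\<rfloor>)" by (rule less_Suc_eq_le[symmetric])
    finally show ?thesis .
  qed
  then show ?thesis by (simp only: lessThan_def)
qed

theorem theorem3p1:
  fixes D :: "'x::{real_inner, complete_space} set"
    and \<A> :: "'x \<Rightarrow> 'x"
    and \<B> :: "'y::{real_inner, complete_space} \<Rightarrow> 'x"
    and T c \<beta> :: real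
  assumes "self_adjoint_op D \<A>"
    and "positive_op D \<A>"
    and "has_compact_inverse D \<A>"
    and "bounded_linear \<B>"
    and "T > 0" and "c > 0" and "\<beta> > - 1/2"
    and observability:
      "\<And>dt z0 u ut. \<lbrakk>dt > 0; z0 \<in> wave_dom D \<A>;
          viscous_midpoint_solution D \<A> (wave_op \<A>) dt z0 u ut\<rbrakk> \<Longrightarrow>
        c * ((X_norm D \<A> (- \<beta>) (fst (u 0)))\<^sup>2 + (X_norm D \<A> (- \<beta> - 1/2) (snd (u 0)))\<^sup>2)
          \<le> dt * (\<Sum>k | real k * dt \<in> {0..T}. (norm (ctrl_adj \<B> (midpt u ut k)))\<^sup>2)
            + dt * (\<Sum>k | real k * dt \<in> {0..T}. dt\<^sup>2 * (H_norm D \<A> (wave_op \<A> (u (Suc k))))\<^sup>2)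
            + dt * (\<Sum>k | real k * dt \<in> {0..T}.
                      dt ^ 5 * (H_norm D \<A> (wave_op \<A> (wave_op \<A> (u (Suc k)))))\<^sup>2)"
  shows "\<exists>M>0. \<forall>dt z0 z zt. 0 < dt \<and> dt < 1 \<and> z0 \<in> wave_dom D \<A> \<and>
          viscous_midpoint_solution D \<A>
            (\<lambda>w. wave_op \<A> w - ctrl_op \<B> (ctrl_adj \<B> w)) dt z0 z zt \<longrightarrow>
          (\<forall>k. 1/2 * (H_norm D \<A> (z k))\<^sup>2
                 \<le> M / (1 + real k * dt) powr (1 / (1 + 2 * \<beta>)) * (wave_dom_norm D \<A> z0)\<^sup>2)"
proof -
  interpret Sp: compact_positive_operator D \<A>
    by (rule compact_positive_operator.intro[OF assms(1-3)])
  define \<alpha> where "\<alpha> = 1 + 2 * \<beta>"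
  have \<alpha>: "\<alpha> > 0" using assms(7) by (simp add: \<alpha>_def)
  obtain b where damped: "damped_skew_operator (Sp.half_dom \<times> Sp.half_dom) Sp.wave_gen (ctrl_adj \<B>)
    (\<lambda>w. ctrl_op \<B> (ctrl_adj \<B> w)) b (1 / sqrt Sp.l0)"
    using Sp.wave_damped[OF assms(4)] ..
  interpret S: damped_skew_operator "Sp.half_dom \<times> Sp.half_dom" Sp.wave_gen "ctrl_adj \<B>"
    "\<lambda>w. ctrl_op \<B> (ctrl_adj \<B> w)" b "1 / sqrt Sp.l0" by (rule damped)
  have obs: "c * Sp.weak_energy \<alpha> (u 0) \<le> S.observation dt u ut (Suc (nat \<lfloor>T / dt\<rfloor>))"
    if dt: "0 < dt" and u0: "u 0 \<in> Sp.half_dom \<times> Sp.half_dom" and u: "S.viscous_orbit dt (\<lambda>k. 0) u ut"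
    for dt u ut
  proof -
    let ?v = "Sp.energy_map_inv \<circ> u" and ?vt = "Sp.energy_map_inv \<circ> ut"
    have v: "viscous_midpoint_solution D \<A> (wave_op \<A>) dt (Sp.energy_map_inv (u 0)) ?v ?vt"
      by (rule Sp.energy_map_inv_free_orbit[OF u dt])
    have dom: "u (Suc k) \<in> Sp.half_dom \<times> Sp.half_dom" "Sp.wave_gen (u (Suc k)) \<in> Sp.half_dom \<times> Sp.half_dom" for k
      using u by (simp_all add: S.viscous_orbit_def S.viscous_step_def)
    have ctrl: "ctrl_adj \<B> (midpt ?v ?vt k) = ctrl_adj \<B> (midpt u ut k)" for k
      by (simp add: ctrl_adj_def midpt_def Sp.energy_map_inv_def)
    have H1: "H_norm D \<A> (wave_op \<A> (?v (Suc k))) = norm (Sp.wave_gen (u (Suc k)))" for k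
      by (simp add: Sp.wave_op_energy_map_inv dom Sp.H_norm_eq Sp.energy_map_energy_map_inv)
    have H2: "H_norm D \<A> (wave_op \<A> (wave_op \<A> (?v (Suc k)))) = norm (Sp.wave_gen (Sp.wave_gen (u (Suc k))))" for k
      by (simp add: Sp.wave_op_energy_map_inv dom Sp.H_norm_eq Sp.energy_map_energy_map_inv)
    define a where "a = fst (Sp.energy_map_inv (u 0))"
    have a: "a \<in> Sp.half_dom" "Sp.half_op a = fst (u 0)"
      by (simp_all add: a_def Sp.energy_map_inv_def Sp.half_op_inv)
    have "(X_norm D \<A> (- \<beta>) (fst (?v 0)))\<^sup>2 + (X_norm D \<A> (- \<beta> - 1/2) (snd (?v 0)))\<^sup>2 = Sp.weak_energy \<alpha> (u 0)"
      using Sp.X_norms_eq_weak_energy[OF a(1), of \<beta> "snd (u 0)"] assms(7)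
      by (simp add: \<alpha>_def a(2)) (simp add: a_def Sp.energy_map_inv_def)
    then show ?thesis
      using observability[OF dt Sp.energy_map_inv_dom[OF u0] v]
      unfolding S.observation_def ctrl H1 H2 window_indices[OF dt assms(5)] by simp
  qed
  have interp: "(norm x)\<^sup>2 \<le> 2 * \<eta> * (norm (Sp.wave_gen y))\<^sup>2 + \<eta> powr (- \<alpha>) * Sp.weak_energy \<alpha> x
      + dt\<^sup>2 * (norm (Sp.wave_gen x))\<^sup>2"
    if "0 < dt" "0 < \<eta>" "y \<in> Sp.half_dom \<times> Sp.half_dom" "x \<in> Sp.half_dom \<times> Sp.half_dom"
      "y - dt *\<^sub>R Sp.wave_gen y = x" for dt \<eta> y x
    using that \<alpha> by (intro Sp.viscous_interpolation) auto
  have "\<exists>M>0. \<forall>dt z zt k. 0 < dt \<longrightarrow> dt < 1 \<longrightarrow> S.damped_orbit dt z zt \<longrightarrow>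
      z 0 \<in> Sp.half_dom \<times> Sp.half_dom \<longrightarrow>
      (norm (z k))\<^sup>2 \<le> M / (1 + real k * dt) powr (1 / \<alpha>) * (norm (Sp.wave_gen (z 0)))\<^sup>2"
    by (rule S.uniform_polynomial_decay[where W = "Sp.weak_energy \<alpha>", OF interp obs assms(6) assms(5) \<alpha>])
  then obtain M where M: "M > 0" and decay: "\<forall>dt z zt k. 0 < dt \<longrightarrow> dt < 1 \<longrightarrow> S.damped_orbit dt z zt \<longrightarrow>
      z 0 \<in> Sp.half_dom \<times> Sp.half_dom \<longrightarrow>
      (norm (z k))\<^sup>2 \<le> M / (1 + real k * dt) powr (1 / \<alpha>) * (norm (Sp.wave_gen (z 0)))\<^sup>2"
    by (elim exE conjE) (rule that)
  show ?thesis
  proof (intro exI[of _ M] conjI allI impI M)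
    fix dt z0 z zt k
    assume *: "0 < dt \<and> dt < 1 \<and> z0 \<in> wave_dom D \<A> \<and>
          viscous_midpoint_solution D \<A> (\<lambda>w. wave_op \<A> w - ctrl_op \<B> (ctrl_adj \<B> w)) dt z0 z zt"
    then have dt: "0 < dt" "dt < 1" and z0: "z0 \<in> wave_dom D \<A>" "z 0 = z0"
      by (auto simp: viscous_midpoint_solution_def)
    have orbit: "S.damped_orbit dt (Sp.energy_map \<circ> z) (Sp.energy_map \<circ> zt)"
      unfolding S.damped_orbit_def S.viscous_orbit_def
      by (intro allI Sp.energy_map_damped_step[OF _ z0(1) dt(1)]) (use * in \<open>elim conjE\<close>)
    have "wave_dom_norm D \<A> z0 = norm (Sp.energy_map (wave_op \<A> z0))"
      by (simp add: wave_dom_norm_def Sp.energy_map_def norm_prod_def Sp.power_op_half wave_op_def add.commute)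
    then have graph: "norm (Sp.wave_gen ((Sp.energy_map \<circ> z) 0)) = wave_dom_norm D \<A> z0"
      using z0 by (simp add: Sp.energy_map_wave_op)
    have "1/2 * (H_norm D \<A> (z k))\<^sup>2 \<le> (norm ((Sp.energy_map \<circ> z) k))\<^sup>2" by (simp add: Sp.H_norm_eq)
    also have "\<dots> \<le> M / (1 + real k * dt) powr (1 / \<alpha>) * (wave_dom_norm D \<A> z0)\<^sup>2"
      using decay[rule_format, OF dt orbit, of k] Sp.energy_map_dom[OF z0(1)] z0(2) unfolding graph by simp
    finally show "1/2 * (H_norm D \<A> (z k))\<^sup>2
        \<le> M / (1 + real k * dt) powr (1 / (1 + 2 * \<beta>)) * (wave_dom_norm D \<A> z0)\<^sup>2"
      by (simp add: \<alpha>_def)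
  qed
qed

end
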